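(* Let $S\geq R$ be an excellent extension of Artin algebras. Then for every integer $j\geq 0$, $$\mathrm{ext.dim}(\Omega^{j}(R\text{-}\mathrm{mod}))=\mathrm{ext.dim}(\Omega^{j}(S\text{-}\mathrm{mod}))\quad\text{and}\quad \mathrm{ext.dim}(\Omega^{j}(\mathcal{P}^{<\infty}(R)))=\mathrm{ext.dim}(\Omega^{j}(\mathcal{P}^{<\infty}(S))).$$
   Context: All rings are Artin $k$-algebras with unit, where $k$ is a fixed commutative Artin ring, and all modules are finitely generated left modules unless otherwise indicated. For an Artin algebra $A$, $A\text{-}\mathrm{mod}$ is the category of finitely generated left $A$-modules; subcategories of $A\text{-}\mathrm{mod}$ are full, additive and closed under isomorphisms. Extension dimension. For a subcategory (or class of objects) $\mathcal{U}$ of $A\text{-}\mathrm{mod}$, $\mathrm{add}(\mathcal{U})$ is the smallest full subcategory of $A\text{-}\mathrm{mod}$ containing $\mathcal{U}$ and closed under finite direct sums and direct summands. For subcategories $\mathcal{U},\mathcal{V}$, $\mathcal{U}\ast\mathcal{V}$ is the full subcategory of modules $X$ fitting into a short exact sequence $0\to U\to X\to V\to 0$ with $U\in\mathcal{U}$, $V\in\mathcal{V}$. Put $[\mathcal{U}]_0$ = the zero modules, $[\mathcal{U}]_1=\mathrm{add}(\mathcal{U})$, and $[\mathcal{U}]_n=\mathrm{add}([\mathcal{U}]_{n-1}\ast[\mathcal{U}]_1)$ for $n\geq 2$; write $[M]_n=[\{M\}]_n$ for a module $M$. The extension dimension is $\mathrm{ext.dim}(\mathcal{U})=\inf\{n\geq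 0\mid \mathcal{U}\subseteq [N]_{n+1}\text{ for some }N\in A\text{-}\mathrm{mod}\}$, or $\infty$ if no such $n$ exists. Syzygies. For $n\geq 1$ and $M\in A\text{-}\mathrm{mod}$, a module $K$ is an $n$-th syzygy module of $M$ if there is an exact sequence $\cdots\to P_n\to P_{n-1}\to\cdots\to P_0\to M\to 0$ in $A\text{-}\mathrm{mod}$ with all $P_i$ projective and $K\cong\mathrm{Im}(P_n\to P_{n-1})$; the $0$-th syzygy of $M$ is $M$ (up to isomorphism). For a subcategory $\mathcal{X}$ of $A\text{-}\mathrm{mod}$, $\Omega^n(\mathcal{X})$ is the full subcategory of all $n$-th syzygy modules of modules in $\mathcal{X}$; in particular $\Omega^n(A\text{-}\mathrm{mod})$ consists of all $n$-th syzygy modules and $\Omega^0(A\text{-}\mathrm{mod})=A\text{-}\mathrm{mod}$. $\mathcal{P}^{<\infty}(A)$ is the subcategory of modules in $A\text{-}\mathrm{mod}$ of finite projective dimension. Excellent extension. If $R$ is a subring of $S$ with the same unit, one writes $S\geq R$ (a ring extension). It is an excellent extension if: (1) for every $S$-module $M$ and $S$-submodule $N$ of $M$, if $N$ is a direct summand of $M$ as an $R$-module, then $N$ is a direct summand of $M$ as an $S$-module; (2) there is a finite set $\{s_1,\dots,s_n\}\subseteq S$ with $S=\sum_{j=1}^n Rs_j$; (3) ${}_RS$ and $S_R$ are free with common basis $\{s_1,\dots,s_n\}$ such that $Rs_j=s_jR$ for $1\leq j\leq n$. *)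

theory Defs
  imports "HOL-Algebra.Module" "HOL-Algebra.Ideal" "HOL-Algebra.Subrings" "HOL-Library.Extended_Nat"
begin

section \<open>Left modules over a not necessarily commutative ring\<close>

text \<open>
  The locale \<^locale>\<open>module\<close> of HOL-Algebra requires a commutative ring of scalars. We keep its
  record type and its axioms, but over an arbitrary ring. The fields \<^const>\<open>monoid.mult\<close> and \<^const>\<open>monoid.one\<close>
  of a module record are never used.
\<close>

locale left_module = A?: ring A + M?: abelian_group M
  for A :: "('a, 'r) ring_scheme" (structure) and M :: "('a, 'm, 'x) module_scheme" (structure) +
  assumes smult_closed [simp, intro]:
      "\<lbrakk>a \<in> carrier A; x \<in> carrier M\<rbrakk> \<Longrightarrow> a \<odot>\<^bsub>M\<^esub> x \<in> carrier M"
    and smult_l_distr: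
      "\<lbrakk>a \<in> carrier A; b \<in> carrier A; x \<in> carrier M\<rbrakk> \<Longrightarrow>
      (a \<oplus> b) \<odot>\<^bsub>M\<^esub> x = a \<odot>\<^bsub>M\<^esub> x \<oplus>\<^bsub>M\<^esub> b \<odot>\<^bsub>M\<^esub> x"
    and smult_r_distr:
      "\<lbrakk>a \<in> carrier A; x \<in> carrier M; y \<in> carrier M\<rbrakk> \<Longrightarrow>
      a \<odot>\<^bsub>M\<^esub> (x \<oplus>\<^bsub>M\<^esub> y) = a \<odot>\<^bsub>M\<^esub> x \<oplus>\<^bsub>M\<^esub> a \<odot>\<^bsub>M\<^esub> y"
    and smult_assoc1:
      "\<lbrakk>a \<in> carrier A; b \<in> carrier A; x \<in> carrier M\<rbrakk> \<Longrightarrow>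
      (a \<otimes> b) \<odot>\<^bsub>M\<^esub> x = a \<odot>\<^bsub>M\<^esub> (b \<odot>\<^bsub>M\<^esub> x)"
    and smult_one [simp]:
      "x \<in> carrier M \<Longrightarrow> \<one> \<odot>\<^bsub>M\<^esub> x = x"

definition fin_gen_module ::
    "('a, 'r) ring_scheme \<Rightarrow> ('a, 'm, 'x) module_scheme \<Rightarrow> bool" where
  "fin_gen_module A M \<longleftrightarrow>
    (\<exists>G. finite G \<and> G \<subseteq> carrier M \<and>
      (\<forall>x \<in> carrier M. \<exists>c \<in> G \<rightarrow> carrier A. x = (\<Oplus>\<^bsub>M\<^esub>g\<in>G. c g \<odot>\<^bsub>M\<^esub> g)))"

definition lmod_hom ::
    "('a, 'r) ring_scheme \<Rightarrow> ('a, 'm, 'x) module_scheme \<Rightarrow> ('a, 'n, 'y) module_scheme \<Rightarrow>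
      ('m \<Rightarrow> 'n) set" where
  "lmod_hom A M N =
    {f \<in> carrier M \<rightarrow> carrier N.
      (\<forall>x \<in> carrier M. \<forall>y \<in> carrier M. f (x \<oplus>\<^bsub>M\<^esub> y) = f x \<oplus>\<^bsub>N\<^esub> f y) \<and>
      (\<forall>a \<in> carrier A. \<forall>x \<in> carrier M. f (a \<odot>\<^bsub>M\<^esub> x) = a \<odot>\<^bsub>N\<^esub> f x)}"

definition lmod_iso ::
    "('a, 'r) ring_scheme \<Rightarrow> ('a, 'm, 'x) module_scheme \<Rightarrow> ('a, 'n, 'y) module_scheme \<Rightarrow>
      bool" where
  "lmod_iso A M N \<longleftrightarrow> (\<exists>f \<in> lmod_hom A M N. bij_betw f (carrier M) (carrier N))"

definition dsum ::
    "('a, 'm, 'x) module_scheme \<Rightarrow> ('a, 'n, 'y) module_scheme \<Rightarrow> ('a, 'm \<times> 'n) module" where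
  "dsum M N =
    \<lparr>carrier = carrier M \<times> carrier N,
     monoid.mult = undefined, monoid.one = undefined,
     ring.zero = (\<zero>\<^bsub>M\<^esub>, \<zero>\<^bsub>N\<^esub>),
     ring.add = (\<lambda>(x, y) (x', y'). (x \<oplus>\<^bsub>M\<^esub> x', y \<oplus>\<^bsub>N\<^esub> y')),
     module.smult = (\<lambda>a (x, y). (a \<odot>\<^bsub>M\<^esub> x, a \<odot>\<^bsub>N\<^esub> y))\<rparr>"

definition direct_summand ::
    "('a, 'r) ring_scheme \<Rightarrow> ('a, 'm, 'x) module_scheme \<Rightarrow> 'm set \<Rightarrow> bool" where
  "direct_summand A M N \<longleftrightarrow>
    submodule N A M \<and>
    (\<exists>N'. submodule N' A M \<and> N <+>\<^bsub>M\<^esub> N' = carrier M \<and> N \<inter> N' = {\<zero>\<^bsub>M\<^esub>})"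


section \<open>The category of finitely generated modules\<close>

text \<open>
  A set of modules in HOL needs a fixed type for the underlying sets. A module generated by
  \<open>n\<close> elements is a quotient of \<open>A\<^sup>n\<close>, so its elements can be taken to be cosets in \<open>A\<^sup>n\<close>, that is,
  sets of coefficient vectors. Hence every finitely generated \<open>A\<close>-module, whatever the type of its
  elements, is isomorphic to one with elements of type \<open>(nat \<Rightarrow> 'a) set\<close>; this is proved below as
  \<open>fg_mods_exhaustive\<close>. Full subcategories are represented by their sets of objects.
\<close>

type_synonym 'a fg_module = "('a, (nat \<Rightarrow> 'a) set) module"

definition fg_mods :: "('a, 'r) ring_scheme \<Rightarrow> 'a fg_module set" where
  "fg_mods A = {M. left_module A M \<and> fin_gen_module A M}"

lemma fg_mods_exhaustive:
  fixes A :: "('a, 'r) ring_scheme" and M :: "('a, 'm, 'x) module_scheme"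
  assumes "left_module A M" "fin_gen_module A M"
  shows "\<exists>M' \<in> fg_mods A. lmod_iso A M M'"
proof -
  interpret left_module A M by fact
  obtain G where G: "finite G" "G \<subseteq> carrier M"
    and gen: "\<And>x. x \<in> carrier M \<Longrightarrow> \<exists>c \<in> G \<rightarrow> carrier A. x = (\<Oplus>\<^bsub>M\<^esub>g\<in>G. c g \<odot>\<^bsub>M\<^esub> g)"
    using assms(2) unfolding fin_gen_module_def by blast
  obtain e :: "'m \<Rightarrow> nat" where e: "inj_on e G"
    using finite_imp_inj_to_nat_seg[OF G(1)] by blast
  define h where
    "h x = {c. (\<lambda>g. c (e g)) \<in> G \<rightarrow> carrier A \<and> x = (\<Oplus>\<^bsub>M\<^esub>g\<in>G. c (e g) \<odot>\<^bsub>M\<^esub> g)}" for x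
  have ne: "h x \<noteq> {}" if x: "x \<in> carrier M" for x
  proof -
    obtain c where c: "c \<in> G \<rightarrow> carrier A" "x = (\<Oplus>\<^bsub>M\<^esub>g\<in>G. c g \<odot>\<^bsub>M\<^esub> g)" using gen[OF x] by blast
    have inv: "inv_into G e (e g) = g" if "g \<in> G" for g using e that by simp
    have "(\<Oplus>\<^bsub>M\<^esub>g\<in>G. c (inv_into G e (e g)) \<odot>\<^bsub>M\<^esub> g) = (\<Oplus>\<^bsub>M\<^esub>g\<in>G. c g \<odot>\<^bsub>M\<^esub> g)"
      using c(1) G(2) by (intro M.finsum_cong') (auto simp: inv Pi_iff subset_iff)
    then have "c \<circ> inv_into G e \<in> h x" using c inv by (auto simp: h_def)
    then show ?thesis by blast
  qed
  have inj: "inj_on h (carrier M)"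
  proof (rule inj_onI)
    fix x y assume xy: "x \<in> carrier M" "y \<in> carrier M" "h x = h y"
    obtain c where "c \<in> h x" using ne[OF xy(1)] by blast
    moreover from this xy(3) have "c \<in> h y" by simp
    ultimately show "x = y" unfolding h_def by simp
  qed
  define k where "k = inv_into (carrier M) h"
  have k: "k (h x) = x" if "x \<in> carrier M" for x
    using inj that by (simp add: k_def)
  define M' :: "'a fg_module" where
    "M' = \<lparr>carrier = h ` carrier M, monoid.mult = undefined, monoid.one = undefined,
      ring.zero = h \<zero>\<^bsub>M\<^esub>, ring.add = (\<lambda>u v. h (k u \<oplus>\<^bsub>M\<^esub> k v)), module.smult = (\<lambda>a u. h (a \<odot>\<^bsub>M\<^esub> k u))\<rparr>"
  have ab: "abelian_group M'"
  proof (rule abelian_groupI)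
    fix u assume "u \<in> carrier M'"
    then obtain x where x: "x \<in> carrier M" "u = h x" by (auto simp: M'_def)
    show "\<exists>v\<in>carrier M'. v \<oplus>\<^bsub>M'\<^esub> u = \<zero>\<^bsub>M'\<^esub>"
      using x by (intro bexI[of _ "h (\<ominus>\<^bsub>M\<^esub> x)"]) (auto simp: M'_def k M.l_neg)
  qed (auto simp: M'_def k M.a_ac)
  have lm: "left_module A M'"
  proof -
    interpret M': abelian_group M' by (rule ab)
    show ?thesis
      by unfold_locales
        (auto simp: M'_def k smult_l_distr smult_r_distr smult_assoc1)
  qed
  interpret M': left_module A M' by (rule lm)
  have hom: "h \<in> lmod_hom A M M'"
    by (auto simp: lmod_hom_def M'_def k)
  have hsum: "h (\<Oplus>\<^bsub>M\<^esub>g\<in>F. f g) = (\<Oplus>\<^bsub>M'\<^esub>g\<in>F. h (f g))"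
    if "finite F" "f \<in> F \<rightarrow> carrier M" for F :: "'m set" and f
    using that
  proof (induction F rule: finite_induct)
    case empty
    have "\<zero>\<^bsub>M'\<^esub> = h \<zero>\<^bsub>M\<^esub>" by (simp add: M'_def)
    then show ?case by simp
  next
    case (insert a F)
    have f: "f \<in> F \<rightarrow> carrier M" "f a \<in> carrier M" "(\<lambda>g. h (f g)) \<in> F \<rightarrow> carrier M'"
      "h (f a) \<in> carrier M'"
      using insert.prems by (auto simp: M'_def)
    have add: "h (x \<oplus>\<^bsub>M\<^esub> y) = h x \<oplus>\<^bsub>M'\<^esub> h y" if "x \<in> carrier M" "y \<in> carrier M" for x y
      using hom that by (auto simp: lmod_hom_def)
    show ?case
      using insert.IH[OF f(1)] f insert.hyps
      by (simp add: add)
  qed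
  have "fin_gen_module A M'"
    unfolding fin_gen_module_def
  proof (intro exI conjI ballI)
    show "finite (h ` G)" "h ` G \<subseteq> carrier M'" using G by (auto simp: M'_def)
    fix u assume "u \<in> carrier M'"
    then obtain x where x: "x \<in> carrier M" "u = h x" by (auto simp: M'_def)
    obtain c where c: "c \<in> G \<rightarrow> carrier A" "x = (\<Oplus>\<^bsub>M\<^esub>g\<in>G. c g \<odot>\<^bsub>M\<^esub> g)" using gen[OF x(1)] by blast
    have kG: "k (h g) = g" if "g \<in> G" for g using k that G(2) by blast
    have inG: "inj_on h G" using inj G(2) by (rule inj_on_subset)
    have "u = (\<Oplus>\<^bsub>M'\<^esub>g\<in>G. h (c g \<odot>\<^bsub>M\<^esub> g))"
      unfolding x(2) c(2) using c(1) G by (intro hsum) (auto simp: Pi_iff subset_iff)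
    also have "\<dots> = (\<Oplus>\<^bsub>M'\<^esub>g\<in>G. c (k (h g)) \<odot>\<^bsub>M'\<^esub> h g)"
      using c(1) G(2)
      by (intro M'.finsum_cong') (auto simp: M'_def kG Pi_iff subset_iff)
    also have "\<dots> = (\<Oplus>\<^bsub>M'\<^esub>v\<in>h ` G. c (k v) \<odot>\<^bsub>M'\<^esub> v)"
      using c(1) G(2) inG
      by (intro M'.finsum_reindex[symmetric]) (auto simp: M'_def kG Pi_iff subset_iff)
    finally show "\<exists>c \<in> h ` G \<rightarrow> carrier A. u = (\<Oplus>\<^bsub>M'\<^esub>v\<in>h ` G. c v \<odot>\<^bsub>M'\<^esub> v)"
      using c(1) by (intro bexI[of _ "\<lambda>v. c (k v)"]) (auto simp: kG Pi_iff)
  qed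
  moreover have "lmod_iso A M M'"
    unfolding lmod_iso_def using hom inj by (auto simp: bij_betw_def M'_def)
  ultimately show ?thesis using lm by (auto simp: fg_mods_def)
qed


section \<open>Extension dimension\<close>

inductive_set add_closure ::
    "('a, 'r) ring_scheme \<Rightarrow> 'a fg_module set \<Rightarrow> 'a fg_module set"
  for A :: "('a, 'r) ring_scheme" and U :: "'a fg_module set" where
  incl: "M \<in> fg_mods A \<Longrightarrow> M \<in> U \<Longrightarrow> M \<in> add_closure A U"
| iso: "M \<in> add_closure A U \<Longrightarrow> N \<in> fg_mods A \<Longrightarrow> lmod_iso A M N \<Longrightarrow> N \<in> add_closure A U"
| zero: "M \<in> fg_mods A \<Longrightarrow> carrier M = {\<zero>\<^bsub>M\<^esub>} \<Longrightarrow> M \<in> add_closure A U"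
| sum: "M \<in> add_closure A U \<Longrightarrow> N \<in> add_closure A U \<Longrightarrow> X \<in> fg_mods A \<Longrightarrow>
    lmod_iso A (dsum M N) X \<Longrightarrow> X \<in> add_closure A U"
| summand: "X \<in> add_closure A U \<Longrightarrow> M \<in> fg_mods A \<Longrightarrow> N \<in> fg_mods A \<Longrightarrow>
    lmod_iso A (dsum M N) X \<Longrightarrow> M \<in> add_closure A U"

definition short_exact ::
    "('a, 'r) ring_scheme \<Rightarrow> ('a, 'l, 'x) module_scheme \<Rightarrow> ('l \<Rightarrow> 'm) \<Rightarrow>
      ('a, 'm, 'y) module_scheme \<Rightarrow> ('m \<Rightarrow> 'n) \<Rightarrow> ('a, 'n, 'z) module_scheme \<Rightarrow> bool" where
  "short_exact A U f X g V \<longleftrightarrow>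
    f \<in> lmod_hom A U X \<and> g \<in> lmod_hom A X V \<and>
    inj_on f (carrier U) \<and> f ` carrier U = a_kernel X V g \<and> g ` carrier X = carrier V"

definition extensions ::
    "('a, 'r) ring_scheme \<Rightarrow> 'a fg_module set \<Rightarrow> 'a fg_module set \<Rightarrow> 'a fg_module set" where
  "extensions A \<U> \<V> = {X \<in> fg_mods A. \<exists>U \<in> \<U>. \<exists>V \<in> \<V>. \<exists>f g. short_exact A U f X g V}"

fun ext_layer ::
    "('a, 'r) ring_scheme \<Rightarrow> 'a fg_module set \<Rightarrow> nat \<Rightarrow> 'a fg_module set" where
  "ext_layer A \<U> 0 = {M \<in> fg_mods A. carrier M = {\<zero>\<^bsub>M\<^esub>}}"
| "ext_layer A \<U> (Suc 0) = add_closure A \<U>"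
| "ext_layer A \<U> (Suc (Suc n)) =
    add_closure A (extensions A (ext_layer A \<U> (Suc n)) (ext_layer A \<U> (Suc 0)))"

text \<open>The infimum of the empty set in \<^typ>\<open>enat\<close> is \<open>\<infinity>\<close>.\<close>

definition ext_dim :: "('a, 'r) ring_scheme \<Rightarrow> 'a fg_module set \<Rightarrow> enat" where
  "ext_dim A \<U> = (INF n \<in> {n. \<exists>N \<in> fg_mods A. \<U> \<subseteq> ext_layer A {N} (n + 1)}. enat n)"


section \<open>Syzygies and projective dimension\<close>

text \<open>
  Testing against surjections between finitely generated modules is enough: a finitely generated
  \<open>P\<close> is a quotient of some \<open>A\<^sup>n\<close>, and lifting the identity of \<open>P\<close> makes it a summand of \<open>A\<^sup>n\<close>.
\<close>

definition fg_projective :: "('a, 'r) ring_scheme \<Rightarrow> 'a fg_module \<Rightarrow> bool" where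
  "fg_projective A P \<longleftrightarrow>
    P \<in> fg_mods A \<and>
    (\<forall>M \<in> fg_mods A. \<forall>N \<in> fg_mods A. \<forall>g \<in> lmod_hom A M N. \<forall>f \<in> lmod_hom A P N.
      g ` carrier M = carrier N \<longrightarrow>
      (\<exists>h \<in> lmod_hom A P M. \<forall>x \<in> carrier P. g (h x) = f x))"

text \<open>\<open>d 0\<close> is the augmentation \<open>P 0 \<rightarrow> M\<close>, and \<open>d (Suc i)\<close> is the map \<open>P (Suc i) \<rightarrow> P i\<close>.\<close>

definition proj_resolution ::
    "('a, 'r) ring_scheme \<Rightarrow> (nat \<Rightarrow> 'a fg_module) \<Rightarrow>
      (nat \<Rightarrow> (nat \<Rightarrow> 'a) set \<Rightarrow> (nat \<Rightarrow> 'a) set) \<Rightarrow> 'a fg_module \<Rightarrow> bool" where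
  "proj_resolution A P d M \<longleftrightarrow>
    (\<forall>i. fg_projective A (P i)) \<and>
    d 0 \<in> lmod_hom A (P 0) M \<and> d 0 ` carrier (P 0) = carrier M \<and>
    (\<forall>i. d (Suc i) \<in> lmod_hom A (P (Suc i)) (P i)) \<and>
    d 1 ` carrier (P 1) = a_kernel (P 0) M (d 0) \<and>
    (\<forall>i. d (Suc (Suc i)) ` carrier (P (Suc (Suc i))) =
      a_kernel (P (Suc i)) (P i) (d (Suc i)))"

fun is_syzygy ::
    "('a, 'r) ring_scheme \<Rightarrow> nat \<Rightarrow> 'a fg_module \<Rightarrow> 'a fg_module \<Rightarrow> bool" where
  "is_syzygy A 0 M K \<longleftrightarrow> lmod_iso A K M"
| "is_syzygy A (Suc n) M K \<longleftrightarrow>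
    (\<exists>P d. proj_resolution A P d M \<and>
      lmod_iso A K ((P n)\<lparr>carrier := d (Suc n) ` carrier (P (Suc n))\<rparr>))"

definition syzygies ::
    "('a, 'r) ring_scheme \<Rightarrow> nat \<Rightarrow> 'a fg_module set \<Rightarrow> 'a fg_module set" where
  "syzygies A n \<X> = {K \<in> fg_mods A. \<exists>M \<in> \<X>. is_syzygy A n M K}"

definition proj_dim :: "('a, 'r) ring_scheme \<Rightarrow> 'a fg_module \<Rightarrow> enat" where
  "proj_dim A M =
    (INF n \<in> {n. \<exists>P d. proj_resolution A P d M \<and> (\<forall>i > n. carrier (P i) = {\<zero>\<^bsub>P i\<^esub>})}. enat n)"

definition fin_proj_dim_mods :: "('a, 'r) ring_scheme \<Rightarrow> 'a fg_module set" where
  "fin_proj_dim_mods A = {M \<in> fg_mods A. proj_dim A M < \<infinity>}"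


section \<open>Artin algebras and excellent extensions\<close>

definition artinian_cring :: "('k, 'l) ring_scheme \<Rightarrow> bool" where
  "artinian_cring k \<longleftrightarrow>
    cring k \<and>
    (\<forall>I :: nat \<Rightarrow> 'k set.
      (\<forall>n. ideal (I n) k \<and> I (Suc n) \<subseteq> I n) \<longrightarrow> (\<exists>m. \<forall>n \<ge> m. I n = I m))"

text \<open>The \<open>k\<close>-algebra structure of \<open>A\<close> is given by a unital ring homomorphism into the centre.\<close>

definition artin_algebra ::
    "('k, 'l) ring_scheme \<Rightarrow> ('k \<Rightarrow> 'a) \<Rightarrow> ('a, 'r) ring_scheme \<Rightarrow> bool" where
  "artin_algebra k \<eta> A \<longleftrightarrow>
    artinian_cring k \<and> ring A \<and> \<eta> \<in> ring_hom k A \<and>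
    (\<forall>c \<in> carrier k. \<forall>x \<in> carrier A. \<eta> c \<otimes>\<^bsub>A\<^esub> x = x \<otimes>\<^bsub>A\<^esub> \<eta> c) \<and>
    (\<exists>G. finite G \<and> G \<subseteq> carrier A \<and>
      (\<forall>x \<in> carrier A. \<exists>c \<in> G \<rightarrow> carrier k. x = (\<Oplus>\<^bsub>A\<^esub>g\<in>G. \<eta> (c g) \<otimes>\<^bsub>A\<^esub> g)))"

text \<open>
  The subring \<open>R\<close> is given by its carrier, so the ring \<open>R\<close> is \<open>S\<lparr>carrier := R\<rparr>\<close>, and an
  \<open>S\<close>-module, viewed as an \<open>R\<close>-module by restriction of scalars, is the same record.
\<close>

definition free_left_basis :: "'a set \<Rightarrow> ('a, 'r) ring_scheme \<Rightarrow> 'a set \<Rightarrow> bool" where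
  "free_left_basis R S B \<longleftrightarrow>
    finite B \<and> B \<subseteq> carrier S \<and>
    (\<forall>x \<in> carrier S. \<exists>r \<in> B \<rightarrow> R. x = (\<Oplus>\<^bsub>S\<^esub>b\<in>B. r b \<otimes>\<^bsub>S\<^esub> b)) \<and>
    (\<forall>r \<in> B \<rightarrow> R. (\<Oplus>\<^bsub>S\<^esub>b\<in>B. r b \<otimes>\<^bsub>S\<^esub> b) = \<zero>\<^bsub>S\<^esub> \<longrightarrow> (\<forall>b \<in> B. r b = \<zero>\<^bsub>S\<^esub>))"

definition free_right_basis :: "'a set \<Rightarrow> ('a, 'r) ring_scheme \<Rightarrow> 'a set \<Rightarrow> bool" where
  "free_right_basis R S B \<longleftrightarrow>
    finite B \<and> B \<subseteq> carrier S \<and>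
    (\<forall>x \<in> carrier S. \<exists>r \<in> B \<rightarrow> R. x = (\<Oplus>\<^bsub>S\<^esub>b\<in>B. b \<otimes>\<^bsub>S\<^esub> r b)) \<and>
    (\<forall>r \<in> B \<rightarrow> R. (\<Oplus>\<^bsub>S\<^esub>b\<in>B. b \<otimes>\<^bsub>S\<^esub> r b) = \<zero>\<^bsub>S\<^esub> \<longrightarrow> (\<forall>b \<in> B. r b = \<zero>\<^bsub>S\<^esub>))"

text \<open>
  The condition that \<open>S\<close> is the sum of the \<open>R b\<close> is part of \<^const>\<open>free_left_basis\<close>.
\<close>

definition excellent_extension :: "'a set \<Rightarrow> ('a, 'r) ring_scheme \<Rightarrow> bool" where
  "excellent_extension R S \<longleftrightarrow>
    ring S \<and> subring R S \<and>
    (\<forall>M \<in> fg_mods S. \<forall>N. submodule N S M \<longrightarrow>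
      direct_summand (S\<lparr>carrier := R\<rparr>) M N \<longrightarrow> direct_summand S M N) \<and>
    (\<exists>B. free_left_basis R S B \<and> free_right_basis R S B \<and>
      (\<forall>b \<in> B. (\<lambda>r. r \<otimes>\<^bsub>S\<^esub> b) ` R = (\<lambda>r. b \<otimes>\<^bsub>S\<^esub> r) ` R))"

end

theory Submission
  imports Defs
begin

text \<open>
  Write \<open>R\<close> also for the ring \<open>S\<lparr>carrier := R\<rparr>\<close>. Restriction of scalars from \<open>S\<close> to \<open>R\<close> and induction
  \<open>S \<otimes> _\<close> from \<open>R\<close> to \<open>S\<close> are exact and preserve finitely generated projectives, because \<open>S\<close> is free of
  finite rank over \<open>R\<close> on both sides. An exact functor with these properties maps \<open>[N]\<^sub>n\<close> into
  \<open>[F N]\<^sub>n\<close>, projective resolutions to projective resolutions, hence syzygies to syzygies and modules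
  of finite projective dimension to modules of finite projective dimension. This part is the locale
  \<open>exact_functor\<close>.

  Suppose now that the syzygy class over \<open>S\<close> lies in \<open>[N]\<^sub>n\<close> with \<open>n > 0\<close>, and let \<open>K\<close> be in the
  corresponding class over \<open>R\<close>. Then \<open>S \<otimes> K\<close> is in the class over \<open>S\<close>, so its restriction lies in a
  layer generated by the restriction of \<open>N\<close>. Layers are closed under direct summands. So it remains
  to find \<open>K\<close> among the summands of a restriction of \<open>S \<otimes> K\<close>. The same argument works with the
  roles of the two rings exchanged (\<open>ext_dim_syzygies_le_of_retract\<close>). There are two retractions:

  \<^item> An \<open>S\<close>-module \<open>K\<close> is a direct summand of \<open>S \<otimes> K\<close>. The multiplication map \<open>S \<otimes> K \<rightarrow> K\<close> has the
    \<open>R\<close>-linear section \<open>x \<mapsto> 1 \<otimes> x\<close>, so its kernel is a direct summand over \<open>R\<close>, and then over \<open>S\<close>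
    by the first condition on excellent extensions (\<open>ext_dim_over_S_le\<close>).

  \<^item> For an \<open>R\<close>-module \<open>K\<close>, the restriction of \<open>S \<otimes> K\<close> is the direct sum of the \<open>b \<otimes> K\<close>, where \<open>b\<close>
    runs over the basis. As \<open>R b = b R\<close>, there is an automorphism \<open>\<phi>\<close> of \<open>R\<close> with \<open>\<phi> r b = b r\<close>, and
    \<open>b \<otimes> K\<close> is \<open>K\<close> twisted by the inverse of \<open>\<phi>\<close>. Restricting along \<open>\<phi>\<close> instead of along the inclusion
    undoes the twist for this \<open>b\<close> and exhibits \<open>K\<close> as a direct summand (\<open>ext_dim_over_R_le\<close>). Any
    basis element serves, so the unit of \<open>S\<close> may or may not be one of them.

  Two choices keep the module theory elementary. The module \<open>S \<otimes> K\<close> is the set of vectors over \<open>K\<close>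
  indexed by the right basis, with \<open>S\<close> acting by matrices, so no tensor products are formed and
  exactness is visible in each component. Projectivity of restricted modules is deduced from the
  dual basis lemma, and that of induced modules from the adjunction with restriction.
\<close>


section \<open>Additive maps and finite sums\<close>

lemma additive_zero:
  assumes "abelian_group G" "abelian_group H" "f \<in> hom (add_monoid G) (add_monoid H)"
  shows "f \<zero>\<^bsub>G\<^esub> = \<zero>\<^bsub>H\<^esub>"
proof -
  interpret G: abelian_group G by fact
  interpret H: abelian_group H by fact
  have c: "f \<zero>\<^bsub>G\<^esub> \<in> carrier H" using assms(3) by (auto simp: hom_def)
  have "f (\<zero>\<^bsub>G\<^esub> \<oplus>\<^bsub>G\<^esub> \<zero>\<^bsub>G\<^esub>) = f \<zero>\<^bsub>G\<^esub> \<oplus>\<^bsub>H\<^esub> f \<zero>\<^bsub>G\<^esub>"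
    using assms(3) G.zero_closed by (simp add: hom_def del: G.l_zero G.r_zero)
  then show ?thesis using c H.add.r_cancel_one'[OF c c] by simp
qed

lemma additive_finsum:
  assumes "abelian_group G" "abelian_group H" "f \<in> hom (add_monoid G) (add_monoid H)"
    and "g \<in> I \<rightarrow> carrier G"
  shows "f (\<Oplus>\<^bsub>G\<^esub>i\<in>I. g i) = (\<Oplus>\<^bsub>H\<^esub>i\<in>I. f (g i))"
proof -
  interpret G: abelian_group G by fact
  interpret H: abelian_group H by fact
  have f: "f x \<in> carrier H" if "x \<in> carrier G" for x using assms(3) that by (auto simp: hom_def)
  have add: "f (x \<oplus>\<^bsub>G\<^esub> y) = f x \<oplus>\<^bsub>H\<^esub> f y" if "x \<in> carrier G" "y \<in> carrier G" for x y
    using assms(3) that by (auto simp: hom_def)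
  have z: "f \<zero>\<^bsub>G\<^esub> = \<zero>\<^bsub>H\<^esub>" by (rule additive_zero[OF assms(1-3)])
  show ?thesis using assms(4)
  proof (induction I rule: infinite_finite_induct)
    case (infinite I) then show ?case by (simp add: z)
  next
    case empty then show ?case by (simp add: z)
  next
    case (insert a I)
    have "g \<in> I \<rightarrow> carrier G" "g a \<in> carrier G" "(\<lambda>i. f (g i)) \<in> I \<rightarrow> carrier H" "f (g a) \<in> carrier H"
      using insert.prems f by auto
    then show ?case using insert by (simp add: add)
  qed
qed

lemma (in abelian_group) finsum_Times:
  assumes "finite I" "finite J" "\<And>i j. i \<in> I \<Longrightarrow> j \<in> J \<Longrightarrow> f i j \<in> carrier G"
  shows "(\<Oplus>i\<in>I. \<Oplus>j\<in>J. f i j) = (\<Oplus>p\<in>I \<times> J. f (fst p) (snd p))"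
  using assms(1,3)
proof (induction I rule: finite_induct)
  case (insert a I)
  have eq: "insert a I \<times> J = Pair a ` J \<union> I \<times> J" by auto
  have row: "(\<Oplus>j\<in>J. f i j) \<in> carrier G" if "i \<in> insert a I" for i
    using insert.prems that by (intro finsum_closed) auto
  have inj: "inj_on (Pair a) J" by (auto simp: inj_on_def)
  have "(\<Oplus>p\<in>insert a I \<times> J. f (fst p) (snd p)) =
      (\<Oplus>p\<in>Pair a ` J. f (fst p) (snd p)) \<oplus> (\<Oplus>p\<in>I \<times> J. f (fst p) (snd p))"
    unfolding eq using insert assms(2) by (intro finsum_Un_disjoint) auto
  also have "(\<Oplus>p\<in>Pair a ` J. f (fst p) (snd p)) = (\<Oplus>j\<in>J. f a j)"
    using insert.prems inj by (subst finsum_reindex) (auto simp: Pi_iff)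
  finally show ?case using insert row by (simp add: Pi_iff)
qed simp

lemma (in abelian_group) finsum_commute:
  assumes "finite I" "finite J" "\<And>i j. i \<in> I \<Longrightarrow> j \<in> J \<Longrightarrow> f i j \<in> carrier G"
  shows "(\<Oplus>i\<in>I. \<Oplus>j\<in>J. f i j) = (\<Oplus>j\<in>J. \<Oplus>i\<in>I. f i j)"
  using assms(1,3)
proof (induction I rule: finite_induct)
  case (insert a I)
  have "(\<Oplus>j\<in>J. f i j) \<in> carrier G" if "i \<in> insert a I" for i
    using insert.prems that by (intro finsum_closed) auto
  moreover have "(\<Oplus>i\<in>I. f i j) \<in> carrier G" if "j \<in> J" for j
    using insert.prems that by (intro finsum_closed) auto
  moreover have "(\<Oplus>j\<in>J. \<Oplus>i\<in>insert a I. f i j) = (\<Oplus>j\<in>J. f a j \<oplus> (\<Oplus>i\<in>I. f i j))"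
    using insert calculation by (intro finsum_cong') (auto simp: Pi_iff)
  ultimately show ?case using insert by (simp add: Pi_iff finsum_addf)
qed simp

lemma (in abelian_group) finsum_delta:
  assumes "finite I" "i \<in> I" "x \<in> carrier G"
  shows "(\<Oplus>j\<in>I. if j = i then x else \<zero>) = x"
proof -
  have "(\<Oplus>j\<in>I. if j = i then x else \<zero>) = (\<Oplus>j\<in>I. if i = j then x else \<zero>)"
    using assms by (intro finsum_cong') auto
  then show ?thesis using finsum_singleton[OF assms(2,1), of "\<lambda>_. x"] assms(3) by simp
qed


section \<open>Modules, homomorphisms and spans\<close>

lemma lmod_homD:
  assumes "f \<in> lmod_hom A M N"
  shows "x \<in> carrier M \<Longrightarrow> f x \<in> carrier N"
    and "x \<in> carrier M \<Longrightarrow> y \<in> carrier M \<Longrightarrow> f (x \<oplus>\<^bsub>M\<^esub> y) = f x \<oplus>\<^bsub>N\<^esub> f y"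
    and "a \<in> carrier A \<Longrightarrow> x \<in> carrier M \<Longrightarrow> f (a \<odot>\<^bsub>M\<^esub> x) = a \<odot>\<^bsub>N\<^esub> f x"
  using assms by (auto simp: lmod_hom_def)

lemma lmod_homI:
  assumes "\<And>x. x \<in> carrier M \<Longrightarrow> f x \<in> carrier N"
    and "\<And>x y. x \<in> carrier M \<Longrightarrow> y \<in> carrier M \<Longrightarrow> f (x \<oplus>\<^bsub>M\<^esub> y) = f x \<oplus>\<^bsub>N\<^esub> f y"
    and "\<And>a x. a \<in> carrier A \<Longrightarrow> x \<in> carrier M \<Longrightarrow> f (a \<odot>\<^bsub>M\<^esub> x) = a \<odot>\<^bsub>N\<^esub> f x"
  shows "f \<in> lmod_hom A M N"
  using assms by (auto simp: lmod_hom_def)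

lemma lmod_hom_additive:
  "f \<in> lmod_hom A M N \<Longrightarrow> f \<in> hom (add_monoid M) (add_monoid N)"
  by (auto simp: lmod_hom_def hom_def)

lemma additiveI:
  assumes "\<And>x. x \<in> carrier M \<Longrightarrow> f x \<in> carrier N"
    and "\<And>x y. x \<in> carrier M \<Longrightarrow> y \<in> carrier M \<Longrightarrow> f (x \<oplus>\<^bsub>M\<^esub> y) = f x \<oplus>\<^bsub>N\<^esub> f y"
  shows "f \<in> hom (add_monoid M) (add_monoid N)"
  using assms by (auto simp: hom_def)

lemma left_module_groups:
  assumes "left_module A M"
  shows "abelian_group A" "abelian_group M" "ring A"
proof -
  interpret left_module A M by fact
  show "abelian_group A" "abelian_group M" "ring A" by unfold_locales
qed

lemma lmod_hom_zero:
  assumes "f \<in> lmod_hom A M N" "left_module A M" "left_module A N"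
  shows "f \<zero>\<^bsub>M\<^esub> = \<zero>\<^bsub>N\<^esub>"
  by (rule additive_zero[OF _ _ lmod_hom_additive[OF assms(1)]])
    (rule left_module_groups[OF assms(2)] left_module_groups[OF assms(3)])+

lemma lmod_hom_finsum:
  assumes "f \<in> lmod_hom A M N" "left_module A M" "left_module A N" "g \<in> I \<rightarrow> carrier M"
  shows "f (\<Oplus>\<^bsub>M\<^esub>i\<in>I. g i) = (\<Oplus>\<^bsub>N\<^esub>i\<in>I. f (g i))"
  by (rule additive_finsum[OF _ _ lmod_hom_additive[OF assms(1)] assms(4)])
    (rule left_module_groups[OF assms(2)] left_module_groups[OF assms(3)])+

lemma lmod_hom_comp:
  "f \<in> lmod_hom A L M \<Longrightarrow> g \<in> lmod_hom A M N \<Longrightarrow> g \<circ> f \<in> lmod_hom A L N"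
  by (auto simp: lmod_hom_def Pi_iff)

lemma lmod_hom_id: "(\<lambda>x. x) \<in> lmod_hom A M M"
  by (auto simp: lmod_hom_def)

lemma lmod_hom_inv_into:
  assumes f: "f \<in> lmod_hom A M N" "bij_betw f (carrier M) (carrier N)" and M: "left_module A M"
  shows "inv_into (carrier M) f \<in> lmod_hom A N M"
    "bij_betw (inv_into (carrier M) f) (carrier N) (carrier M)"
proof -
  interpret left_module A M by fact
  let ?k = "inv_into (carrier M) f"
  show k: "bij_betw ?k (carrier N) (carrier M)" using bij_betw_inv_into[OF f(2)] .
  have kc: "?k y \<in> carrier M" and fk: "f (?k y) = y" if "y \<in> carrier N" for y
    using bij_betw_apply[OF k] bij_betw_inv_into_right[OF f(2)] that by auto
  have kf: "?k (f x) = x" if "x \<in> carrier M" for x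
    using bij_betw_inv_into_left[OF f(2)] that by auto
  show "?k \<in> lmod_hom A N M"
  proof (rule lmod_homI)
    fix x y assume xy: "x \<in> carrier N" "y \<in> carrier N"
    have "?k (f (?k x \<oplus>\<^bsub>M\<^esub> ?k y)) = ?k x \<oplus>\<^bsub>M\<^esub> ?k y" using xy kc by (intro kf) auto
    then show "?k (x \<oplus>\<^bsub>N\<^esub> y) = ?k x \<oplus>\<^bsub>M\<^esub> ?k y"
      using xy by (simp add: lmod_homD(2)[OF f(1)] kc fk)
  next
    fix a x assume ax: "a \<in> carrier A" "x \<in> carrier N"
    have "?k (f (a \<odot>\<^bsub>M\<^esub> ?k x)) = a \<odot>\<^bsub>M\<^esub> ?k x" using ax kc by (intro kf) auto
    then show "?k (a \<odot>\<^bsub>N\<^esub> x) = a \<odot>\<^bsub>M\<^esub> ?k x"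
      using ax by (simp add: lmod_homD(3)[OF f(1)] kc fk)
  qed (rule kc)
qed

lemma lmod_hom_inj_onI:
  assumes f: "f \<in> lmod_hom A M N" and M: "left_module A M" and N: "left_module A N"
    and ker: "\<And>x. x \<in> carrier M \<Longrightarrow> f x = \<zero>\<^bsub>N\<^esub> \<Longrightarrow> x = \<zero>\<^bsub>M\<^esub>"
  shows "inj_on f (carrier M)"
proof (rule inj_onI)
  interpret M: left_module A M by fact
  interpret N: left_module A N by fact
  fix x y assume xy: "x \<in> carrier M" "y \<in> carrier M" "f x = f y"
  have "f (\<ominus>\<^bsub>M\<^esub> y) \<oplus>\<^bsub>N\<^esub> f y = \<zero>\<^bsub>N\<^esub>"
    using xy lmod_homD(2)[OF f, of "\<ominus>\<^bsub>M\<^esub> y" y] lmod_hom_zero[OF f M N] by (simp add: M.l_neg)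
  then have "f (\<ominus>\<^bsub>M\<^esub> y \<oplus>\<^bsub>M\<^esub> x) = \<zero>\<^bsub>N\<^esub>" using xy lmod_homD(2)[OF f, of "\<ominus>\<^bsub>M\<^esub> y" x] by simp
  then have "\<ominus>\<^bsub>M\<^esub> y \<oplus>\<^bsub>M\<^esub> x = \<zero>\<^bsub>M\<^esub>" using ker xy by simp
  then show "x = y" using xy by (metis M.M.add.inv_closed M.M.minus_equality M.M.minus_minus M.M.a_comm)
qed

lemma a_kernel_iff: "x \<in> a_kernel M N f \<longleftrightarrow> x \<in> carrier M \<and> f x = \<zero>\<^bsub>N\<^esub>"
  by (simp add: a_kernel_def' )

context left_module
begin

lemma smult_additive: "a \<in> carrier A \<Longrightarrow> (\<lambda>x. a \<odot>\<^bsub>M\<^esub> x) \<in> hom (add_monoid M) (add_monoid M)"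
  by (rule additiveI) (auto simp: smult_r_distr)

lemma smult_additive_left: "x \<in> carrier M \<Longrightarrow> (\<lambda>a. a \<odot>\<^bsub>M\<^esub> x) \<in> hom (add_monoid A) (add_monoid M)"
  by (rule additiveI) (auto simp: smult_l_distr)

lemma smult_zero [simp]: "a \<in> carrier A \<Longrightarrow> a \<odot>\<^bsub>M\<^esub> \<zero>\<^bsub>M\<^esub> = \<zero>\<^bsub>M\<^esub>"
  using additive_zero[OF M.abelian_group_axioms M.abelian_group_axioms smult_additive] .

lemma zero_smult [simp]: "x \<in> carrier M \<Longrightarrow> \<zero> \<odot>\<^bsub>M\<^esub> x = \<zero>\<^bsub>M\<^esub>"
  using additive_zero[OF A.abelian_group_axioms M.abelian_group_axioms smult_additive_left] .

lemma smult_finsum: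
  "a \<in> carrier A \<Longrightarrow> g \<in> I \<rightarrow> carrier M \<Longrightarrow>
    a \<odot>\<^bsub>M\<^esub> (\<Oplus>\<^bsub>M\<^esub>i\<in>I. g i) = (\<Oplus>\<^bsub>M\<^esub>i\<in>I. a \<odot>\<^bsub>M\<^esub> g i)"
  using additive_finsum[OF M.abelian_group_axioms M.abelian_group_axioms smult_additive] .

lemma finsum_smult:
  "x \<in> carrier M \<Longrightarrow> g \<in> I \<rightarrow> carrier A \<Longrightarrow>
    (\<Oplus>i\<in>I. g i) \<odot>\<^bsub>M\<^esub> x = (\<Oplus>\<^bsub>M\<^esub>i\<in>I. g i \<odot>\<^bsub>M\<^esub> x)"
  using additive_finsum[OF A.abelian_group_axioms M.abelian_group_axioms smult_additive_left] .

text \<open>Applying a matrix to a vector and then summing against a row: the associativity of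
  matrix multiplication.\<close>

lemma finsum_smult_assoc:
  assumes "finite I" "finite J" "\<And>i. i \<in> I \<Longrightarrow> r i \<in> carrier A"
    and "\<And>i j. i \<in> I \<Longrightarrow> j \<in> J \<Longrightarrow> m i j \<in> carrier A" "\<And>j. j \<in> J \<Longrightarrow> x j \<in> carrier M"
  shows "(\<Oplus>\<^bsub>M\<^esub>i\<in>I. r i \<odot>\<^bsub>M\<^esub> (\<Oplus>\<^bsub>M\<^esub>j\<in>J. m i j \<odot>\<^bsub>M\<^esub> x j)) =
    (\<Oplus>\<^bsub>M\<^esub>j\<in>J. (\<Oplus>i\<in>I. r i \<otimes> m i j) \<odot>\<^bsub>M\<^esub> x j)"
proof -
  have "(\<Oplus>\<^bsub>M\<^esub>i\<in>I. r i \<odot>\<^bsub>M\<^esub> (\<Oplus>\<^bsub>M\<^esub>j\<in>J. m i j \<odot>\<^bsub>M\<^esub> x j)) =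
      (\<Oplus>\<^bsub>M\<^esub>i\<in>I. \<Oplus>\<^bsub>M\<^esub>j\<in>J. (r i \<otimes> m i j) \<odot>\<^bsub>M\<^esub> x j)"
  proof (intro M.finsum_cong' refl)
    fix i assume i: "i \<in> I"
    show "r i \<odot>\<^bsub>M\<^esub> (\<Oplus>\<^bsub>M\<^esub>j\<in>J. m i j \<odot>\<^bsub>M\<^esub> x j) = (\<Oplus>\<^bsub>M\<^esub>j\<in>J. (r i \<otimes> m i j) \<odot>\<^bsub>M\<^esub> x j)"
      using assms i by (subst smult_finsum) (auto intro!: M.finsum_cong' simp: smult_assoc1)
  qed (use assms in \<open>auto intro!: M.finsum_closed\<close>)
  also have "\<dots> = (\<Oplus>\<^bsub>M\<^esub>j\<in>J. \<Oplus>\<^bsub>M\<^esub>i\<in>I. (r i \<otimes> m i j) \<odot>\<^bsub>M\<^esub> x j)"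
    using assms by (intro M.finsum_commute) auto
  also have "\<dots> = (\<Oplus>\<^bsub>M\<^esub>j\<in>J. (\<Oplus>i\<in>I. r i \<otimes> m i j) \<odot>\<^bsub>M\<^esub> x j)"
    using assms by (intro M.finsum_cong' finsum_smult[symmetric]) (auto intro!: A.finsum_closed)
  finally show ?thesis .
qed

end

definition lspan :: "('a, 'r) ring_scheme \<Rightarrow> ('a, 'm, 'x) module_scheme \<Rightarrow> 'm set \<Rightarrow> 'm set" where
  "lspan A M G = (\<lambda>c. \<Oplus>\<^bsub>M\<^esub>g\<in>G. c g \<odot>\<^bsub>M\<^esub> g) ` (G \<rightarrow> carrier A)"

lemma lspanI:
  "c \<in> G \<rightarrow> carrier A \<Longrightarrow> x = (\<Oplus>\<^bsub>M\<^esub>g\<in>G. c g \<odot>\<^bsub>M\<^esub> g) \<Longrightarrow> x \<in> lspan A M G"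
  unfolding lspan_def by (rule image_eqI[where x = c])

lemma lspanE:
  assumes "x \<in> lspan A M G"
  obtains c where "c \<in> G \<rightarrow> carrier A" "x = (\<Oplus>\<^bsub>M\<^esub>g\<in>G. c g \<odot>\<^bsub>M\<^esub> g)"
  using assms unfolding lspan_def by (rule imageE) (rule that)

lemma fin_gen_module_iff_lspan:
  "fin_gen_module A M \<longleftrightarrow> (\<exists>G. finite G \<and> G \<subseteq> carrier M \<and> carrier M \<subseteq> lspan A M G)"
  by (simp add: fin_gen_module_def lspan_def subset_iff image_iff Ball_def)

context left_module
begin

lemma lspan_smult:
  assumes "G \<subseteq> carrier M" "a \<in> carrier A" "x \<in> lspan A M G"
  shows "a \<odot>\<^bsub>M\<^esub> x \<in> lspan A M G"
proof -
  obtain c where c: "c \<in> G \<rightarrow> carrier A" "x = (\<Oplus>\<^bsub>M\<^esub>g\<in>G. c g \<odot>\<^bsub>M\<^esub> g)"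
    by (rule lspanE[OF assms(3)])
  have "a \<odot>\<^bsub>M\<^esub> x = (\<Oplus>\<^bsub>M\<^esub>g\<in>G. (a \<otimes> c g) \<odot>\<^bsub>M\<^esub> g)"
    unfolding c(2) using c(1) assms(1,2)
    by (subst smult_finsum) (auto intro!: M.finsum_cong' simp: smult_assoc1 Pi_iff subset_iff)
  then show ?thesis using c(1) assms(2) by (intro lspanI[where c = "\<lambda>g. a \<otimes> c g"]) auto
qed

lemma lspan_add:
  assumes "G \<subseteq> carrier M" "x \<in> lspan A M G" "y \<in> lspan A M G"
  shows "x \<oplus>\<^bsub>M\<^esub> y \<in> lspan A M G"
proof -
  obtain c where c: "c \<in> G \<rightarrow> carrier A" "x = (\<Oplus>\<^bsub>M\<^esub>g\<in>G. c g \<odot>\<^bsub>M\<^esub> g)"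
    by (rule lspanE[OF assms(2)])
  obtain d where d: "d \<in> G \<rightarrow> carrier A" "y = (\<Oplus>\<^bsub>M\<^esub>g\<in>G. d g \<odot>\<^bsub>M\<^esub> g)"
    by (rule lspanE[OF assms(3)])
  have "x \<oplus>\<^bsub>M\<^esub> y = (\<Oplus>\<^bsub>M\<^esub>g\<in>G. c g \<odot>\<^bsub>M\<^esub> g \<oplus>\<^bsub>M\<^esub> d g \<odot>\<^bsub>M\<^esub> g)"
    unfolding c(2) d(2) using c(1) d(1) assms(1)
    by (intro M.finsum_addf[symmetric]) (auto simp: Pi_iff subset_iff)
  also have "\<dots> = (\<Oplus>\<^bsub>M\<^esub>g\<in>G. (c g \<oplus> d g) \<odot>\<^bsub>M\<^esub> g)"
    using c(1) d(1) assms(1)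
    by (intro M.finsum_cong') (auto simp: smult_l_distr Pi_iff subset_iff)
  finally show ?thesis using c(1) d(1) by (intro lspanI[where c = "\<lambda>g. c g \<oplus> d g"]) auto
qed

lemma lspan_generator:
  assumes "finite G" "G \<subseteq> carrier M" "g \<in> G"
  shows "g \<in> lspan A M G"
proof -
  have *: "(\<Oplus>\<^bsub>M\<^esub>h\<in>G. (if h = g then \<one> else \<zero>) \<odot>\<^bsub>M\<^esub> h) = (\<Oplus>\<^bsub>M\<^esub>h\<in>G. if h = g then g else \<zero>\<^bsub>M\<^esub>)"
    using assms by (intro M.finsum_cong') (auto simp: subset_iff)
  also have "\<dots> = g" using assms by (intro M.finsum_delta) auto
  finally have "(\<Oplus>\<^bsub>M\<^esub>h\<in>G. (if h = g then \<one> else \<zero>) \<odot>\<^bsub>M\<^esub> h) = g" .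
  then show ?thesis by (intro lspanI[where c = "\<lambda>h. if h = g then \<one> else \<zero>"]) (auto simp only: Pi_iff A.one_closed A.zero_closed split: if_split)
qed

lemma lspan_finsum:
  assumes "G \<subseteq> carrier M" "\<And>i. i \<in> I \<Longrightarrow> f i \<in> lspan A M G"
  shows "(\<Oplus>\<^bsub>M\<^esub>i\<in>I. f i) \<in> lspan A M G"
proof -
  have sub: "lspan A M G \<subseteq> carrier M"
    using assms(1) unfolding lspan_def by (intro image_subsetI M.finsum_closed) (auto simp: Pi_iff subset_iff)
  have zero: "\<zero>\<^bsub>M\<^esub> \<in> lspan A M G"
  proof -
    have "(\<Oplus>\<^bsub>M\<^esub>g\<in>G. \<zero> \<odot>\<^bsub>M\<^esub> g) = (\<Oplus>\<^bsub>M\<^esub>g\<in>G. \<zero>\<^bsub>M\<^esub>)"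
      using assms(1) by (intro M.finsum_cong') (auto simp: subset_iff)
    then show ?thesis by (intro lspanI[where c = "\<lambda>_. \<zero>"]) (auto simp: M.finsum_zero)
  qed
  show ?thesis using assms(2)
  proof (induction I rule: infinite_finite_induct)
    case (insert a I)
    then have "f \<in> I \<rightarrow> carrier M" "f a \<in> carrier M" using sub by auto
    then show ?case using insert lspan_add[OF assms(1)] by simp
  qed (simp_all add: zero)
qed

end

lemma fin_gen_module_image:
  assumes M: "left_module A M" and N: "left_module A N" and f: "f \<in> lmod_hom A M N"
    and onto: "f ` carrier M = carrier N" and fg: "fin_gen_module A M"
  shows "fin_gen_module A N"
proof -
  interpret M: left_module A M by fact
  interpret N: left_module A N by fact
  obtain G where G: "finite G" "G \<subseteq> carrier M" "carrier M \<subseteq> lspan A M G"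
    using fg by (auto simp: fin_gen_module_iff_lspan)
  have fG: "f ` G \<subseteq> carrier N" using G(2) onto by auto
  have "f x \<in> lspan A N (f ` G)" if x: "x \<in> carrier M" for x
  proof -
    obtain c where c: "c \<in> G \<rightarrow> carrier A" "x = (\<Oplus>\<^bsub>M\<^esub>g\<in>G. c g \<odot>\<^bsub>M\<^esub> g)"
      by (rule lspanE[OF subsetD[OF G(3) x]])
    have "f x = (\<Oplus>\<^bsub>N\<^esub>g\<in>G. f (c g \<odot>\<^bsub>M\<^esub> g))"
      unfolding c(2) using c(1) G(2) by (intro lmod_hom_finsum[OF f M N]) (auto simp: Pi_iff subset_iff)
    also have "\<dots> \<in> lspan A N (f ` G)"
    proof (rule N.lspan_finsum[OF fG])
      fix g assume g: "g \<in> G"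
      then have "f (c g \<odot>\<^bsub>M\<^esub> g) = c g \<odot>\<^bsub>N\<^esub> f g"
        using c(1) G(2) by (intro lmod_homD(3)[OF f]) auto
      also have "\<dots> \<in> lspan A N (f ` G)"
        using g c(1) G(1) fG by (intro N.lspan_smult N.lspan_generator) auto
      finally show "f (c g \<odot>\<^bsub>M\<^esub> g) \<in> lspan A N (f ` G)" .
    qed
    finally show ?thesis .
  qed
  then have "carrier N \<subseteq> lspan A N (f ` G)" unfolding onto[symmetric] by blast
  then show ?thesis unfolding fin_gen_module_iff_lspan using G(1) fG by blast
qed

lemma submodule_left_module:
  assumes M: "left_module A M" and N: "submodule N A M"
  shows "left_module A (M\<lparr>carrier := N\<rparr>)"
proof -
  interpret M: left_module A M by fact
  interpret N: submodule N A M by fact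
  have sub: "x \<in> N \<Longrightarrow> x \<in> carrier M" for x using N.subset by auto
  have "abelian_group (M\<lparr>carrier := N\<rparr>)"
  proof (rule abelian_groupI)
    fix x assume "x \<in> carrier (M\<lparr>carrier := N\<rparr>)"
    then have x: "x \<in> N" "x \<in> carrier M" using sub by auto
    have "\<ominus>\<^bsub>M\<^esub> x \<in> N" using N.m_inv_closed[OF x(1)] by (simp add: a_inv_def)
    then show "\<exists>y\<in>carrier (M\<lparr>carrier := N\<rparr>). y \<oplus>\<^bsub>M\<lparr>carrier := N\<rparr>\<^esub> x = \<zero>\<^bsub>M\<lparr>carrier := N\<rparr>\<^esub>"
      using x by (intro bexI[of _ "\<ominus>\<^bsub>M\<^esub> x"]) (auto simp: M.M.l_neg)
  qed (use N.m_closed N.one_closed sub in \<open>auto simp: M.M.a_ac\<close>)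
  then interpret K: abelian_group "M\<lparr>carrier := N\<rparr>" .
  show ?thesis
    by unfold_locales (auto simp: sub M.smult_l_distr M.smult_r_distr M.smult_assoc1)
qed

lemma submoduleI:
  assumes M: "left_module A M" and sub: "H \<subseteq> carrier M" and zero: "\<zero>\<^bsub>M\<^esub> \<in> H"
    and neg: "\<And>x. x \<in> H \<Longrightarrow> \<ominus>\<^bsub>M\<^esub> x \<in> H"
    and add: "\<And>x y. x \<in> H \<Longrightarrow> y \<in> H \<Longrightarrow> x \<oplus>\<^bsub>M\<^esub> y \<in> H"
    and smult: "\<And>a x. a \<in> carrier A \<Longrightarrow> x \<in> H \<Longrightarrow> a \<odot>\<^bsub>M\<^esub> x \<in> H"
  shows "submodule H A M"
  by (intro submodule.intro subgroup.intro submodule_axioms.intro)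
    (use assms in \<open>auto simp: a_inv_def\<close>)

lemma lmod_hom_neg:
  assumes f: "f \<in> lmod_hom A M N" and M: "left_module A M" and N: "left_module A N"
    and x: "x \<in> carrier M"
  shows "f (\<ominus>\<^bsub>M\<^esub> x) = \<ominus>\<^bsub>N\<^esub> f x"
proof -
  interpret M: left_module A M by fact
  interpret N: left_module A N by fact
  have "f (\<ominus>\<^bsub>M\<^esub> x) \<oplus>\<^bsub>N\<^esub> f x = \<zero>\<^bsub>N\<^esub>"
    using x lmod_homD(2)[OF f, of "\<ominus>\<^bsub>M\<^esub> x" x] lmod_hom_zero[OF f M N] by (simp add: M.l_neg)
  then show ?thesis
    using x lmod_homD(1)[OF f] by (metis M.M.add.inv_closed N.M.minus_equality)
qed

lemma kernel_submodule:
  assumes f: "f \<in> lmod_hom A M N" and M: "left_module A M" and N: "left_module A N"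
  shows "submodule (a_kernel M N f) A M"
proof (rule submoduleI[OF M])
  interpret M: left_module A M by fact
  interpret N: left_module A N by fact
  show "\<ominus>\<^bsub>M\<^esub> x \<in> a_kernel M N f" if "x \<in> a_kernel M N f" for x
    using that by (auto simp: a_kernel_iff lmod_hom_neg[OF f M N])
  show "x \<oplus>\<^bsub>M\<^esub> y \<in> a_kernel M N f" if "x \<in> a_kernel M N f" "y \<in> a_kernel M N f" for x y
    using that by (auto simp: a_kernel_iff lmod_homD(2)[OF f])
  show "a \<odot>\<^bsub>M\<^esub> x \<in> a_kernel M N f" if "a \<in> carrier A" "x \<in> a_kernel M N f" for a x
    using that by (auto simp: a_kernel_iff lmod_homD(3)[OF f])
qed (auto simp: a_kernel_iff lmod_hom_zero[OF f M N] left_module_groups(2)[OF M, THEN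
    abelian_group.axioms(1), THEN abelian_monoid.zero_closed])

lemma image_submodule:
  assumes f: "f \<in> lmod_hom A M N" and M: "left_module A M" and N: "left_module A N"
  shows "submodule (f ` carrier M) A N"
proof (rule submoduleI[OF N])
  interpret M: left_module A M by fact
  show "f ` carrier M \<subseteq> carrier N" using lmod_homD(1)[OF f] by auto
  show "\<zero>\<^bsub>N\<^esub> \<in> f ` carrier M" using lmod_hom_zero[OF f M N] by (intro image_eqI) auto
  show "\<ominus>\<^bsub>N\<^esub> x \<in> f ` carrier M" if "x \<in> f ` carrier M" for x
    using that by (auto simp: lmod_hom_neg[OF f M N, symmetric])
  show "x \<oplus>\<^bsub>N\<^esub> y \<in> f ` carrier M" if "x \<in> f ` carrier M" "y \<in> f ` carrier M" for x y
    using that by (auto simp: lmod_homD(2)[OF f, symmetric])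
  show "a \<odot>\<^bsub>N\<^esub> x \<in> f ` carrier M" if "a \<in> carrier A" "x \<in> f ` carrier M" for a x
    using that by (auto simp: lmod_homD(3)[OF f, symmetric])
qed


section \<open>Retracts and direct sums\<close>

lemma fg_modsD: "M \<in> fg_mods A \<Longrightarrow> left_module A M" "M \<in> fg_mods A \<Longrightarrow> fin_gen_module A M"
  by (auto simp: fg_mods_def)

lemma fg_mods_image:
  "M \<in> fg_mods A \<Longrightarrow> left_module A N \<Longrightarrow> f \<in> lmod_hom A M N \<Longrightarrow> f ` carrier M = carrier N \<Longrightarrow>
    N \<in> fg_mods A"
  using fin_gen_module_image[of A M N f] by (auto simp: fg_mods_def)

lemma dsum_simps [simp]:
  "carrier (dsum M N) = carrier M \<times> carrier N"
  "\<zero>\<^bsub>dsum M N\<^esub> = (\<zero>\<^bsub>M\<^esub>, \<zero>\<^bsub>N\<^esub>)"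
  "p \<oplus>\<^bsub>dsum M N\<^esub> q = (fst p \<oplus>\<^bsub>M\<^esub> fst q, snd p \<oplus>\<^bsub>N\<^esub> snd q)"
  "a \<odot>\<^bsub>dsum M N\<^esub> p = (a \<odot>\<^bsub>M\<^esub> fst p, a \<odot>\<^bsub>N\<^esub> snd p)"
  by (auto simp: dsum_def split_def)

lemma dsum_left_module:
  assumes "left_module A M" "left_module A N"
  shows "left_module A (dsum M N)"
proof -
  interpret M: left_module A M by fact
  interpret N: left_module A N by fact
  have "abelian_group (dsum M N)"
  proof (rule abelian_groupI)
    fix p assume "p \<in> carrier (dsum M N)"
    then show "\<exists>q\<in>carrier (dsum M N). q \<oplus>\<^bsub>dsum M N\<^esub> p = \<zero>\<^bsub>dsum M N\<^esub>"
      by (intro bexI[of _ "(\<ominus>\<^bsub>M\<^esub> fst p, \<ominus>\<^bsub>N\<^esub> snd p)"]) (auto simp: M.M.l_neg N.M.l_neg)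
  qed (auto simp: M.M.a_ac N.M.a_ac)
  then interpret D: abelian_group "dsum M N" .
  show ?thesis
    by unfold_locales (auto simp: M.smult_l_distr N.smult_l_distr M.smult_r_distr N.smult_r_distr
        M.smult_assoc1 N.smult_assoc1)
qed

text \<open>
  A direct sum decomposition is a split exact sequence. In this form it is visibly preserved by
  every functor that preserves injections, exactness and retractions.
\<close>

lemma dsum_iso_of_split:
  assumes M: "left_module A M" and N: "left_module A N" and X: "left_module A X"
    and i: "i \<in> lmod_hom A M X" and p: "p \<in> lmod_hom A X M"
    and pi: "\<And>x. x \<in> carrier M \<Longrightarrow> p (i x) = x"
    and j: "j \<in> lmod_hom A N X" "inj_on j (carrier N)" "j ` carrier N = a_kernel X M p"
  shows "lmod_iso A (dsum M N) X"
proof -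
  interpret M: left_module A M by fact
  interpret N: left_module A N by fact
  interpret X: left_module A X by fact
  note iD = lmod_homD[OF i] and jD = lmod_homD[OF j(1)] and pD = lmod_homD[OF p]
  let ?f = "\<lambda>q. i (fst q) \<oplus>\<^bsub>X\<^esub> j (snd q)"
  have f: "?f \<in> lmod_hom A (dsum M N) X"
    by (rule lmod_homI) (auto simp: iD jD X.M.a_ac X.smult_r_distr)
  have pj: "p (j y) = \<zero>\<^bsub>M\<^esub>" if "y \<in> carrier N" for y
    using that j(3) by (auto simp: a_kernel_iff set_eq_iff image_iff)
  have "inj_on ?f (carrier (dsum M N))"
  proof (rule lmod_hom_inj_onI[OF f dsum_left_module[OF M N] X])
    fix q assume q: "q \<in> carrier (dsum M N)" "?f q = \<zero>\<^bsub>X\<^esub>"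
    then have "p (?f q) = \<zero>\<^bsub>M\<^esub>" using lmod_hom_zero[OF p X M] by simp
    then have 0: "fst q = \<zero>\<^bsub>M\<^esub>" using q(1) by (auto simp: pD iD jD pi pj)
    then have "j (snd q) = \<zero>\<^bsub>X\<^esub>" using q by (auto simp: lmod_hom_zero[OF i M X] jD)
    then have "j (snd q) = j \<zero>\<^bsub>N\<^esub>" using lmod_hom_zero[OF j(1) N X] by simp
    then have "snd q = \<zero>\<^bsub>N\<^esub>" using j(2) q(1) by (auto dest: inj_onD)
    with 0 show "q = \<zero>\<^bsub>dsum M N\<^esub>" by (simp add: prod_eq_iff)
  qed
  moreover have "?f ` carrier (dsum M N) = carrier X"
  proof (intro equalityI subsetI)
    fix z assume z: "z \<in> carrier X"
    let ?w = "\<ominus>\<^bsub>X\<^esub> i (p z) \<oplus>\<^bsub>X\<^esub> z"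
    have pz: "p z \<in> carrier M" "i (p z) \<in> carrier X" using z by (auto simp: pD iD)
    have "p ?w = \<zero>\<^bsub>M\<^esub>" using z pz by (simp add: pD lmod_hom_neg[OF p X M] pi M.M.l_neg)
    then have "?w \<in> j ` carrier N" unfolding j(3) using z pz by (simp add: a_kernel_iff)
    then obtain y where y: "y \<in> carrier N" "?w = j y" by auto
    have "z = i (p z) \<oplus>\<^bsub>X\<^esub> ?w" using z pz
      by (simp add: X.M.a_assoc[symmetric] X.M.r_neg)
    then show "z \<in> ?f ` carrier (dsum M N)"
      using y pz by (intro image_eqI[of _ _ "(p z, y)"]) auto
  qed (auto simp: iD jD)
  ultimately show ?thesis unfolding lmod_iso_def bij_betw_def using f by blast
qed

lemma split_of_dsum_iso:
  assumes M: "left_module A M" and N: "left_module A N" and X: "left_module A X"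
    and iso: "lmod_iso A (dsum M N) X"
  obtains i p j where "i \<in> lmod_hom A M X" "p \<in> lmod_hom A X M"
    "\<And>x. x \<in> carrier M \<Longrightarrow> p (i x) = x"
    "j \<in> lmod_hom A N X" "inj_on j (carrier N)" "j ` carrier N = a_kernel X M p"
proof -
  interpret M: left_module A M by fact
  interpret N: left_module A N by fact
  interpret X: left_module A X by fact
  obtain h where h: "h \<in> lmod_hom A (dsum M N) X" "bij_betw h (carrier (dsum M N)) (carrier X)"
    using iso by (auto simp: lmod_iso_def)
  let ?k = "inv_into (carrier (dsum M N)) h"
  have k: "?k \<in> lmod_hom A X (dsum M N)"
    using lmod_hom_inv_into[OF h dsum_left_module[OF M N]] by simp
  have kh: "?k (h q) = q" if "q \<in> carrier (dsum M N)" for q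
    using bij_betw_inv_into_left[OF h(2) that] .
  have hk: "h (?k z) = z" if "z \<in> carrier X" for z
    using bij_betw_inv_into_right[OF h(2) that] .
  have l: "(\<lambda>x. (x, \<zero>\<^bsub>N\<^esub>)) \<in> lmod_hom A M (dsum M N)" by (rule lmod_homI) auto
  have r: "(\<lambda>y. (\<zero>\<^bsub>M\<^esub>, y)) \<in> lmod_hom A N (dsum M N)" by (rule lmod_homI) auto
  have f: "fst \<in> lmod_hom A (dsum M N) M" by (rule lmod_homI) auto
  show thesis
  proof
    show "h \<circ> (\<lambda>x. (x, \<zero>\<^bsub>N\<^esub>)) \<in> lmod_hom A M X" by (rule lmod_hom_comp[OF l h(1)])
    show "fst \<circ> ?k \<in> lmod_hom A X M" by (rule lmod_hom_comp[OF k f])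
    show "h \<circ> (\<lambda>y. (\<zero>\<^bsub>M\<^esub>, y)) \<in> lmod_hom A N X" by (rule lmod_hom_comp[OF r h(1)])
    show "(fst \<circ> ?k) ((h \<circ> (\<lambda>x. (x, \<zero>\<^bsub>N\<^esub>))) x) = x" if "x \<in> carrier M" for x
      using that kh by simp
    show "inj_on (h \<circ> (\<lambda>y. (\<zero>\<^bsub>M\<^esub>, y))) (carrier N)"
      using h(2) by (auto simp: inj_on_def bij_betw_def)
    show "(h \<circ> (\<lambda>y. (\<zero>\<^bsub>M\<^esub>, y))) ` carrier N = a_kernel X M (fst \<circ> ?k)"
    proof (intro equalityI subsetI)
      fix z assume "z \<in> (h \<circ> (\<lambda>y. (\<zero>\<^bsub>M\<^esub>, y))) ` carrier N"
      then show "z \<in> a_kernel X M (fst \<circ> ?k)"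
        using kh lmod_homD(1)[OF h(1)] by (auto simp: a_kernel_iff)
    next
      fix z assume z: "z \<in> a_kernel X M (fst \<circ> ?k)"
      then have zX: "z \<in> carrier X" "fst (?k z) = \<zero>\<^bsub>M\<^esub>" by (simp_all add: a_kernel_iff)
      then have "?k z \<in> carrier M \<times> carrier N" using lmod_homD(1)[OF k zX(1)] by simp
      then have c: "snd (?k z) \<in> carrier N" by (rule mem_Times_iff[THEN iffD1, THEN conjunct2])
      have "?k z = (\<zero>\<^bsub>M\<^esub>, snd (?k z))" using zX(2) by (simp only: prod_eq_iff fst_conv snd_conv)
      then have "h (?k z) = h (\<zero>\<^bsub>M\<^esub>, snd (?k z))" by (rule arg_cong)
      then have "z = h (\<zero>\<^bsub>M\<^esub>, snd (?k z))" unfolding hk[OF zX(1)] .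
      then have "z = (h \<circ> (\<lambda>y. (\<zero>\<^bsub>M\<^esub>, y))) (snd (?k z))" by (simp only: o_def)
      then show "z \<in> (h \<circ> (\<lambda>y. (\<zero>\<^bsub>M\<^esub>, y))) ` carrier N" using c by (rule image_eqI)
    qed
  qed
qed

text \<open>
  A retract is a direct summand because the kernel of the retraction is a complement; this
  complement is finitely generated, being the image of \<open>X\<close> under \<open>x \<mapsto> x - i (p x)\<close>.
\<close>

lemma add_closure_retract:
  assumes X: "X \<in> add_closure A U" "X \<in> fg_mods A" and M: "M \<in> fg_mods A"
    and i: "i \<in> lmod_hom A M X" and p: "p \<in> lmod_hom A X M"
    and pi: "\<And>x. x \<in> carrier M \<Longrightarrow> p (i x) = x"
  shows "M \<in> add_closure A U"
proof -
  note lM = fg_modsD(1)[OF M] and lX = fg_modsD(1)[OF X(2)]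
  interpret M: left_module A M by (rule lM)
  interpret X: left_module A X by (rule lX)
  note iD = lmod_homD[OF i] and pD = lmod_homD[OF p]
  let ?N = "X\<lparr>carrier := a_kernel X M p\<rparr>"
  have lN: "left_module A ?N" by (rule submodule_left_module[OF lX kernel_submodule[OF p lX lM]])
  let ?e = "\<lambda>x. \<ominus>\<^bsub>X\<^esub> i (p x) \<oplus>\<^bsub>X\<^esub> x"
  have e: "?e x \<in> a_kernel X M p" if "x \<in> carrier X" for x
    using that by (simp add: a_kernel_iff iD pD lmod_hom_neg[OF p lX lM] pi M.M.l_neg)
  have smult_neg: "a \<odot>\<^bsub>X\<^esub> \<ominus>\<^bsub>X\<^esub> x = \<ominus>\<^bsub>X\<^esub> (a \<odot>\<^bsub>X\<^esub> x)" if "a \<in> carrier A" "x \<in> carrier X" for a x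
  proof -
    have "a \<odot>\<^bsub>X\<^esub> \<ominus>\<^bsub>X\<^esub> x \<oplus>\<^bsub>X\<^esub> a \<odot>\<^bsub>X\<^esub> x = \<zero>\<^bsub>X\<^esub>"
      using that X.smult_r_distr[of a "\<ominus>\<^bsub>X\<^esub> x" x] by (simp add: X.M.l_neg)
    then show ?thesis using that by (metis X.M.add.inv_closed X.M.minus_equality X.smult_closed)
  qed
  have "?N \<in> fg_mods A"
  proof (rule fg_mods_image[OF X(2) lN])
    show "?e \<in> lmod_hom A X ?N"
    proof (rule lmod_homI)
      show "?e x \<in> carrier ?N" if "x \<in> carrier X" for x using e[OF that] by simp
      show "?e (x \<oplus>\<^bsub>X\<^esub> y) = ?e x \<oplus>\<^bsub>?N\<^esub> ?e y" if xy: "x \<in> carrier X" "y \<in> carrier X" for x y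
      proof -
        have c: "\<ominus>\<^bsub>X\<^esub> i (p x) \<in> carrier X" "\<ominus>\<^bsub>X\<^esub> i (p y) \<in> carrier X"
          "i (p x) \<in> carrier X" "i (p y) \<in> carrier X" using xy by (auto simp: iD pD)
        have "\<ominus>\<^bsub>X\<^esub> i (p (x \<oplus>\<^bsub>X\<^esub> y)) = \<ominus>\<^bsub>X\<^esub> i (p x) \<oplus>\<^bsub>X\<^esub> \<ominus>\<^bsub>X\<^esub> i (p y)"
          using xy c by (simp add: iD pD X.M.minus_add)
        then show ?thesis using xy c by (simp add: X.M.a_ac)
      qed
      show "?e (a \<odot>\<^bsub>X\<^esub> x) = a \<odot>\<^bsub>?N\<^esub> ?e x" if "a \<in> carrier A" "x \<in> carrier X" for a x
        using that by (simp add: iD pD X.smult_r_distr smult_neg)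
    qed
    show "?e ` carrier X = carrier ?N"
    proof (intro equalityI subsetI)
      fix x assume "x \<in> carrier ?N"
      then have x: "x \<in> carrier X" "p x = \<zero>\<^bsub>M\<^esub>" by (auto simp: a_kernel_iff)
      then have "x = ?e x" by (simp add: lmod_hom_zero[OF i lM lX])
      then show "x \<in> ?e ` carrier X" using x by blast
    qed (auto simp: e)
  qed
  moreover have "lmod_iso A (dsum M ?N) X"
    by (rule dsum_iso_of_split[OF lM lN lX i p pi, where j = "\<lambda>x. x"])
      (auto simp: lmod_hom_def inj_on_def a_kernel_iff)
  ultimately show ?thesis using add_closure.summand[OF X(1) M] by blast
qed

lemma add_closure_fg: "M \<in> add_closure A U \<Longrightarrow> M \<in> fg_mods A"
  by (induction rule: add_closure.induct) auto

lemma ext_layer_fg: "M \<in> ext_layer A U n \<Longrightarrow> M \<in> fg_mods A"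
  by (induction n rule: induct_nat_012) (simp_all only: ext_layer.simps mem_Collect_eq add_closure_fg)

lemma ext_layer_retract:
  assumes "X \<in> ext_layer A U (Suc n)" "M \<in> fg_mods A"
    and "i \<in> lmod_hom A M X" "p \<in> lmod_hom A X M" "\<And>x. x \<in> carrier M \<Longrightarrow> p (i x) = x"
  shows "M \<in> ext_layer A U (Suc n)"
proof -
  have "\<exists>V. ext_layer A U (Suc n) = add_closure A V"
    by (cases n) (simp_all only: ext_layer.simps, blast+)
  then obtain V where V: "ext_layer A U (Suc n) = add_closure A V" ..
  show ?thesis using assms(1) unfolding V
    by (rule add_closure_retract[OF _ ext_layer_fg[OF assms(1)] assms(2-5)])
qed

lemma lmod_iso_image:
  assumes "f \<in> lmod_hom A K P" "inj_on f (carrier K)" "f ` carrier K = N"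
  shows "lmod_iso A K (P\<lparr>carrier := N\<rparr>)"
  using assms unfolding lmod_iso_def by (intro bexI[of _ f]) (auto simp: lmod_hom_def bij_betw_def)


section \<open>Exact functors preserving projectives\<close>

text \<open>
  Restriction and induction enter the comparison through the properties below. The conditions on
  injections, on exactness and on retractions together say that split exact sequences, and with
  them direct sum decompositions, are preserved.
\<close>

locale exact_functor =
  fixes A :: "('a, 'r) ring_scheme" and B :: "('b, 's) ring_scheme"
    and F :: "'a fg_module \<Rightarrow> 'b fg_module"
    and T :: "'a fg_module \<Rightarrow> 'a fg_module \<Rightarrow> ((nat \<Rightarrow> 'a) set \<Rightarrow> (nat \<Rightarrow> 'a) set) \<Rightarrow>
      (nat \<Rightarrow> 'b) set \<Rightarrow> (nat \<Rightarrow> 'b) set"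
  assumes obj: "M \<in> fg_mods A \<Longrightarrow> F M \<in> fg_mods B"
    and map_zero: "M \<in> fg_mods A \<Longrightarrow> carrier M = {\<zero>\<^bsub>M\<^esub>} \<Longrightarrow> carrier (F M) = {\<zero>\<^bsub>F M\<^esub>}"
    and hom: "M \<in> fg_mods A \<Longrightarrow> N \<in> fg_mods A \<Longrightarrow> f \<in> lmod_hom A M N \<Longrightarrow>
      T M N f \<in> lmod_hom B (F M) (F N)"
    and inj: "M \<in> fg_mods A \<Longrightarrow> N \<in> fg_mods A \<Longrightarrow> f \<in> lmod_hom A M N \<Longrightarrow>
      inj_on f (carrier M) \<Longrightarrow> inj_on (T M N f) (carrier (F M))"
    and surj: "M \<in> fg_mods A \<Longrightarrow> N \<in> fg_mods A \<Longrightarrow> f \<in> lmod_hom A M N \<Longrightarrow>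
      f ` carrier M = carrier N \<Longrightarrow> T M N f ` carrier (F M) = carrier (F N)"
    and exact: "L \<in> fg_mods A \<Longrightarrow> M \<in> fg_mods A \<Longrightarrow> N \<in> fg_mods A \<Longrightarrow>
      f \<in> lmod_hom A L M \<Longrightarrow> g \<in> lmod_hom A M N \<Longrightarrow> f ` carrier L = a_kernel M N g \<Longrightarrow>
      T L M f ` carrier (F L) = a_kernel (F M) (F N) (T M N g)"
    and retraction: "M \<in> fg_mods A \<Longrightarrow> N \<in> fg_mods A \<Longrightarrow>
      f \<in> lmod_hom A M N \<Longrightarrow> g \<in> lmod_hom A N M \<Longrightarrow> (\<And>x. x \<in> carrier M \<Longrightarrow> g (f x) = x) \<Longrightarrow>
      y \<in> carrier (F M) \<Longrightarrow> T N M g (T M N f y) = y"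
    and projective: "fg_projective A P \<Longrightarrow> fg_projective B (F P)"
begin

lemma map_iso:
  assumes "M \<in> fg_mods A" "N \<in> fg_mods A" "lmod_iso A M N"
  shows "lmod_iso B (F M) (F N)"
proof -
  obtain f where f: "f \<in> lmod_hom A M N" "inj_on f (carrier M)" "f ` carrier M = carrier N"
    using assms(3) by (auto simp: lmod_iso_def bij_betw_def)
  show ?thesis unfolding lmod_iso_def bij_betw_def
    using hom[OF assms(1,2) f(1)] inj[OF assms(1,2) f(1,2)] surj[OF assms(1,2) f(1,3)] by blast
qed

lemma dsum_iso:
  assumes "M \<in> fg_mods A" "N \<in> fg_mods A" "X \<in> fg_mods A" "lmod_iso A (dsum M N) X"
  shows "lmod_iso B (dsum (F M) (F N)) (F X)"
proof -
  obtain i p j where *: "i \<in> lmod_hom A M X" "p \<in> lmod_hom A X M"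
    "\<And>x. x \<in> carrier M \<Longrightarrow> p (i x) = x"
    "j \<in> lmod_hom A N X" "inj_on j (carrier N)" "j ` carrier N = a_kernel X M p"
    using split_of_dsum_iso[OF fg_modsD(1)[OF assms(1)] fg_modsD(1)[OF assms(2)]
        fg_modsD(1)[OF assms(3)] assms(4)] by blast
  show ?thesis
  proof (rule dsum_iso_of_split[OF fg_modsD(1)[OF obj[OF assms(1)]]
        fg_modsD(1)[OF obj[OF assms(2)]] fg_modsD(1)[OF obj[OF assms(3)]]])
    show "T M X i \<in> lmod_hom B (F M) (F X)" "T X M p \<in> lmod_hom B (F X) (F M)"
      "T N X j \<in> lmod_hom B (F N) (F X)"
      using hom assms * by auto
    show "T X M p (T M X i y) = y" if "y \<in> carrier (F M)" for y
      by (rule retraction[OF assms(1,3) *(1,2) *(3) that])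
    show "inj_on (T N X j) (carrier (F N))" by (rule inj[OF assms(2,3) *(4,5)])
    show "T N X j ` carrier (F N) = a_kernel (F X) (F M) (T X M p)"
      by (rule exact[OF assms(2,3,1) *(4,2,6)])
  qed
qed

lemma map_add_closure:
  assumes "\<And>M. M \<in> U \<Longrightarrow> M \<in> fg_mods A \<Longrightarrow> F M \<in> V" and "M \<in> add_closure A U"
  shows "F M \<in> add_closure B V"
  using assms(2)
proof (induction rule: add_closure.induct)
  case (incl M)
  then show ?case by (intro add_closure.incl obj assms(1))
next
  case (iso M N)
  show ?case
    by (rule add_closure.iso[OF iso.IH obj[OF iso.hyps(2)]
          map_iso[OF add_closure_fg[OF iso.hyps(1)] iso.hyps(2,3)]])
next
  case (zero M)
  then show ?case by (intro add_closure.zero obj map_zero)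
next
  case (sum M N X)
  show ?case
    by (rule add_closure.sum[OF sum.IH obj[OF sum.hyps(3)] dsum_iso[OF
          add_closure_fg[OF sum.hyps(1)] add_closure_fg[OF sum.hyps(2)] sum.hyps(3,4)]])
next
  case (summand X M N)
  show ?case
    by (rule add_closure.summand[OF summand.IH obj[OF summand.hyps(2)] obj[OF summand.hyps(3)]
          dsum_iso[OF summand.hyps(2,3) add_closure_fg[OF summand.hyps(1)] summand.hyps(4)]])
qed

lemma map_ext_layer:
  assumes "M \<in> ext_layer A {N} n"
  shows "F M \<in> ext_layer B {F N} n"
  using assms
proof (induction n arbitrary: M rule: induct_nat_012)
  case 0
  then have "M \<in> fg_mods A" "carrier M = {\<zero>\<^bsub>M\<^esub>}" by simp_all
  then show ?case by (simp add: obj map_zero)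
next
  case 1
  then show ?case unfolding ext_layer.simps(2) by (rule map_add_closure[rotated]) simp
next
  case (ge2 n)
  let ?V = "\<lambda>A N. extensions A (ext_layer A {N} (Suc n)) (ext_layer A {N} (Suc 0))"
  have FV: "F X \<in> ?V B (F N)" if X: "X \<in> ?V A N" for X
  proof -
    obtain U V f g where *: "X \<in> fg_mods A" "U \<in> ext_layer A {N} (Suc n)"
      "V \<in> ext_layer A {N} (Suc 0)" "short_exact A U f X g V"
      using X by (auto simp: extensions_def)
    note fg = ext_layer_fg[OF *(2)] *(1) ext_layer_fg[OF *(3)]
    have "short_exact B (F U) (T U X f) (F X) (T X V g) (F V)"
      using *(4) unfolding short_exact_def
      by (elim conjE) (intro conjI hom inj surj exact fg)
    moreover have "F U \<in> ext_layer B {F N} (Suc n)" by (rule ge2(2)[OF *(2)])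
    moreover have "F V \<in> ext_layer B {F N} (Suc 0)"
      using *(3) unfolding ext_layer.simps(2) by (rule map_add_closure[rotated]) simp
    ultimately show ?thesis unfolding extensions_def using obj[OF *(1)] by blast
  qed
  have "F M \<in> add_closure B (?V B (F N))"
    using ge2.prems unfolding ext_layer.simps(3) by (rule map_add_closure[rotated]) (rule FV)
  then show ?case unfolding ext_layer.simps(3) .
qed

text \<open>
  The differentials of the image of a resolution; the augmentation \<open>d 0\<close> is a separate case because
  its target is \<open>M\<close>.
\<close>

definition T_res where
  "T_res P d M i = (case i of 0 \<Rightarrow> T (P 0) M (d 0) | Suc n \<Rightarrow> T (P (Suc n)) (P n) (d (Suc n)))"

lemma map_resolution:
  assumes M: "M \<in> fg_mods A" and P: "proj_resolution A P d M"
  shows "proj_resolution B (\<lambda>i. F (P i)) (T_res P d M) (F M)"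
proof -
  have Pfg: "P i \<in> fg_mods A" for i using P by (simp add: proj_resolution_def fg_projective_def)
  have d: "d 0 \<in> lmod_hom A (P 0) M" "d (Suc i) \<in> lmod_hom A (P (Suc i)) (P i)" for i
    using P by (auto simp: proj_resolution_def)
  show ?thesis unfolding proj_resolution_def
  proof (intro conjI allI)
    fix i
    show "fg_projective B (F (P i))" using P by (intro projective) (simp add: proj_resolution_def)
    show "T_res P d M 0 \<in> lmod_hom B (F (P 0)) (F M)"
      using hom[OF Pfg M d(1)] by (simp add: T_res_def)
    show "T_res P d M 0 ` carrier (F (P 0)) = carrier (F M)"
      using surj[OF Pfg M d(1)] P by (simp add: T_res_def proj_resolution_def)
    show "T_res P d M (Suc i) \<in> lmod_hom B (F (P (Suc i))) (F (P i))"
      using hom[OF Pfg Pfg d(2)] by (simp add: T_res_def)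
    show "T_res P d M 1 ` carrier (F (P 1)) = a_kernel (F (P 0)) (F M) (T_res P d M 0)"
      using exact[OF Pfg Pfg M d(2) d(1)] P by (simp add: T_res_def proj_resolution_def)
    show "T_res P d M (Suc (Suc i)) ` carrier (F (P (Suc (Suc i)))) =
        a_kernel (F (P (Suc i))) (F (P i)) (T_res P d M (Suc i))"
      using exact[OF Pfg Pfg Pfg d(2) d(2)] P by (simp add: T_res_def proj_resolution_def)
  qed
qed

text \<open>
  A module \<open>K\<close> isomorphic to the image of \<open>d (Suc m)\<close> embeds into \<open>P m\<close> with image the kernel of \<open>d m\<close>.
  This description survives the functor, by exactness. The image itself, as a submodule of \<open>P m\<close>,
  is not compared, because only \<open>K\<close> is known to be an object of the source category.
\<close>

lemma map_syzygies:
  assumes U: "U \<subseteq> fg_mods A" and FU: "\<And>M. M \<in> U \<Longrightarrow> F M \<in> V" and K: "K \<in> syzygies A n U"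
  shows "F K \<in> syzygies B n V"
proof -
  obtain M where Kfg: "K \<in> fg_mods A" and M: "M \<in> U" "is_syzygy A n M K"
    using K by (auto simp: syzygies_def)
  have Mfg: "M \<in> fg_mods A" using M U by auto
  have "is_syzygy B n (F M) (F K)"
  proof (cases n)
    case 0
    then show ?thesis using M map_iso[OF Kfg Mfg] by simp
  next
    case (Suc m)
    obtain P d where P: "proj_resolution A P d M"
      "lmod_iso A K ((P m)\<lparr>carrier := d (Suc m) ` carrier (P (Suc m))\<rparr>)"
      using M(2) Suc by auto
    have Pfg: "P i \<in> fg_mods A" for i using P by (simp add: proj_resolution_def fg_projective_def)
    obtain f where f0: "f \<in> lmod_hom A K ((P m)\<lparr>carrier := d (Suc m) ` carrier (P (Suc m))\<rparr>)"
      "inj_on f (carrier K)" "f ` carrier K = d (Suc m) ` carrier (P (Suc m))"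
      using P(2) by (auto simp: lmod_iso_def bij_betw_def)
    have dc: "d (Suc m) ` carrier (P (Suc m)) \<subseteq> carrier (P m)"
      using P(1) by (auto simp: proj_resolution_def lmod_hom_def)
    have f: "f \<in> lmod_hom A K (P m)" using f0(1) dc by (simp add: lmod_hom_def Pi_iff subset_iff)
    \<comment> \<open>The target of \<open>d m\<close>, which is \<open>M\<close> when \<open>d m\<close> is the augmentation.\<close>
    define N where "N = (case m of 0 \<Rightarrow> M | Suc l \<Rightarrow> P l)"
    have N: "N \<in> fg_mods A" "d m \<in> lmod_hom A (P m) N" "d (Suc m) \<in> lmod_hom A (P (Suc m)) (P m)"
      "d (Suc m) ` carrier (P (Suc m)) = a_kernel (P m) N (d m)"
      using P(1) Mfg Pfg by (auto simp: N_def proj_resolution_def split: nat.split)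
    have "T K (P m) f ` carrier (F K) = a_kernel (F (P m)) (F N) (T (P m) N (d m))"
      by (rule exact[OF Kfg Pfg N(1) f N(2)]) (simp only: f0(3) N(4))
    also have "\<dots> = T_res P d M (Suc m) ` carrier (F (P (Suc m)))"
      unfolding T_res_def using exact[OF Pfg Pfg N(1) N(3,2,4)] by simp
    finally have "lmod_iso B (F K)
        ((F (P m))\<lparr>carrier := T_res P d M (Suc m) ` carrier (F (P (Suc m)))\<rparr>)"
      by (intro lmod_iso_image[OF hom[OF Kfg Pfg f] inj[OF Kfg Pfg f f0(2)]])
    then show ?thesis unfolding Suc is_syzygy.simps
      using map_resolution[OF Mfg P(1)] by blast
  qed
  then show ?thesis using FU[OF M(1)] obj[OF Kfg] by (auto simp: syzygies_def)
qed

lemma map_fin_proj_dim: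
  assumes "M \<in> fin_proj_dim_mods A"
  shows "F M \<in> fin_proj_dim_mods B"
proof -
  have M: "M \<in> fg_mods A" "proj_dim A M < \<infinity>" using assms by (auto simp: fin_proj_dim_mods_def)
  define L where "L = {n. \<exists>P d. proj_resolution A P d M \<and> (\<forall>i>n. carrier (P i) = {\<zero>\<^bsub>P i\<^esub>})}"
  have "L \<noteq> {}"
  proof
    assume "L = {}"
    then have "proj_dim A M = \<infinity>" unfolding proj_dim_def L_def[symmetric] by (simp add: top_enat_def)
    then show False using M(2) by simp
  qed
  then obtain n where "n \<in> L" by blast
  then obtain P d where P: "proj_resolution A P d M" "\<And>i. i > n \<Longrightarrow> carrier (P i) = {\<zero>\<^bsub>P i\<^esub>}"
    unfolding L_def mem_Collect_eq by (elim exE conjE) (rule that, assumption, simp)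
  have Pfg: "P i \<in> fg_mods A" for i using P by (simp add: proj_resolution_def fg_projective_def)
  have "carrier (F (P i)) = {\<zero>\<^bsub>F (P i)\<^esub>}" if "i > n" for i
    by (rule map_zero[OF Pfg P(2)[OF that]])
  then have "\<exists>P' d'. proj_resolution B P' d' (F M) \<and> (\<forall>i>n. carrier (P' i) = {\<zero>\<^bsub>P' i\<^esub>})"
    by (intro exI[of _ "\<lambda>i. F (P i)"] exI[of _ "T_res P d M"] conjI map_resolution[OF M(1) P(1)]) simp
  then have "proj_dim B (F M) \<le> enat n"
    unfolding proj_dim_def by (intro INF_lower) (rule CollectI)
  then have "proj_dim B (F M) < \<infinity>" by (rule le_less_trans) simp
  then show ?thesis using obj[OF M(1)] by (simp add: fin_proj_dim_mods_def)
qed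

end


section \<open>Modules of vectors\<close>

text \<open>
  Vectors over \<open>M\<close> indexed by \<open>I\<close>, added componentwise, with an arbitrary scalar multiplication
  \<open>act\<close>. The vectors are stored through an injection \<open>p\<close> with left inverse \<open>q\<close>, so that the same
  construction also yields modules whose elements have a prescribed type.
\<close>

definition vec_module ::
    "(('i \<Rightarrow> 'm) \<Rightarrow> 'c) \<Rightarrow> ('c \<Rightarrow> 'i \<Rightarrow> 'm) \<Rightarrow> 'i set \<Rightarrow> ('m, 'x) ring_scheme \<Rightarrow>
      ('a \<Rightarrow> ('i \<Rightarrow> 'm) \<Rightarrow> 'i \<Rightarrow> 'm) \<Rightarrow> ('a, 'c) module" where
  "vec_module p q I M act =
    \<lparr>carrier = p ` (I \<rightarrow>\<^sub>E carrier M), monoid.mult = undefined, monoid.one = undefined,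
     ring.zero = p (\<lambda>i\<in>I. \<zero>\<^bsub>M\<^esub>), ring.add = (\<lambda>u v. p (\<lambda>i\<in>I. q u i \<oplus>\<^bsub>M\<^esub> q v i)),
     module.smult = (\<lambda>a u. p (\<lambda>i\<in>I. act a (q u) i))\<rparr>"

lemma vec_module_simps:
  "carrier (vec_module p q I M act) = p ` (I \<rightarrow>\<^sub>E carrier M)"
  "\<zero>\<^bsub>vec_module p q I M act\<^esub> = p (\<lambda>i\<in>I. \<zero>\<^bsub>M\<^esub>)"
  "u \<oplus>\<^bsub>vec_module p q I M act\<^esub> v = p (\<lambda>i\<in>I. q u i \<oplus>\<^bsub>M\<^esub> q v i)"
  "a \<odot>\<^bsub>vec_module p q I M act\<^esub> u = p (\<lambda>i\<in>I. act a (q u) i)"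
  by (simp_all add: vec_module_def)

lemma vec_module_abelian_group:
  assumes qp: "\<And>v. q (p v) = v" and M: "abelian_group M"
  shows "abelian_group (vec_module p q I M act)"
proof -
  interpret M: abelian_group M by fact
  have pe: "p u = p v" if "\<And>i. i \<in> I \<Longrightarrow> u i = v i" "\<And>i. i \<notin> I \<Longrightarrow> u i = v i" for u v :: "'a \<Rightarrow> 'b"
    using that by (intro arg_cong[where f = p] ext) blast
  show ?thesis
  proof (rule abelian_groupI; (unfold vec_module_simps)?)
    fix u v w
    assume u: "u \<in> p ` (I \<rightarrow>\<^sub>E carrier M)"
    then obtain u' where u': "u = p u'" "u' \<in> I \<rightarrow>\<^sub>E carrier M" by blast
    have u'c: "u' i \<in> carrier M" if "i \<in> I" for i using u'(2) that by (rule PiE_mem)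
    have u'e: "u' i = undefined" if "i \<notin> I" for i using u'(2) that by (rule PiE_arb)
    show "p (\<lambda>i\<in>I. q (p (\<lambda>i\<in>I. \<zero>\<^bsub>M\<^esub>)) i \<oplus>\<^bsub>M\<^esub> q u i) = u"
      unfolding u'(1) by (rule pe) (auto simp: qp u'c u'e)
    show "\<exists>v\<in>p ` (I \<rightarrow>\<^sub>E carrier M). p (\<lambda>i\<in>I. q v i \<oplus>\<^bsub>M\<^esub> q u i) = p (\<lambda>i\<in>I. \<zero>\<^bsub>M\<^esub>)"
      unfolding u'(1)
      by (rule bexI[of _ "p (\<lambda>i\<in>I. \<ominus>\<^bsub>M\<^esub> u' i)"], rule pe)
        (auto simp: qp u'c u'e M.l_neg intro!: imageI)
    assume v: "v \<in> p ` (I \<rightarrow>\<^sub>E carrier M)"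
    then obtain v' where v': "v = p v'" "v' \<in> I \<rightarrow>\<^sub>E carrier M" by blast
    have v'c: "v' i \<in> carrier M" if "i \<in> I" for i using v'(2) that by (rule PiE_mem)
    show "p (\<lambda>i\<in>I. q u i \<oplus>\<^bsub>M\<^esub> q v i) \<in> p ` (I \<rightarrow>\<^sub>E carrier M)"
      unfolding u'(1) v'(1) by (rule imageI) (auto simp: qp u'c v'c)
    show "p (\<lambda>i\<in>I. q u i \<oplus>\<^bsub>M\<^esub> q v i) = p (\<lambda>i\<in>I. q v i \<oplus>\<^bsub>M\<^esub> q u i)"
      unfolding u'(1) v'(1) by (rule pe) (auto simp: qp u'c v'c M.a_comm)
    assume w: "w \<in> p ` (I \<rightarrow>\<^sub>E carrier M)"
    then obtain w' where w': "w = p w'" "w' \<in> I \<rightarrow>\<^sub>E carrier M" by blast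
    have w'c: "w' i \<in> carrier M" if "i \<in> I" for i using w'(2) that by (rule PiE_mem)
    show "p (\<lambda>i\<in>I. q (p (\<lambda>i\<in>I. q u i \<oplus>\<^bsub>M\<^esub> q v i)) i \<oplus>\<^bsub>M\<^esub> q w i) =
        p (\<lambda>i\<in>I. q u i \<oplus>\<^bsub>M\<^esub> q (p (\<lambda>i\<in>I. q v i \<oplus>\<^bsub>M\<^esub> q w i)) i)"
      unfolding u'(1) v'(1) w'(1) by (rule pe) (auto simp: qp u'c v'c w'c M.a_assoc)
  qed (rule imageI, use M.zero_closed in auto)
qed

lemma vec_module_component_additive:
  assumes "\<And>v. q (p v) = v" "i \<in> I"
  shows "(\<lambda>u. q u i) \<in> hom (add_monoid (vec_module p q I M act)) (add_monoid M)"
  using assms by (intro additiveI) (auto simp: vec_module_simps)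

definition free_module :: "'i set \<Rightarrow> ('a, 'r) ring_scheme \<Rightarrow> ('a, 'i \<Rightarrow> 'a) module" where
  "free_module I A = vec_module (\<lambda>v. v) (\<lambda>v. v) I A (\<lambda>a v i. a \<otimes>\<^bsub>A\<^esub> v i)"

lemma free_module_simps [simp]:
  "carrier (free_module I A) = I \<rightarrow>\<^sub>E carrier A"
  "\<zero>\<^bsub>free_module I A\<^esub> = (\<lambda>i\<in>I. \<zero>\<^bsub>A\<^esub>)"
  "u \<oplus>\<^bsub>free_module I A\<^esub> v = (\<lambda>i\<in>I. u i \<oplus>\<^bsub>A\<^esub> v i)"
  "a \<odot>\<^bsub>free_module I A\<^esub> u = (\<lambda>i\<in>I. a \<otimes>\<^bsub>A\<^esub> u i)"
  by (simp_all add: free_module_def vec_module_simps)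

lemma free_module_left_module:
  assumes "ring A"
  shows "left_module A (free_module I A)"
proof -
  interpret A: ring A by fact
  have "abelian_group (free_module I A)"
    unfolding free_module_def by (rule vec_module_abelian_group) (simp, rule A.is_abelian_group)
  then interpret F: abelian_group "free_module I A" .
  show ?thesis
  proof unfold_locales
    fix x assume x: "x \<in> carrier (free_module I A)"
    then have xc: "i \<in> I \<Longrightarrow> x i \<in> carrier A" and xe: "i \<notin> I \<Longrightarrow> x i = undefined" for i by auto
    show "\<one>\<^bsub>A\<^esub> \<odot>\<^bsub>free_module I A\<^esub> x = x" using xc xe by (auto simp: fun_eq_iff)
    fix a assume a: "a \<in> carrier A"
    show "a \<odot>\<^bsub>free_module I A\<^esub> x \<in> carrier (free_module I A)" using a xc by auto
    { fix y assume y: "y \<in> carrier (free_module I A)"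
      then have yc: "i \<in> I \<Longrightarrow> y i \<in> carrier A" for i by auto
      show "a \<odot>\<^bsub>free_module I A\<^esub> (x \<oplus>\<^bsub>free_module I A\<^esub> y) =
          a \<odot>\<^bsub>free_module I A\<^esub> x \<oplus>\<^bsub>free_module I A\<^esub> a \<odot>\<^bsub>free_module I A\<^esub> y"
        using a xc yc by (auto simp: fun_eq_iff A.r_distr) }
    { fix b assume b: "b \<in> carrier A"
      show "(a \<oplus>\<^bsub>A\<^esub> b) \<odot>\<^bsub>free_module I A\<^esub> x =
          a \<odot>\<^bsub>free_module I A\<^esub> x \<oplus>\<^bsub>free_module I A\<^esub> b \<odot>\<^bsub>free_module I A\<^esub> x"
        using a b xc by (auto simp: fun_eq_iff A.l_distr)
      show "(a \<otimes>\<^bsub>A\<^esub> b) \<odot>\<^bsub>free_module I A\<^esub> x =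
          a \<odot>\<^bsub>free_module I A\<^esub> (b \<odot>\<^bsub>free_module I A\<^esub> x)"
        using a b xc by (auto simp: fun_eq_iff A.m_assoc) }
  qed
qed

lemma free_module_fin_gen:
  assumes "ring A" "finite I"
  shows "fin_gen_module A (free_module I A)"
proof -
  interpret A: ring A by fact
  let ?F = "free_module I A"
  interpret F: left_module A ?F by (rule free_module_left_module[OF assms(1)])
  define e where "e i = (\<lambda>j\<in>I. if i = j then \<one>\<^bsub>A\<^esub> else \<zero>\<^bsub>A\<^esub>)" for i
  have e: "e i \<in> carrier ?F" for i by (auto simp: e_def)
  have "v \<in> lspan A ?F (e ` I)" if v: "v \<in> carrier ?F" for v
  proof -
    have vc: "i \<in> I \<Longrightarrow> v i \<in> carrier A" and ve: "i \<notin> I \<Longrightarrow> v i = undefined" for i using v by auto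
    have c: "(\<lambda>i. v i \<odot>\<^bsub>?F\<^esub> e i) \<in> I \<rightarrow> carrier ?F" using vc e by (intro Pi_I F.smult_closed)
    have s: "(\<Oplus>\<^bsub>?F\<^esub>i\<in>I. v i \<odot>\<^bsub>?F\<^esub> e i) \<in> carrier ?F" using c by (rule F.M.finsum_closed)
    have "v = (\<Oplus>\<^bsub>?F\<^esub>i\<in>I. v i \<odot>\<^bsub>?F\<^esub> e i)"
    proof (rule PiE_ext)
      show "v \<in> I \<rightarrow>\<^sub>E carrier A" "(\<Oplus>\<^bsub>?F\<^esub>i\<in>I. v i \<odot>\<^bsub>?F\<^esub> e i) \<in> I \<rightarrow>\<^sub>E carrier A" using v s by simp_all
      fix j assume j: "j \<in> I"
      have "(\<lambda>u. u j) \<in> hom (add_monoid ?F) (add_monoid A)"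
        unfolding free_module_def using j by (intro vec_module_component_additive[where q = "\<lambda>v. v"]) auto
      then have "(\<Oplus>\<^bsub>?F\<^esub>i\<in>I. v i \<odot>\<^bsub>?F\<^esub> e i) j = (\<Oplus>\<^bsub>A\<^esub>i\<in>I. (v i \<odot>\<^bsub>?F\<^esub> e i) j)"
        using c by (rule additive_finsum[OF F.M.abelian_group_axioms A.is_abelian_group])
      also have "\<dots> = (\<Oplus>\<^bsub>A\<^esub>i\<in>I. if i = j then v j else \<zero>\<^bsub>A\<^esub>)"
        using j vc by (intro A.finsum_cong') (auto simp: e_def)
      also have "\<dots> = v j" using assms(2) j vc by (intro A.finsum_delta) auto
      finally show "v j = (\<Oplus>\<^bsub>?F\<^esub>i\<in>I. v i \<odot>\<^bsub>?F\<^esub> e i) j" ..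
    qed
    also have "\<dots> \<in> lspan A ?F (e ` I)"
      using e assms(2) vc by (intro F.lspan_finsum F.lspan_smult F.lspan_generator) auto
    finally show ?thesis .
  qed
  then show ?thesis unfolding fin_gen_module_iff_lspan
    using assms(2) e by (intro exI[of _ "e ` I"]) blast
qed


section \<open>The dual basis lemma\<close>

definition dual_basis ::
    "('a, 'r) ring_scheme \<Rightarrow> ('a, 'm, 'x) module_scheme \<Rightarrow> 'i set \<Rightarrow> ('i \<Rightarrow> 'm) \<Rightarrow> ('i \<Rightarrow> 'm \<Rightarrow> 'a) \<Rightarrow>
      bool" where
  "dual_basis A P I e f \<longleftrightarrow> finite I \<and> (\<forall>i\<in>I. e i \<in> carrier P \<and>
      f i \<in> hom (add_monoid P) (add_monoid A) \<and>
      (\<forall>a\<in>carrier A. \<forall>x\<in>carrier P. f i (a \<odot>\<^bsub>P\<^esub> x) = a \<otimes>\<^bsub>A\<^esub> f i x)) \<and>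
    (\<forall>x\<in>carrier P. x = (\<Oplus>\<^bsub>P\<^esub>i\<in>I. f i x \<odot>\<^bsub>P\<^esub> e i))"

lemma dual_basisD:
  assumes "dual_basis A P I e f"
  shows "finite I" "i \<in> I \<Longrightarrow> e i \<in> carrier P" "i \<in> I \<Longrightarrow> f i \<in> hom (add_monoid P) (add_monoid A)"
    "i \<in> I \<Longrightarrow> x \<in> carrier P \<Longrightarrow> f i x \<in> carrier A"
    "i \<in> I \<Longrightarrow> x \<in> carrier P \<Longrightarrow> y \<in> carrier P \<Longrightarrow> f i (x \<oplus>\<^bsub>P\<^esub> y) = f i x \<oplus>\<^bsub>A\<^esub> f i y"
    "i \<in> I \<Longrightarrow> a \<in> carrier A \<Longrightarrow> x \<in> carrier P \<Longrightarrow> f i (a \<odot>\<^bsub>P\<^esub> x) = a \<otimes>\<^bsub>A\<^esub> f i x"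
    "x \<in> carrier P \<Longrightarrow> (\<Oplus>\<^bsub>P\<^esub>i\<in>I. f i x \<odot>\<^bsub>P\<^esub> e i) = x"
  using assms by (auto simp: dual_basis_def hom_def)

text \<open>
  The map factors through the free module on \<open>I\<close>: the functionals \<open>f i\<close> are the coordinates of a map
  from \<open>P\<close> into it, and \<open>y\<close> prescribes the images of its basis. In particular the \<open>y i\<close> are arbitrary.
\<close>

lemma linear_combination_hom:
  assumes P: "left_module A P" and M: "left_module A M" and I: "finite I"
    and f: "\<And>i. i \<in> I \<Longrightarrow> f i \<in> hom (add_monoid P) (add_monoid A)"
    and fs: "\<And>i a x. i \<in> I \<Longrightarrow> a \<in> carrier A \<Longrightarrow> x \<in> carrier P \<Longrightarrow> f i (a \<odot>\<^bsub>P\<^esub> x) = a \<otimes>\<^bsub>A\<^esub> f i x"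
    and y: "\<And>i. i \<in> I \<Longrightarrow> y i \<in> carrier M"
  shows "(\<lambda>x. \<Oplus>\<^bsub>M\<^esub>i\<in>I. f i x \<odot>\<^bsub>M\<^esub> y i) \<in> lmod_hom A P M"
proof -
  interpret P: left_module A P by fact
  interpret M: left_module A M by fact
  have fc: "f i x \<in> carrier A" if "i \<in> I" "x \<in> carrier P" for i x
    using f[OF that(1)] that by (auto simp: hom_def)
  have fa: "f i (x \<oplus>\<^bsub>P\<^esub> x') = f i x \<oplus>\<^bsub>A\<^esub> f i x'" if "i \<in> I" "x \<in> carrier P" "x' \<in> carrier P" for i x x'
    using f[OF that(1)] that by (auto simp: hom_def)
  show ?thesis
  proof (rule lmod_homI)
    fix x assume x: "x \<in> carrier P"
    have c: "(\<lambda>i. f i x \<odot>\<^bsub>M\<^esub> y i) \<in> I \<rightarrow> carrier M" using x fc y by auto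
    then show "(\<Oplus>\<^bsub>M\<^esub>i\<in>I. f i x \<odot>\<^bsub>M\<^esub> y i) \<in> carrier M" by (rule M.M.finsum_closed)
    show "(\<Oplus>\<^bsub>M\<^esub>i\<in>I. f i (x \<oplus>\<^bsub>P\<^esub> x') \<odot>\<^bsub>M\<^esub> y i) =
        (\<Oplus>\<^bsub>M\<^esub>i\<in>I. f i x \<odot>\<^bsub>M\<^esub> y i) \<oplus>\<^bsub>M\<^esub> (\<Oplus>\<^bsub>M\<^esub>i\<in>I. f i x' \<odot>\<^bsub>M\<^esub> y i)" if x': "x' \<in> carrier P" for x'
    proof -
      have c': "(\<lambda>i. f i x' \<odot>\<^bsub>M\<^esub> y i) \<in> I \<rightarrow> carrier M" using x' fc y by auto
      have "(\<Oplus>\<^bsub>M\<^esub>i\<in>I. f i (x \<oplus>\<^bsub>P\<^esub> x') \<odot>\<^bsub>M\<^esub> y i) = (\<Oplus>\<^bsub>M\<^esub>i\<in>I. f i x \<odot>\<^bsub>M\<^esub> y i \<oplus>\<^bsub>M\<^esub> f i x' \<odot>\<^bsub>M\<^esub> y i)"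
        using x x' fc y by (intro M.M.finsum_cong') (auto simp: fa M.smult_l_distr)
      then show ?thesis using M.M.finsum_addf[OF c c'] by simp
    qed
    show "(\<Oplus>\<^bsub>M\<^esub>i\<in>I. f i (a \<odot>\<^bsub>P\<^esub> x) \<odot>\<^bsub>M\<^esub> y i) = a \<odot>\<^bsub>M\<^esub> (\<Oplus>\<^bsub>M\<^esub>i\<in>I. f i x \<odot>\<^bsub>M\<^esub> y i)"
      if a: "a \<in> carrier A" for a
      unfolding M.smult_finsum[OF a c] using x a fc y
      by (intro M.M.finsum_cong') (auto simp: fs M.smult_assoc1)
  qed
qed

text \<open>
  To lift \<open>h\<close> along \<open>g\<close>, choose preimages \<open>y i\<close> of the elements \<open>h (e i)\<close> under \<open>g\<close>. The linear map with
  coefficients \<open>f i\<close> and values \<open>y i\<close> is a lift, since \<open>x\<close> is the combination of the \<open>e i\<close> with the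
  same coefficients.
\<close>

lemma fg_projective_of_dual_basis:
  assumes P: "P \<in> fg_mods A" and db: "dual_basis A P I e f"
  shows "fg_projective A P"
  unfolding fg_projective_def
proof (intro conjI ballI impI)
  note d = dual_basisD[OF db]
  note lP = fg_modsD(1)[OF P]
  interpret P: left_module A P by (rule lP)
  fix M N g h
  assume M: "M \<in> fg_mods A" and N: "N \<in> fg_mods A" and g: "g \<in> lmod_hom A M N"
    and h: "h \<in> lmod_hom A P N" and onto: "g ` carrier M = carrier N"
  interpret M: left_module A M by (rule fg_modsD(1)[OF M])
  interpret N: left_module A N by (rule fg_modsD(1)[OF N])
  have "\<exists>y\<in>carrier M. g y = h (e i)" if i: "i \<in> I" for i
  proof -
    have "h (e i) \<in> g ` carrier M" unfolding onto using d(2)[OF i] by (rule lmod_homD(1)[OF h])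
    then show ?thesis by (elim imageE) (rule bexI, rule sym)
  qed
  then obtain y where y: "\<And>i. i \<in> I \<Longrightarrow> y i \<in> carrier M" "\<And>i. i \<in> I \<Longrightarrow> g (y i) = h (e i)"
    unfolding Bex_def by metis
  show "\<exists>k\<in>lmod_hom A P M. \<forall>x\<in>carrier P. g (k x) = h x"
  proof (intro bexI ballI)
    show "(\<lambda>x. \<Oplus>\<^bsub>M\<^esub>i\<in>I. f i x \<odot>\<^bsub>M\<^esub> y i) \<in> lmod_hom A P M"
      by (rule linear_combination_hom[OF lP fg_modsD(1)[OF M] d(1,3,6) y(1)])
    fix x assume x: "x \<in> carrier P"
    have "g (\<Oplus>\<^bsub>M\<^esub>i\<in>I. f i x \<odot>\<^bsub>M\<^esub> y i) = (\<Oplus>\<^bsub>N\<^esub>i\<in>I. g (f i x \<odot>\<^bsub>M\<^esub> y i))"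
      using x d(4) y(1) by (intro lmod_hom_finsum[OF g fg_modsD(1)[OF M] fg_modsD(1)[OF N]]) auto
    also have "\<dots> = (\<Oplus>\<^bsub>N\<^esub>i\<in>I. h (f i x \<odot>\<^bsub>P\<^esub> e i))"
      using x d(2,4) y lmod_homD(1)[OF h]
      by (intro N.M.finsum_cong') (auto simp: lmod_homD(3)[OF g] lmod_homD(3)[OF h])
    also have "\<dots> = h (\<Oplus>\<^bsub>P\<^esub>i\<in>I. f i x \<odot>\<^bsub>P\<^esub> e i)"
      using x d(2,4) by (intro lmod_hom_finsum[OF h lP fg_modsD(1)[OF N], symmetric]) auto
    finally show "g (\<Oplus>\<^bsub>M\<^esub>i\<in>I. f i x \<odot>\<^bsub>M\<^esub> y i) = h x" by (simp only: d(7)[OF x])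
  qed
qed (rule P)

lemma fg_projective_lift:
  assumes "fg_projective A P" "M \<in> fg_mods A" "N \<in> fg_mods A" "g \<in> lmod_hom A M N"
    "f \<in> lmod_hom A P N" "g ` carrier M = carrier N"
  obtains h where "h \<in> lmod_hom A P M" "\<And>x. x \<in> carrier P \<Longrightarrow> g (h x) = f x"
proof -
  have "\<exists>h\<in>lmod_hom A P M. \<forall>x\<in>carrier P. g (h x) = f x"
    using assms(1)[unfolded fg_projective_def, THEN conjunct2, rule_format, OF assms(2-6)] .
  then show thesis by (elim bexE) (rule that, assumption, erule (1) bspec)
qed

text \<open>
  Lift the identity of \<open>P\<close> along a surjection from the free module on a finite generating set. The
  components of the lift are the dual functionals. Projectivity is tested only on modules of the
  prescribed element type, so the free module is replaced by an isomorphic copy \<open>F'\<close>.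
\<close>

lemma dual_basis_of_fg_projective:
  assumes "fg_projective A P"
  obtains G f where "dual_basis A P G (\<lambda>g. g) f"
proof -
  have P: "P \<in> fg_mods A" using assms by (simp add: fg_projective_def)
  note lP = fg_modsD(1)[OF P]
  interpret P: left_module A P by (rule lP)
  obtain G where G: "finite G" "G \<subseteq> carrier P" "carrier P \<subseteq> lspan A P G"
    using fg_modsD(2)[OF P] unfolding fin_gen_module_iff_lspan by blast
  let ?F = "free_module G A"
  have A: "ring A" by (rule left_module_groups(3)[OF lP])
  note lF = free_module_left_module[OF A, of G]
  interpret F: left_module A ?F by (rule lF)
  have coord: "(\<lambda>v. v g) \<in> hom (add_monoid ?F) (add_monoid A)" if "g \<in> G" for g
    using that by (intro additiveI) auto
  obtain F' where F': "F' \<in> fg_mods A" "lmod_iso A ?F F'"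
    using fg_mods_exhaustive[OF lF free_module_fin_gen[OF A G(1)]] by blast
  then obtain k where k: "k \<in> lmod_hom A ?F F'" "bij_betw k (carrier ?F) (carrier F')"
    by (auto simp: lmod_iso_def)
  define l where "l = inv_into (carrier ?F) k"
  have l: "l \<in> lmod_hom A F' ?F" "bij_betw l (carrier F') (carrier ?F)"
    using lmod_hom_inv_into[OF k lF] by (simp_all only: l_def)
  define s where "s v = (\<Oplus>\<^bsub>P\<^esub>g\<in>G. v g \<odot>\<^bsub>P\<^esub> g)" for v
  have s: "s \<in> lmod_hom A ?F P"
    unfolding s_def
    using G(2) by (intro linear_combination_hom[OF lF lP G(1) coord]) auto
  have sl: "s \<circ> l \<in> lmod_hom A F' P" by (rule lmod_hom_comp[OF l(1) s])
  have "carrier P \<subseteq> s ` carrier ?F"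
  proof
    fix x assume "x \<in> carrier P"
    then obtain c where c: "c \<in> G \<rightarrow> carrier A" "x = (\<Oplus>\<^bsub>P\<^esub>g\<in>G. c g \<odot>\<^bsub>P\<^esub> g)"
      using G(3) by (blast elim: lspanE)
    have "x = s (restrict c G)"
      unfolding s_def c(2) using c(1) G(2) by (intro P.M.finsum_cong') (auto simp: Pi_iff)
    then show "x \<in> s ` carrier ?F" using c(1) by (intro image_eqI) auto
  qed
  moreover have "s ` carrier ?F \<subseteq> carrier P" using lmod_homD(1)[OF s] by blast
  ultimately have "s ` carrier ?F = carrier P" by blast
  then have "(s \<circ> l) ` carrier F' = carrier P"
    unfolding image_comp[symmetric] bij_betw_imp_surj_on[OF l(2)] .
  from fg_projective_lift[OF assms F'(1) P sl lmod_hom_id this]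
  obtain h where h: "h \<in> lmod_hom A P F'" "\<And>x. x \<in> carrier P \<Longrightarrow> (s \<circ> l) (h x) = x"
    by blast
  define f where "f g x = l (h x) g" for g x
  have lh: "l \<circ> h \<in> lmod_hom A P ?F" by (rule lmod_hom_comp[OF h(1) l(1)])
  have "dual_basis A P G (\<lambda>g. g) f"
    unfolding dual_basis_def
  proof (intro conjI ballI)
    fix g assume g: "g \<in> G"
    show "g \<in> carrier P" using g G(2) by blast
    have c: "l (h x) \<in> G \<rightarrow>\<^sub>E carrier A" if "x \<in> carrier P" for x
      using lmod_homD(1)[OF lh that] by simp
    show "f g \<in> hom (add_monoid P) (add_monoid A)"
    proof (rule additiveI)
      show "f g x \<in> carrier A" if "x \<in> carrier P" for x using c[OF that] g by (auto simp: f_def)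
      show "f g (x \<oplus>\<^bsub>P\<^esub> y) = f g x \<oplus>\<^bsub>A\<^esub> f g y" if "x \<in> carrier P" "y \<in> carrier P" for x y
        using lmod_homD(2)[OF lh that] g by (simp add: f_def)
    qed
    show "f g (a \<odot>\<^bsub>P\<^esub> x) = a \<otimes>\<^bsub>A\<^esub> f g x" if "a \<in> carrier A" "x \<in> carrier P" for a x
      using lmod_homD(3)[OF lh that] g by (simp add: f_def)
  next
    fix x assume "x \<in> carrier P"
    then show "x = (\<Oplus>\<^bsub>P\<^esub>i\<in>G. f i x \<odot>\<^bsub>P\<^esub> i)" using h(2)[of x] by (simp add: s_def f_def)
  qed (rule G(1))
  then show thesis by (rule that)
qed


section \<open>Restriction of scalars\<close>

definition restrict_scalars :: "('a \<Rightarrow> 'a) \<Rightarrow> ('a, 'm) module \<Rightarrow> ('a, 'm) module" where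
  "restrict_scalars \<iota> M = M\<lparr>module.smult := \<lambda>a x. \<iota> a \<odot>\<^bsub>M\<^esub> x\<rparr>"

lemma restrict_scalars_simps [simp]:
  "carrier (restrict_scalars \<iota> M) = carrier M"
  "\<zero>\<^bsub>restrict_scalars \<iota> M\<^esub> = \<zero>\<^bsub>M\<^esub>"
  "x \<oplus>\<^bsub>restrict_scalars \<iota> M\<^esub> y = x \<oplus>\<^bsub>M\<^esub> y"
  "a \<odot>\<^bsub>restrict_scalars \<iota> M\<^esub> x = \<iota> a \<odot>\<^bsub>M\<^esub> x"
  "finsum (restrict_scalars \<iota> M) f I = finsum M f I"
  "a_kernel (restrict_scalars \<iota> M) (restrict_scalars \<iota> N) g = a_kernel M N g"
  by (simp_all add: restrict_scalars_def finsum_def a_kernel_def)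

lemma restrict_scalars_left_module:
  assumes A: "ring A" and \<iota>: "\<iota> \<in> ring_hom A S" and M: "left_module S M"
  shows "left_module A (restrict_scalars \<iota> M)"
proof -
  interpret A: ring A by fact
  interpret M: left_module S M by fact
  have "abelian_group (restrict_scalars \<iota> M)"
  proof (rule abelian_groupI)
    fix x assume "x \<in> carrier (restrict_scalars \<iota> M)"
    then show "\<exists>y\<in>carrier (restrict_scalars \<iota> M).
        y \<oplus>\<^bsub>restrict_scalars \<iota> M\<^esub> x = \<zero>\<^bsub>restrict_scalars \<iota> M\<^esub>"
      by (intro bexI[of _ "\<ominus>\<^bsub>M\<^esub> x"]) (auto simp: M.M.l_neg)
  qed (auto simp: M.M.a_ac)
  then interpret N: abelian_group "restrict_scalars \<iota> M" .
  note h = ring_hom_closed[OF \<iota>] ring_hom_add[OF \<iota>] ring_hom_mult[OF \<iota>] ring_hom_one[OF \<iota>]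
  show ?thesis
    by unfold_locales (simp_all add: h M.smult_l_distr M.smult_r_distr M.smult_assoc1)
qed

text \<open>
  The functions \<open>lam b\<close> form a dual basis of the left \<open>A\<close>-module \<open>S\<close> with respect to the
  generators \<open>B\<close>. So \<open>S\<close> is finitely generated projective over \<open>A\<close>, which is what restriction needs
  in order to preserve finitely generated modules and projectives.
\<close>

locale left_coordinates = A: ring A + S: ring S
  for A :: "('a, 'r) ring_scheme" and S :: "('a, 's) ring_scheme" +
  fixes \<iota> :: "'a \<Rightarrow> 'a" and B :: "'a set" and lam :: "'a \<Rightarrow> 'a \<Rightarrow> 'a"
  assumes ring_map: "\<iota> \<in> ring_hom A S"
    and finite_B: "finite B" and B_closed: "b \<in> B \<Longrightarrow> b \<in> carrier S"
    and lam_closed: "b \<in> B \<Longrightarrow> s \<in> carrier S \<Longrightarrow> lam b s \<in> carrier A"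
    and lam_add: "b \<in> B \<Longrightarrow> s \<in> carrier S \<Longrightarrow> t \<in> carrier S \<Longrightarrow>
      lam b (s \<oplus>\<^bsub>S\<^esub> t) = lam b s \<oplus>\<^bsub>A\<^esub> lam b t"
    and lam_mult: "b \<in> B \<Longrightarrow> a \<in> carrier A \<Longrightarrow> s \<in> carrier S \<Longrightarrow>
      lam b (\<iota> a \<otimes>\<^bsub>S\<^esub> s) = a \<otimes>\<^bsub>A\<^esub> lam b s"
    and lam_sum: "s \<in> carrier S \<Longrightarrow> (\<Oplus>\<^bsub>S\<^esub>b\<in>B. \<iota> (lam b s) \<otimes>\<^bsub>S\<^esub> b) = s"
begin

lemma \<iota>_closed: "a \<in> carrier A \<Longrightarrow> \<iota> a \<in> carrier S"
  by (rule ring_hom_closed[OF ring_map])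

lemma restrict_left_module: "left_module S M \<Longrightarrow> left_module A (restrict_scalars \<iota> M)"
  by (rule restrict_scalars_left_module[OF A.ring_axioms ring_map])

lemma smult_expand:
  assumes M: "left_module S M" and s: "s \<in> carrier S" and x: "x \<in> carrier M"
  shows "s \<odot>\<^bsub>M\<^esub> x = (\<Oplus>\<^bsub>M\<^esub>b\<in>B. \<iota> (lam b s) \<odot>\<^bsub>M\<^esub> (b \<odot>\<^bsub>M\<^esub> x))"
proof -
  interpret M: left_module S M by fact
  have "s \<odot>\<^bsub>M\<^esub> x = (\<Oplus>\<^bsub>S\<^esub>b\<in>B. \<iota> (lam b s) \<otimes>\<^bsub>S\<^esub> b) \<odot>\<^bsub>M\<^esub> x" by (simp only: lam_sum[OF s])
  also have "\<dots> = (\<Oplus>\<^bsub>M\<^esub>b\<in>B. (\<iota> (lam b s) \<otimes>\<^bsub>S\<^esub> b) \<odot>\<^bsub>M\<^esub> x)"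
    using x s by (intro M.finsum_smult) (auto simp: \<iota>_closed lam_closed B_closed)
  also have "\<dots> = (\<Oplus>\<^bsub>M\<^esub>b\<in>B. \<iota> (lam b s) \<odot>\<^bsub>M\<^esub> (b \<odot>\<^bsub>M\<^esub> x))"
    using x s by (intro M.M.finsum_cong') (auto simp: \<iota>_closed lam_closed B_closed M.smult_assoc1)
  finally show ?thesis .
qed

lemma restrict_fin_gen:
  assumes M: "left_module S M" and fg: "fin_gen_module S M"
  shows "fin_gen_module A (restrict_scalars \<iota> M)"
proof -
  interpret M: left_module S M by fact
  interpret N: left_module A "restrict_scalars \<iota> M" by (rule restrict_left_module[OF M])
  obtain G where G: "finite G" "G \<subseteq> carrier M" "carrier M \<subseteq> lspan S M G"
    using fg unfolding fin_gen_module_iff_lspan by blast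
  define H where "H = (\<lambda>(b, g). b \<odot>\<^bsub>M\<^esub> g) ` (B \<times> G)"
  have H: "finite H" "H \<subseteq> carrier (restrict_scalars \<iota> M)"
    using G finite_B B_closed by (auto simp: H_def)
  have bg: "b \<odot>\<^bsub>M\<^esub> g \<in> H" if "b \<in> B" "g \<in> G" for b g using that by (auto simp: H_def)
  have "x \<in> lspan A (restrict_scalars \<iota> M) H" if x: "x \<in> carrier M" for x
  proof -
    obtain c where c: "c \<in> G \<rightarrow> carrier S" "x = (\<Oplus>\<^bsub>M\<^esub>g\<in>G. c g \<odot>\<^bsub>M\<^esub> g)"
      by (rule lspanE[OF subsetD[OF G(3) x]])
    have "c g \<odot>\<^bsub>M\<^esub> g \<in> lspan A (restrict_scalars \<iota> M) H" if g: "g \<in> G" for g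
    proof -
      have cg: "c g \<in> carrier S" "g \<in> carrier M" using c(1) g G(2) by auto
      have "\<iota> (lam b (c g)) \<odot>\<^bsub>M\<^esub> (b \<odot>\<^bsub>M\<^esub> g) \<in> lspan A (restrict_scalars \<iota> M) H" if "b \<in> B" for b
        using N.lspan_smult[OF H(2) lam_closed[OF that cg(1)] N.lspan_generator[OF H bg[OF that g]]]
        by simp
      then show ?thesis
        unfolding smult_expand[OF M cg] using N.lspan_finsum[OF H(2), of B] by simp
    qed
    then show ?thesis unfolding c(2) using N.lspan_finsum[OF H(2), of G] by simp
  qed
  then show ?thesis unfolding fin_gen_module_iff_lspan restrict_scalars_simps
    using H by (intro exI[of _ H]) auto
qed

lemma restrict_fg_mods: "M \<in> fg_mods S \<Longrightarrow> restrict_scalars \<iota> M \<in> fg_mods A"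
  by (simp add: fg_mods_def restrict_left_module restrict_fin_gen)

lemma restrict_hom: "f \<in> lmod_hom S M N \<Longrightarrow> f \<in> lmod_hom A (restrict_scalars \<iota> M) (restrict_scalars \<iota> N)"
  by (rule lmod_homI) (simp_all add: lmod_homD \<iota>_closed)

text \<open>The products \<open>b \<odot> g\<close> of two dual bases form a dual basis: projectivity is transitive.\<close>

lemma restrict_projective:
  assumes "fg_projective S P"
  shows "fg_projective A (restrict_scalars \<iota> P)"
proof -
  have P: "P \<in> fg_mods S" using assms by (simp add: fg_projective_def)
  interpret P: left_module S P by (rule fg_modsD(1)[OF P])
  obtain G f where "dual_basis S P G (\<lambda>g. g) f" using assms by (rule dual_basis_of_fg_projective)
  note d = dual_basisD[OF this]
  have "dual_basis A (restrict_scalars \<iota> P) (G \<times> B) (\<lambda>p. snd p \<odot>\<^bsub>P\<^esub> fst p)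
      (\<lambda>p x. lam (snd p) (f (fst p) x))"
    unfolding dual_basis_def
  proof (intro conjI ballI)
    show "finite (G \<times> B)" using d(1) finite_B by simp
    fix p assume "p \<in> G \<times> B"
    then have p: "fst p \<in> G" "snd p \<in> B" by auto
    show "snd p \<odot>\<^bsub>P\<^esub> fst p \<in> carrier (restrict_scalars \<iota> P)"
      using p d(2) B_closed by simp
    show "(\<lambda>x. lam (snd p) (f (fst p) x)) \<in> hom (add_monoid (restrict_scalars \<iota> P)) (add_monoid A)"
      by (rule additiveI) (simp_all add: p d(4,5) lam_closed lam_add)
    show "lam (snd p) (f (fst p) (a \<odot>\<^bsub>restrict_scalars \<iota> P\<^esub> x)) = a \<otimes>\<^bsub>A\<^esub> lam (snd p) (f (fst p) x)"
      if "a \<in> carrier A" "x \<in> carrier (restrict_scalars \<iota> P)" for a x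
      using that by (simp add: p d(4,6) lam_mult \<iota>_closed)
  next
    fix x assume "x \<in> carrier (restrict_scalars \<iota> P)"
    then have x: "x \<in> carrier P" by simp
    have "x = (\<Oplus>\<^bsub>P\<^esub>g\<in>G. f g x \<odot>\<^bsub>P\<^esub> g)" by (simp only: d(7)[OF x])
    also have "\<dots> = (\<Oplus>\<^bsub>P\<^esub>g\<in>G. \<Oplus>\<^bsub>P\<^esub>b\<in>B. \<iota> (lam b (f g x)) \<odot>\<^bsub>P\<^esub> (b \<odot>\<^bsub>P\<^esub> g))"
    proof (rule P.M.finsum_cong'[OF refl])
      show "(\<lambda>g. \<Oplus>\<^bsub>P\<^esub>b\<in>B. \<iota> (lam b (f g x)) \<odot>\<^bsub>P\<^esub> (b \<odot>\<^bsub>P\<^esub> g)) \<in> G \<rightarrow> carrier P"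
        using x d(2,4) by (intro Pi_I P.M.finsum_closed) (auto simp: \<iota>_closed lam_closed B_closed)
      show "f g x \<odot>\<^bsub>P\<^esub> g = (\<Oplus>\<^bsub>P\<^esub>b\<in>B. \<iota> (lam b (f g x)) \<odot>\<^bsub>P\<^esub> (b \<odot>\<^bsub>P\<^esub> g))" if "g \<in> G" for g
        by (rule smult_expand[OF fg_modsD(1)[OF P] d(4)[OF that x] d(2)[OF that]])
    qed
    also have "\<dots> = (\<Oplus>\<^bsub>P\<^esub>p\<in>G \<times> B. \<iota> (lam (snd p) (f (fst p) x)) \<odot>\<^bsub>P\<^esub> (snd p \<odot>\<^bsub>P\<^esub> fst p))"
      using x d(1,2,4) finite_B by (intro P.M.finsum_Times) (auto simp: \<iota>_closed lam_closed B_closed)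
    finally show "x = (\<Oplus>\<^bsub>restrict_scalars \<iota> P\<^esub>p\<in>G \<times> B.
        lam (snd p) (f (fst p) x) \<odot>\<^bsub>restrict_scalars \<iota> P\<^esub> (snd p \<odot>\<^bsub>P\<^esub> fst p))"
      by simp
  qed
  then show ?thesis by (rule fg_projective_of_dual_basis[OF restrict_fg_mods[OF P]])
qed

lemma restrict_exact_functor: "exact_functor S A (restrict_scalars \<iota>) (\<lambda>M N f. f)"
  by unfold_locales (simp_all add: restrict_fg_mods restrict_hom restrict_projective)

end


section \<open>Induction of modules\<close>

text \<open>
  \<open>pack\<close> turns functions with values in sets of sequences into sets of sequences, by prefixing the
  argument. It gives the induced modules the element type that \<^typ>\<open>'a fg_module\<close> prescribes.
\<close>

definition pack :: "('a \<Rightarrow> (nat \<Rightarrow> 'a) set) \<Rightarrow> (nat \<Rightarrow> 'a) set" where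
  "pack v = {w. (\<lambda>n. w (Suc n)) \<in> v (w 0)}"

definition unpack :: "(nat \<Rightarrow> 'a) set \<Rightarrow> 'a \<Rightarrow> (nat \<Rightarrow> 'a) set" where
  "unpack u b = {w. case_nat b w \<in> u}"

lemma unpack_pack [simp]: "unpack (pack v) = v"
  by (simp add: unpack_def pack_def fun_eq_iff)

text \<open>
  Here \<open>B\<close> is a basis of the right \<open>A\<close>-module \<open>S\<close> and \<open>rho b\<close> are the coordinate functions. Thus
  \<open>S \<otimes> M\<close> is the direct sum of the \<open>b \<otimes> M\<close>, a vector \<open>v\<close> indexed by \<open>B\<close> stands for the sum of
  the \<open>b \<otimes> v b\<close>, and \<open>s\<close> acts on vectors as the matrix with entries \<open>rho c (s b)\<close>. With this
  model exactness of induction is evident, because maps act on each component.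
\<close>

locale right_coordinates = A: ring A + S: ring S
  for A :: "('a, 'r) ring_scheme" and S :: "('a, 's) ring_scheme" +
  fixes \<iota> :: "'a \<Rightarrow> 'a" and B :: "'a set" and rho :: "'a \<Rightarrow> 'a \<Rightarrow> 'a"
  assumes ring_map: "\<iota> \<in> ring_hom A S"
    and finite_B: "finite B" and B_closed: "b \<in> B \<Longrightarrow> b \<in> carrier S"
    and rho_closed: "b \<in> B \<Longrightarrow> s \<in> carrier S \<Longrightarrow> rho b s \<in> carrier A"
    and rho_add: "b \<in> B \<Longrightarrow> s \<in> carrier S \<Longrightarrow> t \<in> carrier S \<Longrightarrow>
      rho b (s \<oplus>\<^bsub>S\<^esub> t) = rho b s \<oplus>\<^bsub>A\<^esub> rho b t"
    and rho_mult: "b \<in> B \<Longrightarrow> a \<in> carrier A \<Longrightarrow> s \<in> carrier S \<Longrightarrow>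
      rho b (s \<otimes>\<^bsub>S\<^esub> \<iota> a) = rho b s \<otimes>\<^bsub>A\<^esub> a"
    and rho_sum: "s \<in> carrier S \<Longrightarrow> (\<Oplus>\<^bsub>S\<^esub>b\<in>B. b \<otimes>\<^bsub>S\<^esub> \<iota> (rho b s)) = s"
    and rho_basis: "b \<in> B \<Longrightarrow> c \<in> B \<Longrightarrow> rho c b = (if b = c then \<one>\<^bsub>A\<^esub> else \<zero>\<^bsub>A\<^esub>)"
begin

lemma \<iota>_closed: "a \<in> carrier A \<Longrightarrow> \<iota> a \<in> carrier S"
  by (rule ring_hom_closed[OF ring_map])

text \<open>
  Expanding \<open>t\<close> in the basis shows that \<open>s \<mapsto> (rho c (s b))\<close> is multiplicative into matrices,
  which gives the associativity of the action on vectors.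
\<close>

lemma rho_mult_expand:
  assumes "c \<in> B" "s \<in> carrier S" "t \<in> carrier S"
  shows "(\<Oplus>\<^bsub>A\<^esub>b\<in>B. rho c (s \<otimes>\<^bsub>S\<^esub> b) \<otimes>\<^bsub>A\<^esub> rho b t) = rho c (s \<otimes>\<^bsub>S\<^esub> t)"
proof -
  have rc: "rho c \<in> hom (add_monoid S) (add_monoid A)"
    using assms by (intro additiveI) (simp_all add: rho_closed rho_add)
  have sl: "(\<lambda>x. s \<otimes>\<^bsub>S\<^esub> x) \<in> hom (add_monoid S) (add_monoid S)"
    using assms by (intro additiveI) (simp_all add: S.r_distr)
  have cl: "(\<lambda>b. b \<otimes>\<^bsub>S\<^esub> \<iota> (rho b t)) \<in> B \<rightarrow> carrier S"
    using assms by (auto simp: B_closed \<iota>_closed rho_closed)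
  have "rho c (s \<otimes>\<^bsub>S\<^esub> t) = rho c (s \<otimes>\<^bsub>S\<^esub> (\<Oplus>\<^bsub>S\<^esub>b\<in>B. b \<otimes>\<^bsub>S\<^esub> \<iota> (rho b t)))"
    by (simp only: rho_sum[OF assms(3)])
  also have "\<dots> = rho c (\<Oplus>\<^bsub>S\<^esub>b\<in>B. s \<otimes>\<^bsub>S\<^esub> (b \<otimes>\<^bsub>S\<^esub> \<iota> (rho b t)))"
    by (simp only: additive_finsum[OF S.is_abelian_group S.is_abelian_group sl cl])
  also have "\<dots> = (\<Oplus>\<^bsub>A\<^esub>b\<in>B. rho c (s \<otimes>\<^bsub>S\<^esub> (b \<otimes>\<^bsub>S\<^esub> \<iota> (rho b t))))"
    using cl assms(2) by (intro additive_finsum[OF S.is_abelian_group A.is_abelian_group rc]) auto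
  also have "\<dots> = (\<Oplus>\<^bsub>A\<^esub>b\<in>B. rho c (s \<otimes>\<^bsub>S\<^esub> b) \<otimes>\<^bsub>A\<^esub> rho b t)"
    using assms by (intro A.finsum_cong')
      (auto simp: B_closed \<iota>_closed rho_closed rho_mult S.m_assoc[symmetric])
  finally show ?thesis ..
qed

definition ind :: "'a fg_module \<Rightarrow> 'a fg_module" where
  "ind M = vec_module pack unpack B M (\<lambda>s v c. \<Oplus>\<^bsub>M\<^esub>b\<in>B. rho c (s \<otimes>\<^bsub>S\<^esub> b) \<odot>\<^bsub>M\<^esub> v b)"

lemma pack_in_ind: "(\<And>b. b \<in> B \<Longrightarrow> v b \<in> carrier M) \<Longrightarrow> pack (\<lambda>b\<in>B. v b) \<in> carrier (ind M)"
  unfolding ind_def vec_module_simps by (intro imageI) (auto simp del: restrict_apply simp: restrict_PiE_iff)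

lemma unpack_closed: "u \<in> carrier (ind M) \<Longrightarrow> b \<in> B \<Longrightarrow> unpack u b \<in> carrier M"
  unfolding ind_def vec_module_simps by auto

lemma ind_eqI:
  assumes "u \<in> carrier (ind M)" "v \<in> carrier (ind M)" "\<And>b. b \<in> B \<Longrightarrow> unpack u b = unpack v b"
  shows "u = v"
proof -
  obtain u' where u': "u = pack u'" "u' \<in> B \<rightarrow>\<^sub>E carrier M"
    using assms(1) unfolding ind_def vec_module_simps by blast
  obtain v' where v': "v = pack v'" "v' \<in> B \<rightarrow>\<^sub>E carrier M"
    using assms(2) unfolding ind_def vec_module_simps by blast
  have "u' = v'" using u' v' assms(3) by (intro PiE_ext) auto
  then show ?thesis using u' v' by simp
qed

lemma unpack_ops:
  assumes "c \<in> B"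
  shows "unpack \<zero>\<^bsub>ind M\<^esub> c = \<zero>\<^bsub>M\<^esub>"
    and "unpack (u \<oplus>\<^bsub>ind M\<^esub> v) c = unpack u c \<oplus>\<^bsub>M\<^esub> unpack v c"
    and "unpack (s \<odot>\<^bsub>ind M\<^esub> u) c = (\<Oplus>\<^bsub>M\<^esub>b\<in>B. rho c (s \<otimes>\<^bsub>S\<^esub> b) \<odot>\<^bsub>M\<^esub> unpack u b)"
  using assms by (simp_all add: ind_def vec_module_simps)

lemma ind_left_module:
  assumes M: "left_module A M"
  shows "left_module S (ind M)"
proof -
  interpret M: left_module A M by fact
  have "abelian_group (ind M)"
    unfolding ind_def by (rule vec_module_abelian_group[OF _ M.M.abelian_group_axioms]) simp
  then interpret I: abelian_group "ind M" .
  have rc: "rho c (s \<otimes>\<^bsub>S\<^esub> b) \<in> carrier A" if "b \<in> B" "c \<in> B" "s \<in> carrier S" for b c s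
    using that by (simp add: rho_closed B_closed)
  have summand: "(\<lambda>b. rho c (s \<otimes>\<^bsub>S\<^esub> b) \<odot>\<^bsub>M\<^esub> unpack u b) \<in> B \<rightarrow> carrier M"
    if "c \<in> B" "s \<in> carrier S" "u \<in> carrier (ind M)" for c s u
    using that by (auto simp: rc unpack_closed)
  have cl: "s \<odot>\<^bsub>ind M\<^esub> u \<in> carrier (ind M)" if "s \<in> carrier S" "u \<in> carrier (ind M)" for s u
  proof -
    have "s \<odot>\<^bsub>ind M\<^esub> u = pack (\<lambda>c\<in>B. \<Oplus>\<^bsub>M\<^esub>b\<in>B. rho c (s \<otimes>\<^bsub>S\<^esub> b) \<odot>\<^bsub>M\<^esub> unpack u b)"
      by (simp add: ind_def vec_module_simps)
    also have "\<dots> \<in> carrier (ind M)" using that by (intro pack_in_ind M.M.finsum_closed summand)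
    finally show ?thesis .
  qed
  show ?thesis
  proof unfold_locales
    fix s u assume s: "s \<in> carrier S" and u: "u \<in> carrier (ind M)"
    show "s \<odot>\<^bsub>ind M\<^esub> u \<in> carrier (ind M)" by (rule cl[OF s u])
    show "s \<odot>\<^bsub>ind M\<^esub> (u \<oplus>\<^bsub>ind M\<^esub> v) = s \<odot>\<^bsub>ind M\<^esub> u \<oplus>\<^bsub>ind M\<^esub> s \<odot>\<^bsub>ind M\<^esub> v"
      if v: "v \<in> carrier (ind M)" for v
    proof (rule ind_eqI)
      fix c assume c: "c \<in> B"
      have "(\<Oplus>\<^bsub>M\<^esub>b\<in>B. rho c (s \<otimes>\<^bsub>S\<^esub> b) \<odot>\<^bsub>M\<^esub> (unpack u b \<oplus>\<^bsub>M\<^esub> unpack v b)) =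
          (\<Oplus>\<^bsub>M\<^esub>b\<in>B. rho c (s \<otimes>\<^bsub>S\<^esub> b) \<odot>\<^bsub>M\<^esub> unpack u b \<oplus>\<^bsub>M\<^esub> rho c (s \<otimes>\<^bsub>S\<^esub> b) \<odot>\<^bsub>M\<^esub> unpack v b)"
        using c s u v by (intro M.M.finsum_cong') (auto simp: rc unpack_closed M.smult_r_distr)
      also have "\<dots> = (\<Oplus>\<^bsub>M\<^esub>b\<in>B. rho c (s \<otimes>\<^bsub>S\<^esub> b) \<odot>\<^bsub>M\<^esub> unpack u b) \<oplus>\<^bsub>M\<^esub>
          (\<Oplus>\<^bsub>M\<^esub>b\<in>B. rho c (s \<otimes>\<^bsub>S\<^esub> b) \<odot>\<^bsub>M\<^esub> unpack v b)"
        by (rule M.M.finsum_addf[OF summand[OF c s u] summand[OF c s v]])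
      also have "(\<Oplus>\<^bsub>M\<^esub>b\<in>B. rho c (s \<otimes>\<^bsub>S\<^esub> b) \<odot>\<^bsub>M\<^esub> (unpack u b \<oplus>\<^bsub>M\<^esub> unpack v b)) =
          (\<Oplus>\<^bsub>M\<^esub>b\<in>B. rho c (s \<otimes>\<^bsub>S\<^esub> b) \<odot>\<^bsub>M\<^esub> unpack (u \<oplus>\<^bsub>ind M\<^esub> v) b)"
        using c s u v by (intro M.M.finsum_cong') (auto simp: rc unpack_ops unpack_closed)
      finally show "unpack (s \<odot>\<^bsub>ind M\<^esub> (u \<oplus>\<^bsub>ind M\<^esub> v)) c =
          unpack (s \<odot>\<^bsub>ind M\<^esub> u \<oplus>\<^bsub>ind M\<^esub> s \<odot>\<^bsub>ind M\<^esub> v) c"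
        by (simp only: unpack_ops[OF c])
    qed (use s u v cl in auto)
  next
    fix s t u assume s: "s \<in> carrier S" and t: "t \<in> carrier S" and u: "u \<in> carrier (ind M)"
    show "(s \<oplus>\<^bsub>S\<^esub> t) \<odot>\<^bsub>ind M\<^esub> u = s \<odot>\<^bsub>ind M\<^esub> u \<oplus>\<^bsub>ind M\<^esub> t \<odot>\<^bsub>ind M\<^esub> u"
    proof (rule ind_eqI)
      fix c assume c: "c \<in> B"
      have "(\<Oplus>\<^bsub>M\<^esub>b\<in>B. rho c ((s \<oplus>\<^bsub>S\<^esub> t) \<otimes>\<^bsub>S\<^esub> b) \<odot>\<^bsub>M\<^esub> unpack u b) =
          (\<Oplus>\<^bsub>M\<^esub>b\<in>B. rho c (s \<otimes>\<^bsub>S\<^esub> b) \<odot>\<^bsub>M\<^esub> unpack u b \<oplus>\<^bsub>M\<^esub> rho c (t \<otimes>\<^bsub>S\<^esub> b) \<odot>\<^bsub>M\<^esub> unpack u b)"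
        using c s t u by (intro M.M.finsum_cong')
          (auto simp: rc unpack_closed S.l_distr B_closed rho_add M.smult_l_distr)
      also have "\<dots> = (\<Oplus>\<^bsub>M\<^esub>b\<in>B. rho c (s \<otimes>\<^bsub>S\<^esub> b) \<odot>\<^bsub>M\<^esub> unpack u b) \<oplus>\<^bsub>M\<^esub>
          (\<Oplus>\<^bsub>M\<^esub>b\<in>B. rho c (t \<otimes>\<^bsub>S\<^esub> b) \<odot>\<^bsub>M\<^esub> unpack u b)"
        by (rule M.M.finsum_addf[OF summand[OF c s u] summand[OF c t u]])
      finally show "unpack ((s \<oplus>\<^bsub>S\<^esub> t) \<odot>\<^bsub>ind M\<^esub> u) c =
          unpack (s \<odot>\<^bsub>ind M\<^esub> u \<oplus>\<^bsub>ind M\<^esub> t \<odot>\<^bsub>ind M\<^esub> u) c"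
        by (simp only: unpack_ops[OF c])
    qed (use s t u cl in auto)
    show "(s \<otimes>\<^bsub>S\<^esub> t) \<odot>\<^bsub>ind M\<^esub> u = s \<odot>\<^bsub>ind M\<^esub> (t \<odot>\<^bsub>ind M\<^esub> u)"
    proof (rule ind_eqI)
      fix d assume d: "d \<in> B"
      have "(\<Oplus>\<^bsub>M\<^esub>c\<in>B. rho d (s \<otimes>\<^bsub>S\<^esub> c) \<odot>\<^bsub>M\<^esub> unpack (t \<odot>\<^bsub>ind M\<^esub> u) c) =
          (\<Oplus>\<^bsub>M\<^esub>c\<in>B. rho d (s \<otimes>\<^bsub>S\<^esub> c) \<odot>\<^bsub>M\<^esub> (\<Oplus>\<^bsub>M\<^esub>b\<in>B. rho c (t \<otimes>\<^bsub>S\<^esub> b) \<odot>\<^bsub>M\<^esub> unpack u b))"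
        using d s t u by (intro M.M.finsum_cong' refl)
          (auto simp: unpack_ops(3) unpack_closed intro!: M.smult_closed rc M.M.finsum_closed)
      also have "\<dots> = (\<Oplus>\<^bsub>M\<^esub>b\<in>B. (\<Oplus>\<^bsub>A\<^esub>c\<in>B. rho d (s \<otimes>\<^bsub>S\<^esub> c) \<otimes>\<^bsub>A\<^esub> rho c (t \<otimes>\<^bsub>S\<^esub> b)) \<odot>\<^bsub>M\<^esub> unpack u b)"
        using d s t u finite_B by (intro M.finsum_smult_assoc) (auto simp: rc unpack_closed)
      also have "\<dots> = (\<Oplus>\<^bsub>M\<^esub>b\<in>B. rho d ((s \<otimes>\<^bsub>S\<^esub> t) \<otimes>\<^bsub>S\<^esub> b) \<odot>\<^bsub>M\<^esub> unpack u b)"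
        using d s t u by (intro M.M.finsum_cong' refl)
          (auto simp: rho_mult_expand B_closed S.m_assoc rho_closed unpack_closed)
      finally show "unpack ((s \<otimes>\<^bsub>S\<^esub> t) \<odot>\<^bsub>ind M\<^esub> u) d = unpack (s \<odot>\<^bsub>ind M\<^esub> (t \<odot>\<^bsub>ind M\<^esub> u)) d"
        by (simp only: unpack_ops(3)[OF d])
    qed (use s t u cl in auto)
  next
    fix u assume u: "u \<in> carrier (ind M)"
    show "\<one>\<^bsub>S\<^esub> \<odot>\<^bsub>ind M\<^esub> u = u"
    proof (rule ind_eqI)
      fix c assume c: "c \<in> B"
      have "(\<Oplus>\<^bsub>M\<^esub>b\<in>B. rho c (\<one>\<^bsub>S\<^esub> \<otimes>\<^bsub>S\<^esub> b) \<odot>\<^bsub>M\<^esub> unpack u b) =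
          (\<Oplus>\<^bsub>M\<^esub>b\<in>B. if b = c then unpack u c else \<zero>\<^bsub>M\<^esub>)"
        using c u by (intro M.M.finsum_cong') (auto simp: B_closed rho_basis unpack_closed)
      also have "\<dots> = unpack u c" using c u finite_B by (intro M.M.finsum_delta) (auto simp: unpack_closed)
      finally show "unpack (\<one>\<^bsub>S\<^esub> \<odot>\<^bsub>ind M\<^esub> u) c = unpack u c" by (simp only: unpack_ops[OF c])
    qed (use u cl in auto)
  qed
qed

text \<open>
  The tensor \<open>s \<otimes> x\<close>: writing \<open>s\<close> as the sum of the \<open>c (rho c s)\<close> and moving the coefficients across
  gives the component \<open>rho c s \<odot> x\<close> at \<open>c\<close>.
\<close>

definition tensor :: "'a fg_module \<Rightarrow> 'a \<Rightarrow> (nat \<Rightarrow> 'a) set \<Rightarrow> (nat \<Rightarrow> 'a) set" where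
  "tensor M s x = pack (\<lambda>c\<in>B. rho c s \<odot>\<^bsub>M\<^esub> x)"

lemma unpack_tensor: "c \<in> B \<Longrightarrow> unpack (tensor M s x) c = rho c s \<odot>\<^bsub>M\<^esub> x"
  by (simp add: tensor_def)

lemma tensor_closed:
  assumes "left_module A M" "s \<in> carrier S" "x \<in> carrier M"
  shows "tensor M s x \<in> carrier (ind M)"
proof -
  interpret M: left_module A M by fact
  show ?thesis unfolding tensor_def using assms(2,3) by (intro pack_in_ind) (auto simp: rho_closed)
qed

lemma smult_tensor:
  assumes M: "left_module A M" and s: "s \<in> carrier S" and t: "t \<in> carrier S" and x: "x \<in> carrier M"
  shows "s \<odot>\<^bsub>ind M\<^esub> tensor M t x = tensor M (s \<otimes>\<^bsub>S\<^esub> t) x"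
proof (rule ind_eqI)
  interpret M: left_module A M by fact
  interpret I: left_module S "ind M" by (rule ind_left_module[OF M])
  show "s \<odot>\<^bsub>ind M\<^esub> tensor M t x \<in> carrier (ind M)" "tensor M (s \<otimes>\<^bsub>S\<^esub> t) x \<in> carrier (ind M)"
    using s t x by (auto intro: tensor_closed[OF M])
  fix c assume c: "c \<in> B"
  have "(\<Oplus>\<^bsub>M\<^esub>b\<in>B. rho c (s \<otimes>\<^bsub>S\<^esub> b) \<odot>\<^bsub>M\<^esub> unpack (tensor M t x) b) =
      (\<Oplus>\<^bsub>M\<^esub>b\<in>B. (rho c (s \<otimes>\<^bsub>S\<^esub> b) \<otimes>\<^bsub>A\<^esub> rho b t) \<odot>\<^bsub>M\<^esub> x)"
    using c s t x by (intro M.M.finsum_cong')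
      (auto simp: unpack_tensor rho_closed B_closed M.smult_assoc1)
  also have "\<dots> = (\<Oplus>\<^bsub>A\<^esub>b\<in>B. rho c (s \<otimes>\<^bsub>S\<^esub> b) \<otimes>\<^bsub>A\<^esub> rho b t) \<odot>\<^bsub>M\<^esub> x"
    using c s t x by (intro M.finsum_smult[symmetric]) (auto simp: rho_closed B_closed)
  also have "\<dots> = rho c (s \<otimes>\<^bsub>S\<^esub> t) \<odot>\<^bsub>M\<^esub> x" by (simp only: rho_mult_expand[OF c s t])
  finally show "unpack (s \<odot>\<^bsub>ind M\<^esub> tensor M t x) c = unpack (tensor M (s \<otimes>\<^bsub>S\<^esub> t) x) c"
    by (simp only: unpack_ops(3)[OF c] unpack_tensor[OF c])
qed

lemma tensor_add:
  assumes M: "left_module A M" and s: "s \<in> carrier S" and x: "x \<in> carrier M" and y: "y \<in> carrier M"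
  shows "tensor M s (x \<oplus>\<^bsub>M\<^esub> y) = tensor M s x \<oplus>\<^bsub>ind M\<^esub> tensor M s y"
proof -
  interpret M: left_module A M by fact
  interpret I: left_module S "ind M" by (rule ind_left_module[OF M])
  note cl = tensor_closed[OF M s]
  show ?thesis
    by (rule ind_eqI[OF cl[OF M.M.a_closed[OF x y]] I.M.a_closed[OF cl[OF x] cl[OF y]]])
      (simp add: unpack_tensor unpack_ops(2) M.smult_r_distr rho_closed s x y)
qed

lemma tensor_smult:
  assumes M: "left_module A M" and s: "s \<in> carrier S" and a: "a \<in> carrier A" and x: "x \<in> carrier M"
  shows "tensor M s (a \<odot>\<^bsub>M\<^esub> x) = tensor M (s \<otimes>\<^bsub>S\<^esub> \<iota> a) x"
proof -
  interpret M: left_module A M by fact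
  note sa = S.m_closed[OF s \<iota>_closed[OF a]]
  show ?thesis
    by (rule ind_eqI[OF tensor_closed[OF M s M.smult_closed[OF a x]] tensor_closed[OF M sa x]])
      (simp add: unpack_tensor rho_mult M.smult_assoc1 rho_closed s a x)
qed

text \<open>The unit \<open>x \<mapsto> 1 \<otimes> x\<close> of the adjunction between induction and restriction.\<close>

lemma unit_hom:
  assumes M: "left_module A M"
  shows "tensor M \<one>\<^bsub>S\<^esub> \<in> lmod_hom A M (restrict_scalars \<iota> (ind M))"
proof -
  interpret M: left_module A M by fact
  interpret I: left_module S "ind M" by (rule ind_left_module[OF M])
  show ?thesis
  proof (rule lmod_homI; (unfold restrict_scalars_simps)?)
    show "tensor M \<one>\<^bsub>S\<^esub> x \<in> carrier (ind M)" if "x \<in> carrier M" for x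
      using that by (intro tensor_closed[OF M]) auto
    fix x assume x: "x \<in> carrier M"
    show "tensor M \<one>\<^bsub>S\<^esub> (x \<oplus>\<^bsub>M\<^esub> y) = tensor M \<one>\<^bsub>S\<^esub> x \<oplus>\<^bsub>ind M\<^esub> tensor M \<one>\<^bsub>S\<^esub> y"
      if y: "y \<in> carrier M" for y
      by (rule tensor_add[OF M S.one_closed x y])
    show "tensor M \<one>\<^bsub>S\<^esub> (a \<odot>\<^bsub>M\<^esub> x) = \<iota> a \<odot>\<^bsub>ind M\<^esub> tensor M \<one>\<^bsub>S\<^esub> x" if a: "a \<in> carrier A" for a
      using \<iota>_closed[OF a]
      by (simp add: tensor_smult[OF M S.one_closed a x] smult_tensor[OF M \<iota>_closed[OF a] S.one_closed x])
  qed
qed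

text \<open>So \<open>S\<close>-linear maps out of the induced module are determined on the tensors \<open>1 \<otimes> x\<close>.\<close>

lemma ind_decompose:
  assumes M: "left_module A M" and u: "u \<in> carrier (ind M)"
  shows "u = (\<Oplus>\<^bsub>ind M\<^esub>b\<in>B. b \<odot>\<^bsub>ind M\<^esub> tensor M \<one>\<^bsub>S\<^esub> (unpack u b))"
proof (rule ind_eqI)
  interpret M: left_module A M by fact
  interpret I: left_module S "ind M" by (rule ind_left_module[OF M])
  have bt: "b \<odot>\<^bsub>ind M\<^esub> tensor M \<one>\<^bsub>S\<^esub> (unpack u b) = tensor M b (unpack u b)" if "b \<in> B" for b
    using that by (simp add: smult_tensor[OF M] B_closed unpack_closed[OF u])
  have cl: "(\<lambda>b. b \<odot>\<^bsub>ind M\<^esub> tensor M \<one>\<^bsub>S\<^esub> (unpack u b)) \<in> B \<rightarrow> carrier (ind M)"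
    by (auto intro!: tensor_closed[OF M] simp: B_closed unpack_closed[OF u])
  then show "(\<Oplus>\<^bsub>ind M\<^esub>b\<in>B. b \<odot>\<^bsub>ind M\<^esub> tensor M \<one>\<^bsub>S\<^esub> (unpack u b)) \<in> carrier (ind M)"
    by (rule I.M.finsum_closed)
  fix c assume c: "c \<in> B"
  have "(\<lambda>u. unpack u c) \<in> hom (add_monoid (ind M)) (add_monoid M)"
    unfolding ind_def by (rule vec_module_component_additive[OF unpack_pack c])
  then have "unpack (\<Oplus>\<^bsub>ind M\<^esub>b\<in>B. b \<odot>\<^bsub>ind M\<^esub> tensor M \<one>\<^bsub>S\<^esub> (unpack u b)) c =
      (\<Oplus>\<^bsub>M\<^esub>b\<in>B. unpack (b \<odot>\<^bsub>ind M\<^esub> tensor M \<one>\<^bsub>S\<^esub> (unpack u b)) c)"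
    using cl by (rule additive_finsum[OF I.M.abelian_group_axioms M.M.abelian_group_axioms])
  also have "\<dots> = (\<Oplus>\<^bsub>M\<^esub>b\<in>B. if b = c then unpack u c else \<zero>\<^bsub>M\<^esub>)"
    using c u by (intro M.M.finsum_cong') (auto simp: bt unpack_tensor rho_basis unpack_closed)
  also have "\<dots> = unpack u c" using c u finite_B by (intro M.M.finsum_delta) (auto simp: unpack_closed)
  finally show "unpack u c = unpack (\<Oplus>\<^bsub>ind M\<^esub>b\<in>B. b \<odot>\<^bsub>ind M\<^esub> tensor M \<one>\<^bsub>S\<^esub> (unpack u b)) c" ..
qed (rule u)

lemma ind_fin_gen:
  assumes M: "left_module A M" and fg: "fin_gen_module A M"
  shows "fin_gen_module S (ind M)"
proof -
  interpret M: left_module A M by fact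
  interpret I: left_module S "ind M" by (rule ind_left_module[OF M])
  obtain G where G: "finite G" "G \<subseteq> carrier M" "carrier M \<subseteq> lspan A M G"
    using fg unfolding fin_gen_module_iff_lspan by blast
  have lR: "left_module A (restrict_scalars \<iota> (ind M))"
    by (rule restrict_scalars_left_module[OF A.ring_axioms ring_map ind_left_module[OF M]])
  note t = unit_hom[OF M] and tD = lmod_homD[OF unit_hom[OF M], unfolded restrict_scalars_simps]
  let ?H = "tensor M \<one>\<^bsub>S\<^esub> ` G"
  have H: "finite ?H" "?H \<subseteq> carrier (ind M)" using G tD(1) by auto
  have x: "tensor M \<one>\<^bsub>S\<^esub> x \<in> lspan S (ind M) ?H" if x: "x \<in> carrier M" for x
  proof -
    obtain c where c: "c \<in> G \<rightarrow> carrier A" "x = (\<Oplus>\<^bsub>M\<^esub>g\<in>G. c g \<odot>\<^bsub>M\<^esub> g)"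
      by (rule lspanE[OF subsetD[OF G(3) x]])
    have cg: "c g \<in> carrier A" "g \<in> carrier M" if "g \<in> G" for g using c(1) G(2) that by auto
    have "tensor M \<one>\<^bsub>S\<^esub> x = (\<Oplus>\<^bsub>ind M\<^esub>g\<in>G. tensor M \<one>\<^bsub>S\<^esub> (c g \<odot>\<^bsub>M\<^esub> g))"
      unfolding c(2) using lmod_hom_finsum[OF t M lR, of "\<lambda>g. c g \<odot>\<^bsub>M\<^esub> g" G] cg by simp
    also have "\<dots> \<in> lspan S (ind M) ?H"
    proof (rule I.lspan_finsum[OF H(2)])
      fix g assume g: "g \<in> G"
      show "tensor M \<one>\<^bsub>S\<^esub> (c g \<odot>\<^bsub>M\<^esub> g) \<in> lspan S (ind M) ?H"
        unfolding tD(3)[OF cg[OF g]]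
        by (rule I.lspan_smult[OF H(2) \<iota>_closed[OF cg(1)[OF g]] I.lspan_generator[OF H imageI[OF g]]])
    qed
    finally show ?thesis .
  qed
  have "u \<in> lspan S (ind M) ?H" if u: "u \<in> carrier (ind M)" for u
    by (subst ind_decompose[OF M u])
      (intro I.lspan_finsum[OF H(2)] I.lspan_smult[OF H(2)] B_closed x unpack_closed[OF u])
  then show ?thesis unfolding fin_gen_module_iff_lspan using H by blast
qed

lemma ind_fg_mods: "M \<in> fg_mods A \<Longrightarrow> ind M \<in> fg_mods S"
  by (simp add: fg_mods_def ind_left_module ind_fin_gen)

definition ind_map :: "((nat \<Rightarrow> 'a) set \<Rightarrow> (nat \<Rightarrow> 'a) set) \<Rightarrow> (nat \<Rightarrow> 'a) set \<Rightarrow> (nat \<Rightarrow> 'a) set" where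
  "ind_map f u = pack (\<lambda>b\<in>B. f (unpack u b))"

lemma unpack_ind_map: "b \<in> B \<Longrightarrow> unpack (ind_map f u) b = f (unpack u b)"
  by (simp add: ind_map_def)

lemma ind_map_closed:
  "f \<in> lmod_hom A M N \<Longrightarrow> u \<in> carrier (ind M) \<Longrightarrow> ind_map f u \<in> carrier (ind N)"
  unfolding ind_map_def by (intro pack_in_ind) (simp add: lmod_homD(1) unpack_closed)

lemma ind_map_hom:
  assumes M: "left_module A M" and N: "left_module A N" and f: "f \<in> lmod_hom A M N"
  shows "ind_map f \<in> lmod_hom S (ind M) (ind N)"
proof -
  interpret M: left_module A M by fact
  interpret N: left_module A N by fact
  interpret IM: left_module S "ind M" by (rule ind_left_module[OF M])
  interpret IN: left_module S "ind N" by (rule ind_left_module[OF N])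
  note fD = lmod_homD[OF f] and cl = ind_map_closed[OF f]
  show ?thesis
  proof (rule lmod_homI)
    fix u assume u: "u \<in> carrier (ind M)"
    show "ind_map f u \<in> carrier (ind N)" by (rule cl[OF u])
    show "ind_map f (u \<oplus>\<^bsub>ind M\<^esub> v) = ind_map f u \<oplus>\<^bsub>ind N\<^esub> ind_map f v" if v: "v \<in> carrier (ind M)" for v
      by (rule ind_eqI[OF cl[OF IM.M.a_closed[OF u v]] IN.M.a_closed[OF cl[OF u] cl[OF v]]])
        (simp add: unpack_ind_map unpack_ops(2) fD(2) unpack_closed u v)
    show "ind_map f (s \<odot>\<^bsub>ind M\<^esub> u) = s \<odot>\<^bsub>ind N\<^esub> ind_map f u" if s: "s \<in> carrier S" for s
    proof (rule ind_eqI)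
      fix c assume c: "c \<in> B"
      have "f (\<Oplus>\<^bsub>M\<^esub>b\<in>B. rho c (s \<otimes>\<^bsub>S\<^esub> b) \<odot>\<^bsub>M\<^esub> unpack u b) =
          (\<Oplus>\<^bsub>N\<^esub>b\<in>B. f (rho c (s \<otimes>\<^bsub>S\<^esub> b) \<odot>\<^bsub>M\<^esub> unpack u b))"
        using c s u by (intro lmod_hom_finsum[OF f M N]) (auto simp: rho_closed B_closed unpack_closed)
      also have "\<dots> = (\<Oplus>\<^bsub>N\<^esub>b\<in>B. rho c (s \<otimes>\<^bsub>S\<^esub> b) \<odot>\<^bsub>N\<^esub> unpack (ind_map f u) b)"
        using c s u by (intro N.M.finsum_cong')
          (auto simp: rho_closed B_closed unpack_closed fD unpack_ind_map)
      finally show "unpack (ind_map f (s \<odot>\<^bsub>ind M\<^esub> u)) c = unpack (s \<odot>\<^bsub>ind N\<^esub> ind_map f u) c"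
        by (simp only: unpack_ind_map[OF c] unpack_ops(3)[OF c])
    qed (use s u cl in auto)
  qed
qed

text \<open>Surjectivity and exactness both reduce to this description, because kernels are also
  computed in each component.\<close>

lemma ind_map_image:
  assumes f: "f \<in> lmod_hom A M N"
  shows "ind_map f ` carrier (ind M) = {w \<in> carrier (ind N). \<forall>b\<in>B. unpack w b \<in> f ` carrier M}"
proof (intro equalityI subsetI)
  fix w assume "w \<in> ind_map f ` carrier (ind M)"
  then show "w \<in> {w \<in> carrier (ind N). \<forall>b\<in>B. unpack w b \<in> f ` carrier M}"
    by (auto simp: ind_map_closed[OF f] unpack_ind_map unpack_closed)
next
  fix w assume "w \<in> {w \<in> carrier (ind N). \<forall>b\<in>B. unpack w b \<in> f ` carrier M}"
  then have w: "w \<in> carrier (ind N)" "\<And>b. b \<in> B \<Longrightarrow> \<exists>x. x \<in> carrier M \<and> f x = unpack w b"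
    by (auto simp: image_iff) metis
  then obtain v where v: "\<And>b. b \<in> B \<Longrightarrow> v b \<in> carrier M" "\<And>b. b \<in> B \<Longrightarrow> f (v b) = unpack w b"
    by metis
  have c: "pack (\<lambda>b\<in>B. v b) \<in> carrier (ind M)" using v(1) by (rule pack_in_ind)
  have "w = ind_map f (pack (\<lambda>b\<in>B. v b))"
    using w(1) ind_map_closed[OF f c] by (rule ind_eqI) (simp add: unpack_ind_map v(2))
  then show "w \<in> ind_map f ` carrier (ind M)" using c by (rule image_eqI)
qed

text \<open>
  The map \<open>s \<otimes> x \<mapsto> s \<odot> h x\<close>, which corresponds to \<open>h\<close> under the adjunction. For the identity map \<open>h\<close>
  it is the counit, that is, the multiplication map \<open>S \<otimes> M \<rightarrow> M\<close>.
\<close>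

definition extend where
  "extend M h u = (\<Oplus>\<^bsub>M\<^esub>b\<in>B. b \<odot>\<^bsub>M\<^esub> h (unpack u b))"

lemma extend_hom:
  assumes P: "left_module A P" and M: "left_module S M"
    and h: "h \<in> lmod_hom A P (restrict_scalars \<iota> M)"
  shows "extend M h \<in> lmod_hom S (ind P) M"
proof -
  interpret P: left_module A P by fact
  interpret M: left_module S M by fact
  interpret I: left_module S "ind P" by (rule ind_left_module[OF P])
  note hD = lmod_homD[OF h, unfolded restrict_scalars_simps]
  have cl: "(\<lambda>b. b \<odot>\<^bsub>M\<^esub> h (unpack u b)) \<in> B \<rightarrow> carrier M" if "u \<in> carrier (ind P)" for u
    using that by (auto simp: B_closed unpack_closed hD)
  show ?thesis
  proof (rule lmod_homI)
    fix u assume u: "u \<in> carrier (ind P)"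
    show "extend M h u \<in> carrier M" unfolding extend_def by (rule M.M.finsum_closed[OF cl[OF u]])
    show "extend M h (u \<oplus>\<^bsub>ind P\<^esub> v) = extend M h u \<oplus>\<^bsub>M\<^esub> extend M h v" if v: "v \<in> carrier (ind P)" for v
    proof -
      have "extend M h (u \<oplus>\<^bsub>ind P\<^esub> v) =
          (\<Oplus>\<^bsub>M\<^esub>b\<in>B. b \<odot>\<^bsub>M\<^esub> h (unpack u b) \<oplus>\<^bsub>M\<^esub> b \<odot>\<^bsub>M\<^esub> h (unpack v b))"
        unfolding extend_def using u v
        by (intro M.M.finsum_cong') (auto simp: unpack_ops B_closed unpack_closed hD M.smult_r_distr)
      then show ?thesis unfolding extend_def using M.M.finsum_addf[OF cl[OF u] cl[OF v]] by simp
    qed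
    show "extend M h (s \<odot>\<^bsub>ind P\<^esub> u) = s \<odot>\<^bsub>M\<^esub> extend M h u" if s: "s \<in> carrier S" for s
    proof -
      have rc: "rho c (s \<otimes>\<^bsub>S\<^esub> b) \<in> carrier A" if "b \<in> B" "c \<in> B" for b c
        using that s by (simp add: rho_closed B_closed)
      have lR: "left_module A (restrict_scalars \<iota> M)"
        by (rule restrict_scalars_left_module[OF A.ring_axioms ring_map M])
      have hs: "h (unpack (s \<odot>\<^bsub>ind P\<^esub> u) c) =
          (\<Oplus>\<^bsub>M\<^esub>b\<in>B. \<iota> (rho c (s \<otimes>\<^bsub>S\<^esub> b)) \<odot>\<^bsub>M\<^esub> h (unpack u b))" if c: "c \<in> B" for c
      proof -
        have "h (unpack (s \<odot>\<^bsub>ind P\<^esub> u) c) = (\<Oplus>\<^bsub>M\<^esub>b\<in>B. h (rho c (s \<otimes>\<^bsub>S\<^esub> b) \<odot>\<^bsub>P\<^esub> unpack u b))"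
          unfolding unpack_ops(3)[OF c]
          using lmod_hom_finsum[OF h P lR, of "\<lambda>b. rho c (s \<otimes>\<^bsub>S\<^esub> b) \<odot>\<^bsub>P\<^esub> unpack u b" B] c u
          by (simp add: rc unpack_closed)
        also have "\<dots> = (\<Oplus>\<^bsub>M\<^esub>b\<in>B. \<iota> (rho c (s \<otimes>\<^bsub>S\<^esub> b)) \<odot>\<^bsub>M\<^esub> h (unpack u b))"
          using c u by (intro M.M.finsum_cong') (auto simp: rc unpack_closed hD \<iota>_closed)
        finally show ?thesis .
      qed
      have "extend M h (s \<odot>\<^bsub>ind P\<^esub> u) =
          (\<Oplus>\<^bsub>M\<^esub>c\<in>B. c \<odot>\<^bsub>M\<^esub> (\<Oplus>\<^bsub>M\<^esub>b\<in>B. \<iota> (rho c (s \<otimes>\<^bsub>S\<^esub> b)) \<odot>\<^bsub>M\<^esub> h (unpack u b)))"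
        unfolding extend_def using u
        by (intro M.M.finsum_cong' refl)
          (auto simp: hs B_closed rc unpack_closed hD \<iota>_closed intro!: M.smult_closed M.M.finsum_closed)
      also have "\<dots> = (\<Oplus>\<^bsub>M\<^esub>b\<in>B. (\<Oplus>\<^bsub>S\<^esub>c\<in>B. c \<otimes>\<^bsub>S\<^esub> \<iota> (rho c (s \<otimes>\<^bsub>S\<^esub> b))) \<odot>\<^bsub>M\<^esub> h (unpack u b))"
        using u finite_B by (intro M.finsum_smult_assoc) (auto simp: B_closed rc unpack_closed hD \<iota>_closed)
      also have "\<dots> = (\<Oplus>\<^bsub>M\<^esub>b\<in>B. s \<odot>\<^bsub>M\<^esub> (b \<odot>\<^bsub>M\<^esub> h (unpack u b)))"
        using u s by (intro M.M.finsum_cong' refl)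
          (auto simp: rho_sum B_closed unpack_closed hD M.smult_assoc1)
      also have "\<dots> = s \<odot>\<^bsub>M\<^esub> extend M h u"
        unfolding extend_def by (rule M.smult_finsum[OF s cl[OF u], symmetric])
      finally show ?thesis .
    qed
  qed
qed

lemma extend_tensor_one:
  assumes M: "left_module S M" and x: "x \<in> carrier M"
  shows "extend M (\<lambda>x. x) (tensor (restrict_scalars \<iota> M) \<one>\<^bsub>S\<^esub> x) = x"
proof -
  interpret M: left_module S M by fact
  have "extend M (\<lambda>x. x) (tensor (restrict_scalars \<iota> M) \<one>\<^bsub>S\<^esub> x) =
      (\<Oplus>\<^bsub>M\<^esub>b\<in>B. (b \<otimes>\<^bsub>S\<^esub> \<iota> (rho b \<one>\<^bsub>S\<^esub>)) \<odot>\<^bsub>M\<^esub> x)"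
    unfolding extend_def using x
    by (intro M.M.finsum_cong') (auto simp: unpack_tensor B_closed \<iota>_closed rho_closed M.smult_assoc1)
  also have "\<dots> = (\<Oplus>\<^bsub>S\<^esub>b\<in>B. b \<otimes>\<^bsub>S\<^esub> \<iota> (rho b \<one>\<^bsub>S\<^esub>)) \<odot>\<^bsub>M\<^esub> x"
    using x by (intro M.finsum_smult[symmetric]) (auto simp: B_closed \<iota>_closed rho_closed)
  also have "\<dots> = x" using x by (simp add: rho_sum)
  finally show ?thesis .
qed

text \<open>
  Left multiplication by \<open>\<phi> r\<close> preserves each summand \<open>c A\<close> of \<open>S\<close>, so its matrix is diagonal. Hence
  \<open>b \<otimes> M\<close> is a direct summand of the induced module over \<open>A\<close> acting through \<open>\<phi>\<close>. On this summand
  \<open>\<phi> r\<close> acts as \<open>r\<close>, since \<open>\<phi> r\<close> can be moved past \<open>b\<close>; so the summand is a copy of \<open>M\<close>.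
\<close>

lemma retract_of_restricted_ind:
  assumes M: "left_module A M" and b: "b \<in> B"
    and \<phi>_closed: "\<And>r. r \<in> carrier A \<Longrightarrow> \<phi> r \<in> carrier S"
    and \<phi>b: "\<And>r. r \<in> carrier A \<Longrightarrow> \<phi> r \<otimes>\<^bsub>S\<^esub> b = b \<otimes>\<^bsub>S\<^esub> \<iota> r"
    and \<phi>B: "\<And>r c. r \<in> carrier A \<Longrightarrow> c \<in> B \<Longrightarrow> \<exists>a\<in>carrier A. \<phi> r \<otimes>\<^bsub>S\<^esub> c = c \<otimes>\<^bsub>S\<^esub> \<iota> a"
  shows "tensor M b \<in> lmod_hom A M (restrict_scalars \<phi> (ind M))"
    and "(\<lambda>u. unpack u b) \<in> lmod_hom A (restrict_scalars \<phi> (ind M)) M"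
    and "x \<in> carrier M \<Longrightarrow> unpack (tensor M b x) b = x"
proof -
  interpret M: left_module A M by fact
  interpret I: left_module S "ind M" by (rule ind_left_module[OF M])
  note bS = B_closed[OF b]
  show "tensor M b \<in> lmod_hom A M (restrict_scalars \<phi> (ind M))"
  proof (rule lmod_homI; (unfold restrict_scalars_simps)?)
    fix x assume x: "x \<in> carrier M"
    show "tensor M b x \<in> carrier (ind M)" by (rule tensor_closed[OF M bS x])
    show "tensor M b (x \<oplus>\<^bsub>M\<^esub> y) = tensor M b x \<oplus>\<^bsub>ind M\<^esub> tensor M b y" if y: "y \<in> carrier M" for y
      by (rule tensor_add[OF M bS x y])
    show "tensor M b (r \<odot>\<^bsub>M\<^esub> x) = \<phi> r \<odot>\<^bsub>ind M\<^esub> tensor M b x" if r: "r \<in> carrier A" for r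
      unfolding smult_tensor[OF M \<phi>_closed[OF r] bS x] \<phi>b[OF r] by (rule tensor_smult[OF M bS r x])
  qed
  show "(\<lambda>u. unpack u b) \<in> lmod_hom A (restrict_scalars \<phi> (ind M)) M"
  proof (rule lmod_homI; (unfold restrict_scalars_simps)?)
    fix u assume u: "u \<in> carrier (ind M)"
    show "unpack u b \<in> carrier M" by (rule unpack_closed[OF u b])
    show "unpack (u \<oplus>\<^bsub>ind M\<^esub> v) b = unpack u b \<oplus>\<^bsub>M\<^esub> unpack v b" for v by (rule unpack_ops(2)[OF b])
    show "unpack (\<phi> r \<odot>\<^bsub>ind M\<^esub> u) b = r \<odot>\<^bsub>M\<^esub> unpack u b" if r: "r \<in> carrier A" for r
    proof -
      have "rho b (\<phi> r \<otimes>\<^bsub>S\<^esub> c) = (if c = b then r else \<zero>\<^bsub>A\<^esub>)" if c: "c \<in> B" for c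
      proof -
        obtain a where a: "a \<in> carrier A" "\<phi> r \<otimes>\<^bsub>S\<^esub> c = c \<otimes>\<^bsub>S\<^esub> \<iota> a" using \<phi>B[OF r c] by blast
        show ?thesis
        proof (cases "c = b")
          case True
          then show ?thesis using r b bS by (simp add: \<phi>b rho_mult rho_basis)
        next
          case False
          then show ?thesis using a b c by (simp add: rho_mult B_closed rho_basis)
        qed
      qed
      then have "unpack (\<phi> r \<odot>\<^bsub>ind M\<^esub> u) b =
          (\<Oplus>\<^bsub>M\<^esub>c\<in>B. if c = b then r \<odot>\<^bsub>M\<^esub> unpack u b else \<zero>\<^bsub>M\<^esub>)"
        unfolding unpack_ops(3)[OF b] using r u b
        by (intro M.M.finsum_cong') (auto simp: unpack_closed)
      also have "\<dots> = r \<odot>\<^bsub>M\<^esub> unpack u b"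
        using r u b finite_B by (intro M.M.finsum_delta) (auto simp: unpack_closed)
      finally show ?thesis .
    qed
  qed
  show "unpack (tensor M b x) b = x" if "x \<in> carrier M"
    using that b by (simp add: unpack_tensor rho_basis)
qed

end

locale two_sided_coordinates = left_coordinates A S \<iota> B lam + right_coordinates A S \<iota> B' rho
  for A :: "('a, 'r) ring_scheme" and S :: "('a, 's) ring_scheme"
    and \<iota> :: "'a \<Rightarrow> 'a" and B lam B' rho
begin

text \<open>
  Lifting problems for the induced module transpose, along the adjunction, to lifting problems
  for \<open>P\<close>.
\<close>

lemma ind_projective:
  assumes P: "fg_projective A P"
  shows "fg_projective S (ind P)"
  unfolding fg_projective_def
proof (intro conjI ballI impI)
  have Pfg: "P \<in> fg_mods A" using P by (simp add: fg_projective_def)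
  note lP = fg_modsD(1)[OF Pfg]
  show Ifg: "ind P \<in> fg_mods S" by (rule ind_fg_mods[OF Pfg])
  fix M N g f
  assume M: "M \<in> fg_mods S" and N: "N \<in> fg_mods S" and g: "g \<in> lmod_hom S M N"
    and f: "f \<in> lmod_hom S (ind P) N" and onto: "g ` carrier M = carrier N"
  interpret P: left_module A P by (rule lP)
  interpret I: left_module S "ind P" by (rule fg_modsD(1)[OF Ifg])
  interpret M: left_module S M by (rule fg_modsD(1)[OF M])
  interpret N: left_module S N by (rule fg_modsD(1)[OF N])
  have f1: "f \<circ> tensor P \<one>\<^bsub>S\<^esub> \<in> lmod_hom A P (restrict_scalars \<iota> N)"
    by (rule lmod_hom_comp[OF unit_hom[OF lP] restrict_hom[OF f]])
  obtain h where h: "h \<in> lmod_hom A P (restrict_scalars \<iota> M)"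
    "\<And>x. x \<in> carrier P \<Longrightarrow> g (h x) = (f \<circ> tensor P \<one>\<^bsub>S\<^esub>) x"
    using fg_projective_lift[OF P restrict_fg_mods[OF M] restrict_fg_mods[OF N] restrict_hom[OF g] f1]
      onto by (metis restrict_scalars_simps(1))
  note hD = lmod_homD[OF h(1), unfolded restrict_scalars_simps]
  show "\<exists>k\<in>lmod_hom S (ind P) M. \<forall>u\<in>carrier (ind P). g (k u) = f u"
  proof (intro bexI ballI)
    show "extend M h \<in> lmod_hom S (ind P) M" by (rule extend_hom[OF lP fg_modsD(1)[OF M] h(1)])
    fix u assume u: "u \<in> carrier (ind P)"
    note uc = unpack_closed[OF u]
    have t: "tensor P \<one>\<^bsub>S\<^esub> (unpack u b) \<in> carrier (ind P)" if "b \<in> B'" for b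
      by (rule tensor_closed[OF lP S.one_closed uc[OF that]])
    have "g (extend M h u) = (\<Oplus>\<^bsub>N\<^esub>b\<in>B'. g (b \<odot>\<^bsub>M\<^esub> h (unpack u b)))"
      unfolding extend_def
      by (rule lmod_hom_finsum[OF g fg_modsD(1)[OF M] fg_modsD(1)[OF N]])
        (auto intro!: M.smult_closed right_coordinates.B_closed[OF right_coordinates_axioms] hD uc)
    also have "\<dots> = (\<Oplus>\<^bsub>N\<^esub>b\<in>B'. f (b \<odot>\<^bsub>ind P\<^esub> tensor P \<one>\<^bsub>S\<^esub> (unpack u b)))"
    proof (rule N.M.finsum_cong'[OF refl])
      show "(\<lambda>b. f (b \<odot>\<^bsub>ind P\<^esub> tensor P \<one>\<^bsub>S\<^esub> (unpack u b))) \<in> B' \<rightarrow> carrier N"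
        by (intro Pi_I lmod_homD(1)[OF f] I.smult_closed t
            right_coordinates.B_closed[OF right_coordinates_axioms])
      fix b assume b: "b \<in> B'"
      have bS: "b \<in> carrier S" by (rule right_coordinates.B_closed[OF right_coordinates_axioms b])
      show "g (b \<odot>\<^bsub>M\<^esub> h (unpack u b)) = f (b \<odot>\<^bsub>ind P\<^esub> tensor P \<one>\<^bsub>S\<^esub> (unpack u b))"
        by (simp add: lmod_homD(3)[OF g bS hD(1)[OF uc[OF b]]] h(2)[OF uc[OF b]]
            lmod_homD(3)[OF f bS t[OF b]])
    qed
    also have "\<dots> = f (\<Oplus>\<^bsub>ind P\<^esub>b\<in>B'. b \<odot>\<^bsub>ind P\<^esub> tensor P \<one>\<^bsub>S\<^esub> (unpack u b))"
      by (rule lmod_hom_finsum[OF f fg_modsD(1)[OF Ifg] fg_modsD(1)[OF N], symmetric])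
        (intro Pi_I I.smult_closed t right_coordinates.B_closed[OF right_coordinates_axioms])
    also have "\<dots> = f u" by (simp only: ind_decompose[OF lP u, symmetric])
    finally show "g (extend M h u) = f u" .
  qed
qed

lemma ind_exact_functor: "exact_functor A S ind (\<lambda>M N. ind_map)"
proof unfold_locales
  fix M N :: "'a fg_module" and f
  assume M: "M \<in> fg_mods A"
  interpret IM: left_module S "ind M" by (rule ind_left_module[OF fg_modsD(1)[OF M]])
  show "ind M \<in> fg_mods S" by (rule ind_fg_mods[OF M])
  show "carrier (ind M) = {\<zero>\<^bsub>ind M\<^esub>}" if z: "carrier M = {\<zero>\<^bsub>M\<^esub>}"
  proof (intro equalityI subsetI)
    fix u assume u: "u \<in> carrier (ind M)"
    have "u = \<zero>\<^bsub>ind M\<^esub>"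
      using u IM.M.zero_closed
    proof (rule ind_eqI)
      fix b assume b: "b \<in> B'"
      have "unpack u b \<in> {\<zero>\<^bsub>M\<^esub>}" unfolding z[symmetric] by (rule unpack_closed[OF u b])
      then show "unpack u b = unpack \<zero>\<^bsub>ind M\<^esub> b" by (simp add: unpack_ops(1)[OF b])
    qed
    then show "u \<in> {\<zero>\<^bsub>ind M\<^esub>}" by simp
  qed simp
  assume N: "N \<in> fg_mods A" and f: "f \<in> lmod_hom A M N"
  show "ind_map f \<in> lmod_hom S (ind M) (ind N)"
    by (rule ind_map_hom[OF fg_modsD(1)[OF M] fg_modsD(1)[OF N] f])
  show "inj_on (ind_map f) (carrier (ind M))" if i: "inj_on f (carrier M)"
  proof (rule inj_onI)
    fix u v assume u: "u \<in> carrier (ind M)" and v: "v \<in> carrier (ind M)"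
      and eq: "ind_map f u = ind_map f v"
    show "u = v" using u v
    proof (rule ind_eqI)
      fix b assume b: "b \<in> B'"
      have "f (unpack u b) = f (unpack v b)" using eq unpack_ind_map[OF b, of f] by metis
      then show "unpack u b = unpack v b" by (rule inj_onD[OF i]) (rule unpack_closed[OF _ b], fact)+
    qed
  qed
  show "ind_map f ` carrier (ind M) = carrier (ind N)" if "f ` carrier M = carrier N"
    unfolding ind_map_image[OF f] that using unpack_closed by blast
  show "ind_map g (ind_map f u) = u" if g: "g \<in> lmod_hom A N M" and gf: "\<And>x. x \<in> carrier M \<Longrightarrow> g (f x) = x"
    and u: "u \<in> carrier (ind M)" for g u
    by (rule ind_eqI[OF ind_map_closed[OF g ind_map_closed[OF f u]] u])
      (simp add: unpack_ind_map gf unpack_closed[OF u])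
next
  fix L M N :: "'a fg_module" and f g
  assume L: "L \<in> fg_mods A" and M: "M \<in> fg_mods A" and N: "N \<in> fg_mods A"
    and f: "f \<in> lmod_hom A L M" and g: "g \<in> lmod_hom A M N" and ex: "f ` carrier L = a_kernel M N g"
  interpret IN: left_module S "ind N" by (rule ind_left_module[OF fg_modsD(1)[OF N]])
  show "ind_map f ` carrier (ind L) = a_kernel (ind M) (ind N) (ind_map g)"
    unfolding ind_map_image[OF f] ex
  proof (intro equalityI subsetI)
    fix u assume "u \<in> {u \<in> carrier (ind M). \<forall>b\<in>B'. unpack u b \<in> a_kernel M N g}"
    then have u: "u \<in> carrier (ind M)" "\<And>b. b \<in> B' \<Longrightarrow> g (unpack u b) = \<zero>\<^bsub>N\<^esub>"
      by (simp_all add: a_kernel_iff)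
    have "ind_map g u = \<zero>\<^bsub>ind N\<^esub>"
      by (rule ind_eqI[OF ind_map_closed[OF g u(1)] IN.M.zero_closed])
        (simp add: unpack_ind_map unpack_ops(1) u(2))
    then show "u \<in> a_kernel (ind M) (ind N) (ind_map g)" using u(1) by (simp add: a_kernel_iff)
  next
    fix u assume "u \<in> a_kernel (ind M) (ind N) (ind_map g)"
    then have u: "u \<in> carrier (ind M)" "ind_map g u = \<zero>\<^bsub>ind N\<^esub>" by (simp_all add: a_kernel_iff)
    have "g (unpack u b) = \<zero>\<^bsub>N\<^esub>" if b: "b \<in> B'" for b
      using u(2) unpack_ind_map[OF b, of g u] unpack_ops(1)[OF b, of N] by simp
    then show "u \<in> {u \<in> carrier (ind M). \<forall>b\<in>B'. unpack u b \<in> a_kernel M N g}"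
      using u(1) unpack_closed[OF u(1)] by (simp add: a_kernel_iff)
  qed
qed (rule ind_projective)

end


section \<open>Comparison of extension dimensions\<close>

lemma ext_dim_le:
  assumes "\<And>n N. N \<in> fg_mods B \<Longrightarrow> V \<subseteq> ext_layer B {N} (Suc n) \<Longrightarrow>
    \<exists>N'\<in>fg_mods A. U \<subseteq> ext_layer A {N'} (Suc n)"
  shows "ext_dim A U \<le> ext_dim B V"
proof -
  have "{n. \<exists>N\<in>fg_mods B. V \<subseteq> ext_layer B {N} (n + 1)} \<subseteq> {n. \<exists>N\<in>fg_mods A. U \<subseteq> ext_layer A {N} (n + 1)}"
    using assms by auto
  then show ?thesis unfolding ext_dim_def by (rule INF_superset_mono) simp
qed

text \<open>
  A layer over \<open>B\<close> that contains \<open>V\<close> is carried by \<open>G\<close> into a layer over \<open>A\<close> of the same height. That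
  layer is closed under retracts, hence it contains \<open>U\<close>.
\<close>

lemma ext_dim_le_of_retract:
  assumes F: "\<And>K. K \<in> U \<Longrightarrow> F K \<in> V" and U: "U \<subseteq> fg_mods A"
    and G: "exact_functor B A G T"
    and retract: "\<And>K. K \<in> U \<Longrightarrow> \<exists>i\<in>lmod_hom A K (G (F K)). \<exists>p\<in>lmod_hom A (G (F K)) K.
      \<forall>x\<in>carrier K. p (i x) = x"
  shows "ext_dim A U \<le> ext_dim B V"
proof (rule ext_dim_le)
  interpret G: exact_functor B A G T by (rule G)
  fix n N assume N: "N \<in> fg_mods B" and V: "V \<subseteq> ext_layer B {N} (Suc n)"
  show "\<exists>N'\<in>fg_mods A. U \<subseteq> ext_layer A {N'} (Suc n)"
  proof (intro bexI subsetI)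
    show "G N \<in> fg_mods A" by (rule G.obj[OF N])
    fix K assume K: "K \<in> U"
    obtain i p where ip: "i \<in> lmod_hom A K (G (F K))" "p \<in> lmod_hom A (G (F K)) K"
      "\<And>x. x \<in> carrier K \<Longrightarrow> p (i x) = x"
      using retract[OF K] by blast
    have "G (F K) \<in> ext_layer A {G N} (Suc n)" by (rule G.map_ext_layer[OF subsetD[OF V F[OF K]]])
    then show "K \<in> ext_layer A {G N} (Suc n)"
      by (rule ext_layer_retract[OF _ subsetD[OF U K] ip])
  qed
qed

lemma syzygies_fg: "syzygies A j X \<subseteq> fg_mods A"
  by (auto simp: syzygies_def)

lemma fin_proj_dim_mods_fg: "fin_proj_dim_mods A \<subseteq> fg_mods A"
  by (auto simp: fin_proj_dim_mods_def)

lemma ext_dim_syzygies_le_of_retract: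
  assumes F: "exact_functor A B F T" and G: "exact_functor B A G T'"
    and retract: "\<And>K. K \<in> fg_mods A \<Longrightarrow> \<exists>i\<in>lmod_hom A K (G (F K)). \<exists>p\<in>lmod_hom A (G (F K)) K.
      \<forall>x\<in>carrier K. p (i x) = x"
  shows "ext_dim A (syzygies A j (fg_mods A)) \<le> ext_dim B (syzygies B j (fg_mods B))"
    and "ext_dim A (syzygies A j (fin_proj_dim_mods A)) \<le> ext_dim B (syzygies B j (fin_proj_dim_mods B))"
proof -
  interpret F: exact_functor A B F T by (rule F)
  show "ext_dim A (syzygies A j (fg_mods A)) \<le> ext_dim B (syzygies B j (fg_mods B))"
    by (rule ext_dim_le_of_retract[OF F.map_syzygies[OF subset_refl F.obj] syzygies_fg G
          retract[OF subsetD[OF syzygies_fg]]])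
  show "ext_dim A (syzygies A j (fin_proj_dim_mods A)) \<le> ext_dim B (syzygies B j (fin_proj_dim_mods B))"
    by (rule ext_dim_le_of_retract[OF F.map_syzygies[OF fin_proj_dim_mods_fg F.map_fin_proj_dim]
          syzygies_fg G retract[OF subsetD[OF syzygies_fg]]])
qed


section \<open>Coordinates with respect to a free basis\<close>

text \<open>
  The last property, that coordinates are unique, is what makes the coordinate functions additive
  and compatible with scalars. Left and right bases are both covered, by taking for \<open>m b\<close> the
  multiplication by \<open>b\<close> on the corresponding side.
\<close>

lemma basis_coordinates:
  assumes G: "abelian_group G" and H: "abelian_group H" and B: "finite B"
    and m: "\<forall>b\<in>B. m b \<in> hom (add_monoid H) (add_monoid G)"
    and span: "\<forall>x\<in>carrier G. \<exists>r\<in>B \<rightarrow> carrier H. x = (\<Oplus>\<^bsub>G\<^esub>b\<in>B. m b (r b))"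
    and indep: "\<forall>r\<in>B \<rightarrow> carrier H. (\<Oplus>\<^bsub>G\<^esub>b\<in>B. m b (r b)) = \<zero>\<^bsub>G\<^esub> \<longrightarrow> (\<forall>b\<in>B. r b = \<zero>\<^bsub>H\<^esub>)"
  shows "\<exists>q. (\<forall>b\<in>B. \<forall>x\<in>carrier G. q b x \<in> carrier H) \<and>
    (\<forall>x\<in>carrier G. (\<Oplus>\<^bsub>G\<^esub>b\<in>B. m b (q b x)) = x) \<and>
    (\<forall>r\<in>B \<rightarrow> carrier H. \<forall>b\<in>B. q b (\<Oplus>\<^bsub>G\<^esub>b\<in>B. m b (r b)) = r b)"
proof -
  interpret G: abelian_group G by fact
  interpret H: abelian_group H by fact
  have mc: "m b r \<in> carrier G" if "b \<in> B" "r \<in> carrier H" for b r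
    using m[rule_format, OF that(1)] that(2) by (auto simp: hom_def)
  have ma: "m b (r \<oplus>\<^bsub>H\<^esub> s) = m b r \<oplus>\<^bsub>G\<^esub> m b s" if "b \<in> B" "r \<in> carrier H" "s \<in> carrier H" for b r s
    using m[rule_format, OF that(1)] that(2,3) by (auto simp: hom_def)
  have unique: "r b = s b"
    if r: "r \<in> B \<rightarrow> carrier H" and s: "s \<in> B \<rightarrow> carrier H" and b: "b \<in> B"
      and eq: "(\<Oplus>\<^bsub>G\<^esub>b\<in>B. m b (r b)) = (\<Oplus>\<^bsub>G\<^esub>b\<in>B. m b (s b))" for r s b
  proof -
    have rc: "(\<lambda>b. m b (r b)) \<in> B \<rightarrow> carrier G" and sc: "(\<lambda>b. m b (s b)) \<in> B \<rightarrow> carrier G"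
      and nc: "(\<lambda>b. m b (\<ominus>\<^bsub>H\<^esub> s b)) \<in> B \<rightarrow> carrier G"
      using r s mc H.a_inv_closed by (simp_all add: Pi_iff)
    have dc: "(\<lambda>b. r b \<oplus>\<^bsub>H\<^esub> \<ominus>\<^bsub>H\<^esub> s b) \<in> B \<rightarrow> carrier H" using r s by auto
    have m0: "m b \<zero>\<^bsub>H\<^esub> = \<zero>\<^bsub>G\<^esub>" if "b \<in> B" for b by (rule additive_zero[OF H G m[rule_format, OF that]])
    have "(\<Oplus>\<^bsub>G\<^esub>b\<in>B. m b (r b \<oplus>\<^bsub>H\<^esub> \<ominus>\<^bsub>H\<^esub> s b)) = (\<Oplus>\<^bsub>G\<^esub>b\<in>B. m b (r b) \<oplus>\<^bsub>G\<^esub> m b (\<ominus>\<^bsub>H\<^esub> s b))"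
      using r s mc by (intro G.finsum_cong') (auto simp: ma Pi_iff)
    also have "\<dots> = (\<Oplus>\<^bsub>G\<^esub>b\<in>B. m b (s b)) \<oplus>\<^bsub>G\<^esub> (\<Oplus>\<^bsub>G\<^esub>b\<in>B. m b (\<ominus>\<^bsub>H\<^esub> s b))"
      using G.finsum_addf[OF rc nc] eq by simp
    also have "\<dots> = (\<Oplus>\<^bsub>G\<^esub>b\<in>B. m b (s b) \<oplus>\<^bsub>G\<^esub> m b (\<ominus>\<^bsub>H\<^esub> s b))"
      using G.finsum_addf[OF sc nc] by simp
    also have "\<dots> = (\<Oplus>\<^bsub>G\<^esub>b\<in>B. \<zero>\<^bsub>G\<^esub>)"
      using s by (intro G.finsum_cong') (auto simp: ma[symmetric] m0 Pi_iff H.r_neg)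
    also have "\<dots> = \<zero>\<^bsub>G\<^esub>" by (rule G.finsum_zero)
    finally have "r b \<oplus>\<^bsub>H\<^esub> \<ominus>\<^bsub>H\<^esub> s b = \<zero>\<^bsub>H\<^esub>" using indep[rule_format, OF dc _ b] by blast
    then have "r b = \<ominus>\<^bsub>H\<^esub> (\<ominus>\<^bsub>H\<^esub> s b)"
      using r s b by (intro H.minus_equality[symmetric]) auto
    then show ?thesis using s b by (simp add: Pi_iff)
  qed
  have "\<forall>x\<in>carrier G. \<exists>r. r \<in> B \<rightarrow> carrier H \<and> x = (\<Oplus>\<^bsub>G\<^esub>b\<in>B. m b (r b))"
    using span by blast
  from bchoice[OF this] obtain c where
    c: "\<And>x. x \<in> carrier G \<Longrightarrow> c x \<in> B \<rightarrow> carrier H" "\<And>x. x \<in> carrier G \<Longrightarrow> x = (\<Oplus>\<^bsub>G\<^esub>b\<in>B. m b (c x b))"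
    by blast
  show ?thesis
  proof (intro exI[of _ "\<lambda>b x. c x b"] conjI ballI)
    show "c x b \<in> carrier H" if "b \<in> B" "x \<in> carrier G" for b x using c(1)[OF that(2)] that(1) by blast
    show "(\<Oplus>\<^bsub>G\<^esub>b\<in>B. m b (c x b)) = x" if "x \<in> carrier G" for x by (rule c(2)[OF that, symmetric])
    fix r b assume r: "r \<in> B \<rightarrow> carrier H" and b: "b \<in> B"
    have x: "(\<Oplus>\<^bsub>G\<^esub>b\<in>B. m b (r b)) \<in> carrier G" using r mc by (intro G.finsum_closed) auto
    show "c (\<Oplus>\<^bsub>G\<^esub>b\<in>B. m b (r b)) b = r b"
      by (rule unique[OF c(1)[OF x] r b c(2)[OF x, symmetric]])
  qed
qed

locale free_extension = S: ring S + subring R S for R and S :: "('a, 's) ring_scheme" +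
  fixes B :: "'a set"
  assumes left_basis: "free_left_basis R S B" and right_basis: "free_right_basis R S B"
    and normalizing: "b \<in> B \<Longrightarrow> (\<lambda>r. r \<otimes>\<^bsub>S\<^esub> b) ` R = (\<lambda>r. b \<otimes>\<^bsub>S\<^esub> r) ` R"
begin

abbreviation "A \<equiv> S\<lparr>carrier := R\<rparr>"

lemma ring_A: "ring A"
  by (rule S.subring_is_ring[OF subring_axioms])

lemma R_sub: "r \<in> R \<Longrightarrow> r \<in> carrier S"
  using subset by blast

lemma R_closed: "\<zero>\<^bsub>S\<^esub> \<in> R" "\<one>\<^bsub>S\<^esub> \<in> R" "r \<in> R \<Longrightarrow> s \<in> R \<Longrightarrow> r \<oplus>\<^bsub>S\<^esub> s \<in> R" "r \<in> R \<Longrightarrow> s \<in> R \<Longrightarrow> r \<otimes>\<^bsub>S\<^esub> s \<in> R"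
proof -
  interpret A: ring A by (rule ring_A)
  show "\<zero>\<^bsub>S\<^esub> \<in> R" "\<one>\<^bsub>S\<^esub> \<in> R" "r \<in> R \<Longrightarrow> s \<in> R \<Longrightarrow> r \<oplus>\<^bsub>S\<^esub> s \<in> R" "r \<in> R \<Longrightarrow> s \<in> R \<Longrightarrow> r \<otimes>\<^bsub>S\<^esub> s \<in> R"
    using A.zero_closed A.one_closed A.a_closed[of r s] A.m_closed[of r s] by simp_all
qed

lemma B_sub: "b \<in> B \<Longrightarrow> b \<in> carrier S"
  using left_basis by (auto simp: free_left_basis_def)

lemma finite_B: "finite B"
  using left_basis by (simp add: free_left_basis_def)

lemma left_coordinates_exist:
  obtains lam where "left_coordinates A S (\<lambda>r. r) B lam"
    "\<And>b. b \<in> B \<Longrightarrow> lam b b = \<one>\<^bsub>S\<^esub>"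
proof -
  interpret A: ring A by (rule ring_A)
  have m: "\<forall>b\<in>B. (\<lambda>r. r \<otimes>\<^bsub>S\<^esub> b) \<in> hom (add_monoid A) (add_monoid S)"
    by (intro ballI additiveI) (simp_all add: R_sub B_sub S.l_distr)
  have span: "\<forall>x\<in>carrier S. \<exists>r\<in>B \<rightarrow> carrier A. x = (\<Oplus>\<^bsub>S\<^esub>b\<in>B. r b \<otimes>\<^bsub>S\<^esub> b)"
    and indep: "\<forall>r\<in>B \<rightarrow> carrier A. (\<Oplus>\<^bsub>S\<^esub>b\<in>B. r b \<otimes>\<^bsub>S\<^esub> b) = \<zero>\<^bsub>S\<^esub> \<longrightarrow> (\<forall>b\<in>B. r b = \<zero>\<^bsub>A\<^esub>)"
    using left_basis by (simp_all add: free_left_basis_def)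
  from basis_coordinates[where m = "\<lambda>b r. r \<otimes>\<^bsub>S\<^esub> b", OF S.is_abelian_group A.is_abelian_group
      finite_B m span indep]
  obtain lam where "\<forall>b\<in>B. \<forall>x\<in>carrier S. lam b x \<in> carrier A"
    "\<forall>x\<in>carrier S. (\<Oplus>\<^bsub>S\<^esub>b\<in>B. lam b x \<otimes>\<^bsub>S\<^esub> b) = x"
    "\<forall>r\<in>B \<rightarrow> carrier A. \<forall>b\<in>B. lam b (\<Oplus>\<^bsub>S\<^esub>b\<in>B. r b \<otimes>\<^bsub>S\<^esub> b) = r b"
    by (elim exE conjE) (erule (2) that)
  then have cl: "\<And>b x. b \<in> B \<Longrightarrow> x \<in> carrier S \<Longrightarrow> lam b x \<in> R"
    and sum: "\<And>x. x \<in> carrier S \<Longrightarrow> (\<Oplus>\<^bsub>S\<^esub>b\<in>B. lam b x \<otimes>\<^bsub>S\<^esub> b) = x"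
    and coord: "\<And>r b. r \<in> B \<rightarrow> R \<Longrightarrow> b \<in> B \<Longrightarrow> lam b (\<Oplus>\<^bsub>S\<^esub>b\<in>B. r b \<otimes>\<^bsub>S\<^esub> b) = r b"
    by simp_all
  note clS = R_sub[OF cl]
  have "left_coordinates A S (\<lambda>r. r) B lam"
  proof (unfold_locales)
    show "(\<lambda>r. r) \<in> ring_hom A S" by (rule ring_hom_memI) (simp_all add: R_sub)
    fix b s t assume b: "b \<in> B" and s: "s \<in> carrier S"
    show "lam b (s \<oplus>\<^bsub>S\<^esub> t) = lam b s \<oplus>\<^bsub>A\<^esub> lam b t" if t: "t \<in> carrier S"
    proof -
      have "s \<oplus>\<^bsub>S\<^esub> t = (\<Oplus>\<^bsub>S\<^esub>b\<in>B. lam b s \<otimes>\<^bsub>S\<^esub> b) \<oplus>\<^bsub>S\<^esub> (\<Oplus>\<^bsub>S\<^esub>b\<in>B. lam b t \<otimes>\<^bsub>S\<^esub> b)"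
        by (simp only: sum s t)
      also have "\<dots> = (\<Oplus>\<^bsub>S\<^esub>b\<in>B. lam b s \<otimes>\<^bsub>S\<^esub> b \<oplus>\<^bsub>S\<^esub> lam b t \<otimes>\<^bsub>S\<^esub> b)"
        using s t by (intro S.finsum_addf[symmetric]) (auto simp: clS B_sub)
      also have "\<dots> = (\<Oplus>\<^bsub>S\<^esub>b\<in>B. (lam b s \<oplus>\<^bsub>S\<^esub> lam b t) \<otimes>\<^bsub>S\<^esub> b)"
        using s t by (intro S.finsum_cong') (auto simp: clS B_sub S.l_distr)
      finally have "lam b (s \<oplus>\<^bsub>S\<^esub> t) = lam b (\<Oplus>\<^bsub>S\<^esub>b\<in>B. (lam b s \<oplus>\<^bsub>S\<^esub> lam b t) \<otimes>\<^bsub>S\<^esub> b)" by (rule arg_cong)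
      also have "\<dots> = lam b s \<oplus>\<^bsub>S\<^esub> lam b t"
        using s t b by (intro coord) (auto simp: cl R_closed)
      finally show ?thesis by simp
    qed
    show "lam b (a \<otimes>\<^bsub>S\<^esub> s) = a \<otimes>\<^bsub>A\<^esub> lam b s" if a: "a \<in> carrier A" for a
    proof -
      have aR: "a \<in> R" "a \<in> carrier S" using a R_sub by auto
      have am: "(\<lambda>x. a \<otimes>\<^bsub>S\<^esub> x) \<in> hom (add_monoid S) (add_monoid S)"
        using aR by (intro additiveI) (simp_all add: S.r_distr)
      have "a \<otimes>\<^bsub>S\<^esub> s = a \<otimes>\<^bsub>S\<^esub> (\<Oplus>\<^bsub>S\<^esub>b\<in>B. lam b s \<otimes>\<^bsub>S\<^esub> b)" by (simp only: sum s)
      also have "\<dots> = (\<Oplus>\<^bsub>S\<^esub>b\<in>B. a \<otimes>\<^bsub>S\<^esub> (lam b s \<otimes>\<^bsub>S\<^esub> b))"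
        using s by (intro additive_finsum[OF S.is_abelian_group S.is_abelian_group am]) (auto simp: clS B_sub)
      also have "\<dots> = (\<Oplus>\<^bsub>S\<^esub>b\<in>B. (a \<otimes>\<^bsub>S\<^esub> lam b s) \<otimes>\<^bsub>S\<^esub> b)"
        using s aR by (intro S.finsum_cong') (auto simp: clS B_sub S.m_assoc)
      finally have "lam b (a \<otimes>\<^bsub>S\<^esub> s) = lam b (\<Oplus>\<^bsub>S\<^esub>b\<in>B. (a \<otimes>\<^bsub>S\<^esub> lam b s) \<otimes>\<^bsub>S\<^esub> b)" by (rule arg_cong)
      also have "\<dots> = a \<otimes>\<^bsub>S\<^esub> lam b s" using s b aR by (intro coord) (auto simp: cl R_closed)
      finally show ?thesis by simp
    qed
  qed (simp_all add: finite_B B_sub cl sum)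
  moreover have "lam b b = \<one>\<^bsub>S\<^esub>" if b: "b \<in> B" for b
  proof -
    have "(\<Oplus>\<^bsub>S\<^esub>d\<in>B. (if b = d then \<one>\<^bsub>S\<^esub> else \<zero>\<^bsub>S\<^esub>) \<otimes>\<^bsub>S\<^esub> d) = (\<Oplus>\<^bsub>S\<^esub>d\<in>B. if d = b then b else \<zero>\<^bsub>S\<^esub>)"
      by (intro S.finsum_cong') (auto simp: B_sub)
    also have "\<dots> = b" by (rule S.finsum_delta[OF finite_B b B_sub[OF b]])
    finally have "lam b b = lam b (\<Oplus>\<^bsub>S\<^esub>d\<in>B. (if b = d then \<one>\<^bsub>S\<^esub> else \<zero>\<^bsub>S\<^esub>) \<otimes>\<^bsub>S\<^esub> d)" by simp
    also have "\<dots> = (if b = b then \<one>\<^bsub>S\<^esub> else \<zero>\<^bsub>S\<^esub>)" using b by (intro coord) (auto simp: R_closed)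
    finally show ?thesis by simp
  qed
  ultimately show thesis by (rule that)
qed

lemma right_coordinates_exist:
  obtains rho where "right_coordinates A S (\<lambda>r. r) B rho"
proof -
  interpret A: ring A by (rule ring_A)
  have m: "\<forall>b\<in>B. (\<lambda>r. b \<otimes>\<^bsub>S\<^esub> r) \<in> hom (add_monoid A) (add_monoid S)"
    by (intro ballI additiveI) (simp_all add: R_sub B_sub S.r_distr)
  have span: "\<forall>x\<in>carrier S. \<exists>r\<in>B \<rightarrow> carrier A. x = (\<Oplus>\<^bsub>S\<^esub>b\<in>B. b \<otimes>\<^bsub>S\<^esub> r b)"
    and indep: "\<forall>r\<in>B \<rightarrow> carrier A. (\<Oplus>\<^bsub>S\<^esub>b\<in>B. b \<otimes>\<^bsub>S\<^esub> r b) = \<zero>\<^bsub>S\<^esub> \<longrightarrow> (\<forall>b\<in>B. r b = \<zero>\<^bsub>A\<^esub>)"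
    using right_basis by (simp_all add: free_right_basis_def)
  from basis_coordinates[where m = "\<lambda>b r. b \<otimes>\<^bsub>S\<^esub> r", OF S.is_abelian_group A.is_abelian_group
      finite_B m span indep]
  obtain rho where "\<forall>b\<in>B. \<forall>x\<in>carrier S. rho b x \<in> carrier A"
    "\<forall>x\<in>carrier S. (\<Oplus>\<^bsub>S\<^esub>b\<in>B. b \<otimes>\<^bsub>S\<^esub> rho b x) = x"
    "\<forall>r\<in>B \<rightarrow> carrier A. \<forall>b\<in>B. rho b (\<Oplus>\<^bsub>S\<^esub>b\<in>B. b \<otimes>\<^bsub>S\<^esub> r b) = r b"
    by (elim exE conjE) (erule (2) that)
  then have cl: "\<And>b x. b \<in> B \<Longrightarrow> x \<in> carrier S \<Longrightarrow> rho b x \<in> R"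
    and sum: "\<And>x. x \<in> carrier S \<Longrightarrow> (\<Oplus>\<^bsub>S\<^esub>b\<in>B. b \<otimes>\<^bsub>S\<^esub> rho b x) = x"
    and coord: "\<And>r b. r \<in> B \<rightarrow> R \<Longrightarrow> b \<in> B \<Longrightarrow> rho b (\<Oplus>\<^bsub>S\<^esub>b\<in>B. b \<otimes>\<^bsub>S\<^esub> r b) = r b"
    by simp_all
  note clS = R_sub[OF cl]
  have "right_coordinates A S (\<lambda>r. r) B rho"
  proof (unfold_locales)
    show "(\<lambda>r. r) \<in> ring_hom A S" by (rule ring_hom_memI) (simp_all add: R_sub)
    fix b s t assume b: "b \<in> B" and s: "s \<in> carrier S"
    show "rho b (s \<oplus>\<^bsub>S\<^esub> t) = rho b s \<oplus>\<^bsub>A\<^esub> rho b t" if t: "t \<in> carrier S"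
    proof -
      have "s \<oplus>\<^bsub>S\<^esub> t = (\<Oplus>\<^bsub>S\<^esub>b\<in>B. b \<otimes>\<^bsub>S\<^esub> rho b s) \<oplus>\<^bsub>S\<^esub> (\<Oplus>\<^bsub>S\<^esub>b\<in>B. b \<otimes>\<^bsub>S\<^esub> rho b t)"
        by (simp only: sum s t)
      also have "\<dots> = (\<Oplus>\<^bsub>S\<^esub>b\<in>B. b \<otimes>\<^bsub>S\<^esub> rho b s \<oplus>\<^bsub>S\<^esub> b \<otimes>\<^bsub>S\<^esub> rho b t)"
        using s t by (intro S.finsum_addf[symmetric]) (auto simp: clS B_sub)
      also have "\<dots> = (\<Oplus>\<^bsub>S\<^esub>b\<in>B. b \<otimes>\<^bsub>S\<^esub> (rho b s \<oplus>\<^bsub>S\<^esub> rho b t))"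
        using s t by (intro S.finsum_cong') (auto simp: clS B_sub S.r_distr)
      finally have "rho b (s \<oplus>\<^bsub>S\<^esub> t) = rho b (\<Oplus>\<^bsub>S\<^esub>b\<in>B. b \<otimes>\<^bsub>S\<^esub> (rho b s \<oplus>\<^bsub>S\<^esub> rho b t))" by (rule arg_cong)
      also have "\<dots> = rho b s \<oplus>\<^bsub>S\<^esub> rho b t"
        using s t b by (intro coord) (auto simp: cl R_closed)
      finally show ?thesis by simp
    qed
    show "rho b (s \<otimes>\<^bsub>S\<^esub> a) = rho b s \<otimes>\<^bsub>A\<^esub> a" if a: "a \<in> carrier A" for a
    proof -
      have aR: "a \<in> R" "a \<in> carrier S" using a R_sub by auto
      have am: "(\<lambda>x. x \<otimes>\<^bsub>S\<^esub> a) \<in> hom (add_monoid S) (add_monoid S)"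
        using aR by (intro additiveI) (simp_all add: S.l_distr)
      have "s \<otimes>\<^bsub>S\<^esub> a = (\<Oplus>\<^bsub>S\<^esub>b\<in>B. b \<otimes>\<^bsub>S\<^esub> rho b s) \<otimes>\<^bsub>S\<^esub> a" by (simp only: sum s)
      also have "\<dots> = (\<Oplus>\<^bsub>S\<^esub>b\<in>B. b \<otimes>\<^bsub>S\<^esub> rho b s \<otimes>\<^bsub>S\<^esub> a)"
        using s by (intro additive_finsum[OF S.is_abelian_group S.is_abelian_group am]) (auto simp: clS B_sub)
      also have "\<dots> = (\<Oplus>\<^bsub>S\<^esub>b\<in>B. b \<otimes>\<^bsub>S\<^esub> (rho b s \<otimes>\<^bsub>S\<^esub> a))"
        using s aR by (intro S.finsum_cong') (auto simp: clS B_sub S.m_assoc)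
      finally have "rho b (s \<otimes>\<^bsub>S\<^esub> a) = rho b (\<Oplus>\<^bsub>S\<^esub>b\<in>B. b \<otimes>\<^bsub>S\<^esub> (rho b s \<otimes>\<^bsub>S\<^esub> a))" by (rule arg_cong)
      also have "\<dots> = rho b s \<otimes>\<^bsub>S\<^esub> a" using s b aR by (intro coord) (auto simp: cl R_closed)
      finally show ?thesis by simp
    qed
  next
    fix b c assume b: "b \<in> B" and c: "c \<in> B"
    show "rho c b = (if b = c then \<one>\<^bsub>A\<^esub> else \<zero>\<^bsub>A\<^esub>)"
    proof -
      have "(\<Oplus>\<^bsub>S\<^esub>d\<in>B. d \<otimes>\<^bsub>S\<^esub> (if b = d then \<one>\<^bsub>S\<^esub> else \<zero>\<^bsub>S\<^esub>)) = (\<Oplus>\<^bsub>S\<^esub>d\<in>B. if d = b then b else \<zero>\<^bsub>S\<^esub>)"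
        by (intro S.finsum_cong') (auto simp: B_sub)
      also have "\<dots> = b" by (rule S.finsum_delta[OF finite_B b B_sub[OF b]])
      finally have "rho c b = rho c (\<Oplus>\<^bsub>S\<^esub>d\<in>B. d \<otimes>\<^bsub>S\<^esub> (if b = d then \<one>\<^bsub>S\<^esub> else \<zero>\<^bsub>S\<^esub>))" by simp
      also have "\<dots> = (if b = c then \<one>\<^bsub>S\<^esub> else \<zero>\<^bsub>S\<^esub>)" using c by (intro coord) (auto simp: R_closed)
      finally show ?thesis by simp
    qed
  qed (simp_all add: finite_B B_sub cl sum)
  then show thesis by (rule that)
qed

text \<open>
  A basis element \<open>b\<close> induces the automorphism \<open>\<phi>\<close> of \<open>R\<close> with \<open>\<phi> r b = b r\<close>. Along \<open>\<phi>\<close>, just as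
  along the inclusion, \<open>S\<close> is free over \<open>R\<close>.
\<close>

lemma twisted_left_coordinates:
  assumes b: "b \<in> B"
  obtains \<phi> lam where "left_coordinates A S \<phi> B lam"
    "\<And>r. r \<in> R \<Longrightarrow> \<phi> r \<in> R" "\<And>r. r \<in> R \<Longrightarrow> \<phi> r \<otimes>\<^bsub>S\<^esub> b = b \<otimes>\<^bsub>S\<^esub> r"
proof -
  obtain lam where lam: "left_coordinates A S (\<lambda>r. r) B lam" and lam_b: "lam b b = \<one>\<^bsub>S\<^esub>"
    using left_coordinates_exist b by metis
  obtain rho where rho: "right_coordinates A S (\<lambda>r. r) B rho" by (rule right_coordinates_exist)
  interpret L: left_coordinates A S "\<lambda>r. r" B lam by (rule lam)
  interpret Q: right_coordinates A S "\<lambda>r. r" B rho by (rule rho)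
  note bS = B_sub[OF b]
  define \<phi> where "\<phi> r = lam b (b \<otimes>\<^bsub>S\<^esub> r)" for r
  define \<psi> where "\<psi> r = rho b (r \<otimes>\<^bsub>S\<^esub> b)" for r
  have lam_mult_b: "lam b (r \<otimes>\<^bsub>S\<^esub> b) = r" if "r \<in> R" for r
    using L.lam_mult[OF b _ bS, of r] that lam_b R_sub[OF that] by simp
  have rho_mult_b: "rho b (b \<otimes>\<^bsub>S\<^esub> r) = r" if "r \<in> R" for r
    using Q.rho_mult[OF b _ bS, of r] that Q.rho_basis[OF b b] R_sub[OF that] by simp
  have \<phi>R: "\<phi> r \<in> R" and \<phi>b: "\<phi> r \<otimes>\<^bsub>S\<^esub> b = b \<otimes>\<^bsub>S\<^esub> r" if r: "r \<in> R" for r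
  proof -
    have "b \<otimes>\<^bsub>S\<^esub> r \<in> (\<lambda>r. r \<otimes>\<^bsub>S\<^esub> b) ` R" unfolding normalizing[OF b] using r by (rule imageI)
    then obtain r' where r': "r' \<in> R" "b \<otimes>\<^bsub>S\<^esub> r = r' \<otimes>\<^bsub>S\<^esub> b" by blast
    then have "\<phi> r = r'" by (simp add: \<phi>_def lam_mult_b)
    then show "\<phi> r \<in> R" "\<phi> r \<otimes>\<^bsub>S\<^esub> b = b \<otimes>\<^bsub>S\<^esub> r" using r' by simp_all
  qed
  have \<psi>R: "\<psi> r \<in> R" and \<psi>b: "b \<otimes>\<^bsub>S\<^esub> \<psi> r = r \<otimes>\<^bsub>S\<^esub> b" if r: "r \<in> R" for r
  proof -
    have "r \<otimes>\<^bsub>S\<^esub> b \<in> (\<lambda>r. b \<otimes>\<^bsub>S\<^esub> r) ` R" unfolding normalizing[OF b, symmetric] using r by (rule imageI)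
    then obtain r' where r': "r' \<in> R" "r \<otimes>\<^bsub>S\<^esub> b = b \<otimes>\<^bsub>S\<^esub> r'" by blast
    then have "\<psi> r = r'" by (simp add: \<psi>_def rho_mult_b)
    then show "\<psi> r \<in> R" "b \<otimes>\<^bsub>S\<^esub> \<psi> r = r \<otimes>\<^bsub>S\<^esub> b" using r' by simp_all
  qed
  have \<phi>\<psi>: "\<phi> (\<psi> r) = r" if "r \<in> R" for r
    unfolding \<phi>_def \<psi>b[OF that] by (rule lam_mult_b[OF that])
  have \<psi>\<phi>: "\<psi> (\<phi> r) = r" if "r \<in> R" for r
    unfolding \<psi>_def \<phi>b[OF that] by (rule rho_mult_b[OF that])
  have \<phi>I: "\<phi> r = t" if "t \<in> R" "b \<otimes>\<^bsub>S\<^esub> r = t \<otimes>\<^bsub>S\<^esub> b" for r t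
    unfolding \<phi>_def that(2) by (rule lam_mult_b[OF that(1)])
  have \<phi>_add: "\<phi> (r \<oplus>\<^bsub>S\<^esub> s) = \<phi> r \<oplus>\<^bsub>S\<^esub> \<phi> s" if "r \<in> R" "s \<in> R" for r s
    by (rule \<phi>I) (simp_all add: that \<phi>R R_sub R_closed bS S.l_distr S.r_distr \<phi>b)
  have \<phi>_mult: "\<phi> (r \<otimes>\<^bsub>S\<^esub> s) = \<phi> r \<otimes>\<^bsub>S\<^esub> \<phi> s" if "r \<in> R" "s \<in> R" for r s
  proof (rule \<phi>I)
    show "\<phi> r \<otimes>\<^bsub>S\<^esub> \<phi> s \<in> R" using that by (simp add: \<phi>R R_closed)
    have "b \<otimes>\<^bsub>S\<^esub> (r \<otimes>\<^bsub>S\<^esub> s) = (b \<otimes>\<^bsub>S\<^esub> r) \<otimes>\<^bsub>S\<^esub> s" using that by (simp add: R_sub bS S.m_assoc)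
    also have "\<dots> = \<phi> r \<otimes>\<^bsub>S\<^esub> (b \<otimes>\<^bsub>S\<^esub> s)"
      unfolding \<phi>b[OF that(1), symmetric] using that by (simp add: R_sub \<phi>R bS S.m_assoc)
    also have "\<dots> = (\<phi> r \<otimes>\<^bsub>S\<^esub> \<phi> s) \<otimes>\<^bsub>S\<^esub> b"
      unfolding \<phi>b[OF that(2), symmetric] using that by (simp add: R_sub \<phi>R bS S.m_assoc)
    finally show "b \<otimes>\<^bsub>S\<^esub> (r \<otimes>\<^bsub>S\<^esub> s) = (\<phi> r \<otimes>\<^bsub>S\<^esub> \<phi> s) \<otimes>\<^bsub>S\<^esub> b" .
  qed
  have \<psi>_add: "\<psi> (r \<oplus>\<^bsub>S\<^esub> s) = \<psi> r \<oplus>\<^bsub>S\<^esub> \<psi> s" if "r \<in> R" "s \<in> R" for r s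
    using \<psi>\<phi>[of "\<psi> r \<oplus>\<^bsub>S\<^esub> \<psi> s"] that by (simp add: \<psi>R R_closed \<phi>_add \<phi>\<psi>)
  have \<psi>_mult: "\<psi> (r \<otimes>\<^bsub>S\<^esub> s) = \<psi> r \<otimes>\<^bsub>S\<^esub> \<psi> s" if "r \<in> R" "s \<in> R" for r s
    using \<psi>\<phi>[of "\<psi> r \<otimes>\<^bsub>S\<^esub> \<psi> s"] that by (simp add: \<psi>R R_closed \<phi>_mult \<phi>\<psi>)
  have lamR: "lam c s \<in> R" if "c \<in> B" "s \<in> carrier S" for c s
    using L.lam_closed[OF that] by simp
  have "left_coordinates A S \<phi> B (\<lambda>c s. \<psi> (lam c s))"
  proof (unfold_locales)
    show "\<phi> \<in> ring_hom A S"
    proof (rule ring_hom_memI)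
      show "\<phi> \<one>\<^bsub>A\<^esub> = \<one>\<^bsub>S\<^esub>" by (rule \<phi>I) (simp_all add: bS R_closed)
    qed (simp_all add: \<phi>R R_sub \<phi>_add \<phi>_mult)
    fix c s assume c: "c \<in> B" and s: "s \<in> carrier S"
    show "\<psi> (lam c s) \<in> carrier A" using c s by (simp add: lamR \<psi>R)
    show "\<psi> (lam c (s \<oplus>\<^bsub>S\<^esub> t)) = \<psi> (lam c s) \<oplus>\<^bsub>A\<^esub> \<psi> (lam c t)" if "t \<in> carrier S" for t
      using c s that by (simp add: L.lam_add \<psi>_add lamR)
    show "\<psi> (lam c (\<phi> a \<otimes>\<^bsub>S\<^esub> s)) = a \<otimes>\<^bsub>A\<^esub> \<psi> (lam c s)" if "a \<in> carrier A" for a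
      using c s that L.lam_mult[of c "\<phi> a" s] by (simp add: \<phi>R \<psi>_mult lamR \<psi>\<phi>)
  next
    fix s assume s: "s \<in> carrier S"
    have "(\<Oplus>\<^bsub>S\<^esub>c\<in>B. \<phi> (\<psi> (lam c s)) \<otimes>\<^bsub>S\<^esub> c) = (\<Oplus>\<^bsub>S\<^esub>c\<in>B. lam c s \<otimes>\<^bsub>S\<^esub> c)"
      using s by (intro S.finsum_cong') (auto simp: lamR \<phi>\<psi> R_sub B_sub)
    then show "(\<Oplus>\<^bsub>S\<^esub>c\<in>B. \<phi> (\<psi> (lam c s)) \<otimes>\<^bsub>S\<^esub> c) = s" by (simp only: L.lam_sum[OF s])
  qed (simp_all add: finite_B B_sub)
  then show thesis using \<phi>R \<phi>b by (rule that)
qed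

end


section \<open>Excellent extensions\<close>

text \<open>The complement is the image of the section.\<close>

lemma kernel_direct_summand_of_section:
  assumes X: "left_module A X" and M: "left_module A M"
    and f: "f \<in> lmod_hom A X M" and g: "g \<in> lmod_hom A M X" and fg: "\<And>x. x \<in> carrier M \<Longrightarrow> f (g x) = x"
  shows "direct_summand A X (a_kernel X M f)"
  unfolding direct_summand_def
proof (intro conjI exI)
  interpret X: left_module A X by fact
  interpret M: left_module A M by fact
  note fD = lmod_homD[OF f] and gD = lmod_homD[OF g]
  show "submodule (a_kernel X M f) A X" by (rule kernel_submodule[OF f X M])
  show "submodule (g ` carrier M) A X" by (rule image_submodule[OF g M X])
  show "a_kernel X M f <+>\<^bsub>X\<^esub> g ` carrier M = carrier X"
  proof (intro equalityI subsetI)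
    fix x assume x: "x \<in> carrier X"
    let ?k = "x \<oplus>\<^bsub>X\<^esub> \<ominus>\<^bsub>X\<^esub> g (f x)"
    have gf: "g (f x) \<in> carrier X" "f x \<in> carrier M" using x by (auto simp: fD gD)
    have "f ?k = \<zero>\<^bsub>M\<^esub>" using x gf by (simp add: fD lmod_hom_neg[OF f X M] fg M.M.r_neg)
    then have "?k \<in> a_kernel X M f" using x gf by (simp add: a_kernel_iff)
    moreover have "x = ?k \<oplus>\<^bsub>X\<^esub> g (f x)" using x gf by (simp add: X.M.a_assoc X.M.l_neg)
    ultimately show "x \<in> a_kernel X M f <+>\<^bsub>X\<^esub> g ` carrier M"
      unfolding set_add_def' using gf(2) by blast
  qed (auto simp: set_add_def' a_kernel_iff gD)
  show "a_kernel X M f \<inter> g ` carrier M = {\<zero>\<^bsub>X\<^esub>}"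
  proof (intro equalityI subsetI)
    fix x assume "x \<in> a_kernel X M f \<inter> g ` carrier M"
    then obtain y where y: "y \<in> carrier M" "x = g y" "f x = \<zero>\<^bsub>M\<^esub>" by (auto simp: a_kernel_iff)
    then have "y = \<zero>\<^bsub>M\<^esub>" using fg by simp
    then show "x \<in> {\<zero>\<^bsub>X\<^esub>}" using y(2) by (simp add: lmod_hom_zero[OF g M X])
  next
    fix x assume "x \<in> {\<zero>\<^bsub>X\<^esub>}"
    then show "x \<in> a_kernel X M f \<inter> g ` carrier M"
      using lmod_hom_zero[OF f X M] lmod_hom_zero[OF g M X] M.M.zero_closed
      by (auto simp: a_kernel_iff intro: image_eqI[of _ _ "\<zero>\<^bsub>M\<^esub>"])
  qed
qed

text \<open>The map \<open>f\<close> restricts to an isomorphism on any complement of its kernel.\<close>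

lemma section_of_kernel_direct_summand:
  assumes X: "left_module A X" and M: "left_module A M"
    and f: "f \<in> lmod_hom A X M" and onto: "f ` carrier X = carrier M"
    and ds: "direct_summand A X (a_kernel X M f)"
  shows "\<exists>i\<in>lmod_hom A M X. \<forall>x\<in>carrier M. f (i x) = x"
proof -
  interpret X: left_module A X by fact
  interpret M: left_module A M by fact
  note fD = lmod_homD[OF f]
  obtain N where N: "submodule N A X" "a_kernel X M f <+>\<^bsub>X\<^esub> N = carrier X"
    "a_kernel X M f \<inter> N = {\<zero>\<^bsub>X\<^esub>}"
    using ds unfolding direct_summand_def by blast
  interpret N: submodule N A X by (rule N(1))
  have sub: "x \<in> N \<Longrightarrow> x \<in> carrier X" for x using N.subset by auto
  let ?N = "X\<lparr>carrier := N\<rparr>"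
  have lN: "left_module A ?N" by (rule submodule_left_module[OF X N(1)])
  have fN: "f \<in> lmod_hom A ?N M" using f sub by (auto simp: lmod_hom_def)
  have "inj_on f (carrier ?N)"
  proof (rule lmod_hom_inj_onI[OF fN lN M])
    fix x assume "x \<in> carrier ?N" "f x = \<zero>\<^bsub>M\<^esub>"
    then have "x \<in> a_kernel X M f \<inter> N" using sub by (simp add: a_kernel_iff)
    then show "x = \<zero>\<^bsub>?N\<^esub>" unfolding N(3) by simp
  qed
  moreover have "f ` carrier ?N = carrier M"
  proof (intro equalityI subsetI)
    fix y assume "y \<in> carrier M"
    then obtain x where x: "x \<in> carrier X" "y = f x" unfolding onto[symmetric] by blast
    then obtain k n where kn: "k \<in> a_kernel X M f" "n \<in> N" "x = k \<oplus>\<^bsub>X\<^esub> n"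
      unfolding N(2)[symmetric] set_add_def' by blast
    then have "y = f n" using x sub fD by (simp add: a_kernel_iff)
    then show "y \<in> f ` carrier ?N" using kn(2) by simp
  qed (use fD(1) sub in auto)
  ultimately have bij: "bij_betw f (carrier ?N) (carrier M)" by (simp add: bij_betw_def)
  show ?thesis
  proof (intro bexI[of _ "inv_into (carrier ?N) f"] ballI)
    have i: "inv_into (carrier ?N) f \<in> lmod_hom A M ?N" by (rule lmod_hom_inv_into(1)[OF fN bij lN])
    show "inv_into (carrier ?N) f \<in> lmod_hom A M X"
      by (rule lmod_homI) (use lmod_homD[OF i] sub in simp_all)
    show "f (inv_into (carrier ?N) f x) = x" if "x \<in> carrier M" for x
      by (rule bij_betw_inv_into_right[OF bij that])
  qed
qed

lemma restrict_scalars_id: "restrict_scalars (\<lambda>r. r) M = M"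
  by (simp add: restrict_scalars_def)

context free_extension
begin

text \<open>
  The multiplication map \<open>S \<otimes> K \<rightarrow> K\<close> has the \<open>R\<close>-linear section \<open>x \<mapsto> 1 \<otimes> x\<close>, so its kernel is a
  direct summand over \<open>R\<close>. The first condition on an excellent extension makes the kernel a
  direct summand over \<open>S\<close>.
\<close>

lemma ext_dim_over_S_le:
  assumes excellent: "\<And>M N. M \<in> fg_mods S \<Longrightarrow> submodule N S M \<Longrightarrow> direct_summand A M N \<Longrightarrow>
    direct_summand S M N"
  shows "ext_dim S (syzygies S j (fg_mods S)) \<le> ext_dim A (syzygies A j (fg_mods A))"
    and "ext_dim S (syzygies S j (fin_proj_dim_mods S)) \<le> ext_dim A (syzygies A j (fin_proj_dim_mods A))"
proof -
  obtain lam where "left_coordinates A S (\<lambda>r. r) B lam" by (rule left_coordinates_exist)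
  moreover obtain rho where "right_coordinates A S (\<lambda>r. r) B rho" by (rule right_coordinates_exist)
  ultimately interpret C: two_sided_coordinates A S "\<lambda>r. r" B lam B rho
    by (rule two_sided_coordinates.intro)
  have "\<exists>i\<in>lmod_hom S K (C.ind (restrict_scalars (\<lambda>r. r) K)).
      \<exists>p\<in>lmod_hom S (C.ind (restrict_scalars (\<lambda>r. r) K)) K. \<forall>x\<in>carrier K. p (i x) = x"
    if K: "K \<in> fg_mods S" for K
    unfolding restrict_scalars_id
  proof -
    have lK: "left_module S K" "left_module A K" and fgA: "K \<in> fg_mods A"
      using fg_modsD(1)[OF K] C.restrict_left_module[of K] C.restrict_fg_mods[OF K]
      by (simp_all add: restrict_scalars_id)
    have X: "C.ind K \<in> fg_mods S" by (rule C.ind_fg_mods[OF fgA])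
    have lX: "left_module S (C.ind K)" "left_module A (C.ind K)"
      using fg_modsD(1)[OF X] C.restrict_left_module[of "C.ind K"] by (simp_all add: restrict_scalars_id)
    let ?\<mu> = "C.extend K (\<lambda>x. x)"
    have \<mu>: "?\<mu> \<in> lmod_hom S (C.ind K) K"
      by (rule C.extend_hom[OF lK(2,1)]) (simp only: restrict_scalars_id lmod_hom_id)
    have \<mu>A: "?\<mu> \<in> lmod_hom A (C.ind K) K"
      using C.restrict_hom[OF \<mu>] by (simp only: restrict_scalars_id)
    have u: "C.tensor K \<one>\<^bsub>S\<^esub> \<in> lmod_hom A K (C.ind K)"
      using C.unit_hom[OF lK(2)] by (simp only: restrict_scalars_id)
    have \<mu>u: "?\<mu> (C.tensor K \<one>\<^bsub>S\<^esub> x) = x" if "x \<in> carrier K" for x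
      using C.extend_tensor_one[OF lK(1) that] by (simp only: restrict_scalars_id)
    have "direct_summand A (C.ind K) (a_kernel (C.ind K) K ?\<mu>)"
      by (rule kernel_direct_summand_of_section[OF lX(2) lK(2) \<mu>A u \<mu>u])
    then have ds: "direct_summand S (C.ind K) (a_kernel (C.ind K) K ?\<mu>)"
      by (rule excellent[OF X kernel_submodule[OF \<mu> lX(1) lK(1)]])
    have "?\<mu> ` carrier (C.ind K) = carrier K"
    proof (intro equalityI subsetI)
      fix x assume x: "x \<in> carrier K"
      show "x \<in> ?\<mu> ` carrier (C.ind K)"
        by (rule image_eqI[where f = ?\<mu>, OF \<mu>u[OF x, symmetric] lmod_homD(1)[OF u x]])
    qed (use lmod_homD(1)[OF \<mu>] in blast)
    then have "\<exists>i\<in>lmod_hom S K (C.ind K). \<forall>x\<in>carrier K. ?\<mu> (i x) = x"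
      by (rule section_of_kernel_direct_summand[OF lX(1) lK(1) \<mu> _ ds])
    then show "\<exists>i\<in>lmod_hom S K (C.ind K). \<exists>p\<in>lmod_hom S (C.ind K) K. \<forall>x\<in>carrier K. p (i x) = x"
      by (elim bexE) (rule bexI, rule bexI[OF _ \<mu>])
  qed
  from ext_dim_syzygies_le_of_retract[OF C.restrict_exact_functor C.ind_exact_functor this]
  show "ext_dim S (syzygies S j (fg_mods S)) \<le> ext_dim A (syzygies A j (fg_mods A))"
    "ext_dim S (syzygies S j (fin_proj_dim_mods S)) \<le> ext_dim A (syzygies A j (fin_proj_dim_mods A))"
    by simp_all
qed

text \<open>
  Over \<open>R\<close>, the induced module \<open>S \<otimes> K\<close> is the direct sum of the \<open>b \<otimes> K\<close>, and \<open>b \<otimes> K\<close> is \<open>K\<close> with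
  scalars twisted by an automorphism \<open>\<phi>\<close> of \<open>R\<close>. Since \<open>1\<close> need not belong to the basis, \<open>K\<close> itself
  is recovered by restricting along \<open>\<phi>\<close>, for any fixed \<open>b\<close>, instead of along the inclusion.
\<close>

lemma ext_dim_over_R_le:
  shows "ext_dim A (syzygies A j (fg_mods A)) \<le> ext_dim S (syzygies S j (fg_mods S))"
    and "ext_dim A (syzygies A j (fin_proj_dim_mods A)) \<le> ext_dim S (syzygies S j (fin_proj_dim_mods S))"
proof -
  obtain lam where lam: "left_coordinates A S (\<lambda>r. r) B lam" by (rule left_coordinates_exist)
  obtain rho where rho: "right_coordinates A S (\<lambda>r. r) B rho" by (rule right_coordinates_exist)
  interpret C: two_sided_coordinates A S "\<lambda>r. r" B lam B rho
    using lam rho by (rule two_sided_coordinates.intro)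
  have "\<exists>G T. exact_functor S A G T \<and> (\<forall>K\<in>fg_mods A. \<exists>i\<in>lmod_hom A K (G (C.ind K)).
      \<exists>p\<in>lmod_hom A (G (C.ind K)) K. \<forall>x\<in>carrier K. p (i x) = x)"
  proof (cases "B = {}")
    case True
    \<comment> \<open>An empty basis means that \<open>S\<close> is the zero ring, and then all modules are zero.\<close>
    have "\<one>\<^bsub>S\<^esub> = \<zero>\<^bsub>S\<^esub>" using C.lam_sum[OF S.one_closed] True by simp
    then have one: "\<one>\<^bsub>A\<^esub> = \<zero>\<^bsub>A\<^esub>" by simp
    have "\<exists>i\<in>lmod_hom A K (restrict_scalars (\<lambda>r. r) (C.ind K)).
      \<exists>p\<in>lmod_hom A (restrict_scalars (\<lambda>r. r) (C.ind K)) K. \<forall>x\<in>carrier K. p (i x) = x"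
      if K: "K \<in> fg_mods A" for K
    proof (intro bexI ballI)
      interpret K: left_module A K by (rule fg_modsD(1)[OF K])
      interpret I: left_module A "restrict_scalars (\<lambda>r. r) (C.ind K)"
        by (rule C.restrict_left_module[OF C.ind_left_module[OF fg_modsD(1)[OF K]]])
      let ?I = "restrict_scalars (\<lambda>r. r) (C.ind K)"
      show "(\<lambda>_. \<zero>\<^bsub>?I\<^esub>) \<in> lmod_hom A K ?I"
        by (rule lmod_homI) (use I.M.zero_closed I.smult_zero in \<open>simp_all only: I.M.l_zero\<close>)
      show "(\<lambda>_. \<zero>\<^bsub>K\<^esub>) \<in> lmod_hom A ?I K"
        by (rule lmod_homI) (use K.M.zero_closed K.smult_zero in \<open>simp_all only: K.M.l_zero\<close>)
      fix x assume x: "x \<in> carrier K"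
      have "\<one>\<^bsub>A\<^esub> \<odot>\<^bsub>K\<^esub> x = \<zero>\<^bsub>K\<^esub>" unfolding one by (rule K.zero_smult[OF x])
      then show "\<zero>\<^bsub>K\<^esub> = x" using K.smult_one[OF x] by (simp only:)
    qed
    then show ?thesis
      by (intro exI[of _ "restrict_scalars (\<lambda>r. r)"] exI[of _ "\<lambda>M N f. f"] conjI ballI
          C.restrict_exact_functor)
  next
    case False
    then obtain b where b: "b \<in> B" by blast
    obtain \<phi> lam' where \<phi>: "left_coordinates A S \<phi> B lam'"
      "\<And>r. r \<in> R \<Longrightarrow> \<phi> r \<in> R" "\<And>r. r \<in> R \<Longrightarrow> \<phi> r \<otimes>\<^bsub>S\<^esub> b = b \<otimes>\<^bsub>S\<^esub> r"
      using twisted_left_coordinates[OF b] by blast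
    have \<phi>B: "\<exists>a\<in>carrier A. \<phi> r \<otimes>\<^bsub>S\<^esub> c = c \<otimes>\<^bsub>S\<^esub> a" if "r \<in> carrier A" "c \<in> B" for r c
    proof -
      have "\<phi> r \<otimes>\<^bsub>S\<^esub> c \<in> (\<lambda>r. c \<otimes>\<^bsub>S\<^esub> r) ` R"
        unfolding normalizing[OF that(2), symmetric] using that(1) \<phi>(2) by simp
      then show ?thesis by auto
    qed
    have "\<exists>i\<in>lmod_hom A K (restrict_scalars \<phi> (C.ind K)).
      \<exists>p\<in>lmod_hom A (restrict_scalars \<phi> (C.ind K)) K. \<forall>x\<in>carrier K. p (i x) = x"
      if K: "K \<in> fg_mods A" for K
    proof -
      have "\<phi> r \<in> carrier S" "\<phi> r \<otimes>\<^bsub>S\<^esub> b = b \<otimes>\<^bsub>S\<^esub> r" if "r \<in> carrier A" for r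
        using that \<phi>(2,3) R_sub by simp_all
      note retract = C.retract_of_restricted_ind[OF fg_modsD(1)[OF K] b this \<phi>B]
      show ?thesis using retract(3) by (intro bexI[OF _ retract(1)] bexI[OF _ retract(2)] ballI)
    qed
    then show ?thesis
      by (intro exI[of _ "restrict_scalars \<phi>"] exI[of _ "\<lambda>M N f. f"] conjI ballI
          left_coordinates.restrict_exact_functor[OF \<phi>(1)])
  qed
  then obtain G T where G: "exact_functor S A G T" and r: "\<And>K. K \<in> fg_mods A \<Longrightarrow>
      \<exists>i\<in>lmod_hom A K (G (C.ind K)). \<exists>p\<in>lmod_hom A (G (C.ind K)) K. \<forall>x\<in>carrier K. p (i x) = x"
    by (elim exE conjE) (rule that, assumption, erule (1) bspec)
  from ext_dim_syzygies_le_of_retract[OF C.ind_exact_functor G r]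
  show "ext_dim A (syzygies A j (fg_mods A)) \<le> ext_dim S (syzygies S j (fg_mods S))"
    "ext_dim A (syzygies A j (fin_proj_dim_mods A)) \<le> ext_dim S (syzygies S j (fin_proj_dim_mods S))"
    by simp_all
qed

end

theorem theorem1p1:
  fixes k :: "('k, 'l) ring_scheme" and S :: "('a, 'r) ring_scheme" and R :: "'a set"
    and \<eta>\<^sub>R \<eta>\<^sub>S :: "'k \<Rightarrow> 'a" and j :: nat
  assumes "artin_algebra k \<eta>\<^sub>R (S\<lparr>carrier := R\<rparr>)"
    and "artin_algebra k \<eta>\<^sub>S S"
    and "excellent_extension R S"
  shows "ext_dim (S\<lparr>carrier := R\<rparr>) (syzygies (S\<lparr>carrier := R\<rparr>) j (fg_mods (S\<lparr>carrier := R\<rparr>))) =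
      ext_dim S (syzygies S j (fg_mods S)) \<and>
    ext_dim (S\<lparr>carrier := R\<rparr>) (syzygies (S\<lparr>carrier := R\<rparr>) j (fin_proj_dim_mods (S\<lparr>carrier := R\<rparr>))) =
      ext_dim S (syzygies S j (fin_proj_dim_mods S))"
proof -
  note ex = assms(3)[unfolded excellent_extension_def]
  have RS: "ring S" "subring R S" using ex by simp_all
  from ex[THEN conjunct2, THEN conjunct2, THEN conjunct2]
  obtain B where B: "free_left_basis R S B" "free_right_basis R S B"
    "\<And>b. b \<in> B \<Longrightarrow> (\<lambda>r. r \<otimes>\<^bsub>S\<^esub> b) ` R = (\<lambda>r. b \<otimes>\<^bsub>S\<^esub> r) ` R"
    by (elim conjE exE) (rule that, assumption+, erule (1) bspec)
  interpret free_extension R S B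
    by (intro free_extension.intro free_extension_axioms.intro RS B)
  have excellent: "direct_summand S M N"
    if "M \<in> fg_mods S" "submodule N S M" "direct_summand (S\<lparr>carrier := R\<rparr>) M N" for M N
    using ex[THEN conjunct2, THEN conjunct2, THEN conjunct1, rule_format, OF that] .
  show ?thesis
    by (intro conjI antisym ext_dim_over_R_le ext_dim_over_S_le[OF excellent])
qed
end
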